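(* Let $\Omega\subset\mathbb R^N$, $N\ge2$, be a smooth bounded domain, let $\lambda<0$ and let $u_\lambda$ be a family of negative solutions to $$-\Delta u=\lambda e^u\ \text{ in }\Omega,\qquad u=0\ \text{ on }\partial\Omega.$$ Then $$u_\lambda=-\log(-\lambda)+v+o(1)\quad\text{in }C^\infty_{\mathrm{loc}}(\Omega)\ \text{as }\lambda\to-\infty,$$ and $v$ is the unique positive solution to $$\Delta v=e^v\ \text{ in }\Omega,\qquad v(x)\to+\infty\ \text{ as }x\to\partial\Omega.$$
   Formalization: Positivity of v is not claimed, as it fails on large domains (on a planar disc of radius R, v(0)=log(8/R²)<0 if R²>8); instead v is shown to be the unique solution among all boundary blow-up solutions, of any sign. *)

theory Defs
  imports "HOL-Analysis.Analysis"
begin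

definition partial_derivative ::
  "'a::euclidean_space \<Rightarrow> ('a \<Rightarrow> real) \<Rightarrow> 'a \<Rightarrow> real" where
  "partial_derivative b f x = frechet_derivative f (at x) b"

text \<open>The list is read as the multi-index notation
  \<open>\<partial>\<^sub>b\<^sub>1 \<dots> \<partial>\<^sub>b\<^sub>k f\<close> for \<open>bs = [b1, \<dots>, bk]\<close>, with each \<open>bi\<close> a basis vector.\<close>

definition iterated_partial ::
  "'a::euclidean_space list \<Rightarrow> ('a \<Rightarrow> real) \<Rightarrow> 'a \<Rightarrow> real" where
  "iterated_partial bs f = foldr partial_derivative bs f"

definition laplacian :: "('a::euclidean_space \<Rightarrow> real) \<Rightarrow> 'a \<Rightarrow> real" where
  "laplacian f x = (\<Sum>b\<in>Basis. partial_derivative b (partial_derivative b f) x)"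

text \<open>\<open>C\<^sup>k(S)\<close>, to be used for open \<open>S\<close>: only there does \<open>at x\<close> depend on the values on \<open>S\<close> alone.\<close>

primrec Ck_on :: "nat \<Rightarrow> 'a::euclidean_space set \<Rightarrow> ('a \<Rightarrow> real) \<Rightarrow> bool" where
  "Ck_on 0 S f \<longleftrightarrow> continuous_on S f"
| "Ck_on (Suc k) S f \<longleftrightarrow>
     (\<forall>x\<in>S. f differentiable (at x)) \<and> (\<forall>b\<in>Basis. Ck_on k S (partial_derivative b f))"

definition Cinf_on :: "'a::euclidean_space set \<Rightarrow> ('a \<Rightarrow> real) \<Rightarrow> bool" where
  "Cinf_on S f \<longleftrightarrow> (\<forall>k. Ck_on k S f)"

text \<open>Smooth boundary in the usual sense: in suitable orthonormal coordinates, with last axis along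
  the unit vector \<open>\<nu>\<close>, the domain is near each boundary point the region above the graph of a smooth
  function of the other \<open>N - 1\<close> coordinates. As there is no type for the hyperplane orthogonal to
  \<open>\<nu>\<close>, the graph function \<open>\<gamma>\<close> is defined on the whole space but only evaluated at the orthogonal
  projection of \<open>x\<close> to that hyperplane.\<close>

definition smooth_bounded_domain :: "'a::euclidean_space set \<Rightarrow> bool" where
  "smooth_bounded_domain \<Omega> \<longleftrightarrow>
     \<Omega> \<noteq> {} \<and> open \<Omega> \<and> connected \<Omega> \<and> bounded \<Omega> \<and>
     (\<forall>z\<in>frontier \<Omega>. \<exists>r>0. \<exists>\<nu> \<gamma>. norm \<nu> = 1 \<and> Cinf_on UNIV \<gamma> \<and>
        \<Omega> \<inter> ball z r = {x \<in> ball z r. x \<bullet> \<nu> > \<gamma> (x - (x \<bullet> \<nu>) *\<^sub>R \<nu>)})"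

definition negative_solution ::
  "'a::euclidean_space set \<Rightarrow> real \<Rightarrow> ('a \<Rightarrow> real) \<Rightarrow> bool" where
  "negative_solution \<Omega> l u \<longleftrightarrow>
     Ck_on 2 \<Omega> u \<and> continuous_on (closure \<Omega>) u \<and>
     (\<forall>x\<in>\<Omega>. - laplacian u x = l * exp (u x)) \<and>
     (\<forall>x\<in>frontier \<Omega>. u x = 0) \<and>
     (\<forall>x\<in>\<Omega>. u x < 0)"

text \<open>No sign is imposed on \<open>v\<close>: the boundary condition makes \<open>v\<close> positive near the boundary, but not
  in the interior. On the disc of radius \<open>R\<close> in the plane the solution is
  \<open>ln (8 R\<^sup>2 / (R\<^sup>2 - |x|\<^sup>2)\<^sup>2)\<close>, with the value \<open>ln (8 / R\<^sup>2)\<close> at the centre.\<close>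

definition boundary_blowup_solution ::
  "'a::euclidean_space set \<Rightarrow> ('a \<Rightarrow> real) \<Rightarrow> bool" where
  "boundary_blowup_solution \<Omega> v \<longleftrightarrow>
     Ck_on 2 \<Omega> v \<and>
     (\<forall>x\<in>\<Omega>. laplacian v x = exp (v x)) \<and>
     (\<forall>z\<in>frontier \<Omega>. filterlim v at_top (at z within \<Omega>))"

text \<open>Convergence in \<open>C\<^sup>\<infinity>\<^sub>l\<^sub>o\<^sub>c(\<Omega>)\<close>: uniform convergence of all partial derivatives, of every order
  (including \<open>0\<close>), on every compact subset.\<close>

definition tendsto_Cinf_loc ::
  "'a::euclidean_space set \<Rightarrow> ('i \<Rightarrow> 'a \<Rightarrow> real) \<Rightarrow> ('a \<Rightarrow> real) \<Rightarrow> 'i filter \<Rightarrow> bool" where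
  "tendsto_Cinf_loc \<Omega> f g F \<longleftrightarrow>
     Cinf_on \<Omega> g \<and> (\<forall>\<^sub>F i in F. Cinf_on \<Omega> (f i)) \<and>
     (\<forall>K bs. compact K \<and> K \<subseteq> \<Omega> \<and> set bs \<subseteq> Basis \<longrightarrow>
        uniform_limit K (\<lambda>i. iterated_partial bs (f i)) (iterated_partial bs g) F)"

end

theory Submission
  imports Defs
begin

text \<open>
  Put \<open>w = u\<^sub>\<lambda> + ln (-\<lambda>)\<close>. Then \<open>\<Delta>w = e\<^sup>w\<close> in \<open>\<Omega>\<close>, an equation from which \<open>\<lambda>\<close> has disappeared, and
  \<open>w = ln (-\<lambda>)\<close> on the boundary. Letting \<open>\<lambda> \<rightarrow> -\<infinity>\<close> therefore means pushing constant boundary values \<open>c\<close>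
  to \<open>+\<infinity>\<close> in one fixed equation. As the exponential is increasing, solutions obey a comparison
  principle. So the solutions \<open>w\<^sub>c\<close> increase with \<open>c\<close>, and the explicit blow-up supersolutions on balls
  (\<open>Keller_Osserman_bound\<close>) bound them on compact sets independently of \<open>c\<close>. Their limit \<open>v\<close> exceeds
  every \<open>w\<^sub>c\<close>, hence it is infinite on the boundary.

  The regularity theory rests on the maximum principle alone. Reflecting a function in a hyperplane
  and comparing its odd part with a quadratic polynomial on a half ball gives
  \<open>|\<nabla>f(x)| \<le> C (sup |f| / r + r sup |\<Delta>f|)\<close> (\<open>gradient_estimate\<close>). Applied to differences of \<open>C\<^sup>2\<close>
  functions, it shows that locally uniform convergence of \<open>f\<^sub>n\<close> and of \<open>\<Delta>f\<^sub>n\<close> implies locally uniform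
  convergence of \<open>\<nabla>f\<^sub>n\<close> (\<open>partial_derivatives_uniform_limit\<close>). This has three uses.

  \<^item> Second difference quotients of a \<open>C\<^sup>2\<close> function \<open>f\<close> converge to the second derivatives of \<open>f\<close>,
    and their Laplacians are the second difference quotients of \<open>\<Delta>f\<close>. If \<open>\<Delta>f\<close> is \<open>C\<^sup>2\<close>, it
    follows that the second derivatives of \<open>f\<close> are \<open>C\<^sup>1\<close>. Bootstrapping in \<open>\<Delta>w = e\<^sup>w\<close> makes every solution
    smooth (\<open>Cinf_on_if_laplacian_eq_exp\<close>).
  \<^item> Used twice on \<open>w\<^sub>n \<rightarrow> v\<close>, it shows that \<open>v\<close> is \<open>C\<^sup>2\<close> and solves the equation
    (\<open>large_solution_limit\<close>).
  \<^item> Convergence of \<open>w\<^sub>c\<close> to \<open>v\<close> with \<open>k\<close> derivatives passes to \<open>\<Delta>w\<^sub>c = exp w\<^sub>c\<close> and thereby gains one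
    more derivative (\<open>Ck_tendsto_if_laplacian_eq_exp\<close>).

  For uniqueness, \<open>v\<close> lies below every blow-up solution \<open>w\<close>, because each \<open>w\<^sub>c\<close> does. In a smooth
  domain the exterior balls have a common radius, and a barrier on the complement of such a ball gives
  \<open>v \<ge> -2 ln d - C\<close>, where \<open>d\<close> is the distance to the boundary; the supersolutions on balls give
  \<open>w \<le> -2 ln d + C\<close>. So \<open>w - v\<close> is bounded and \<open>2v - w = v - (w - v)\<close> still blows up at the boundary. By
  convexity of the exponential \<open>2v - w\<close> is a supersolution, so it lies above each \<open>w\<^sub>c\<close> and hence above \<open>v\<close>,
  which says \<open>w \<le> v\<close> (\<open>boundary_blowup_solution_unique\<close>).
\<close>


section \<open>Calculus of partial derivatives\<close>

lemma partial_derivative_eqI: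
  "(f has_derivative f') (at x) \<Longrightarrow> partial_derivative b f x = f' b"
  unfolding partial_derivative_def by (simp add: frechet_derivative_at[symmetric])

lemma has_derivative_partial_derivatives:
  fixes f :: "'a::euclidean_space \<Rightarrow> real"
  assumes "f differentiable (at x)"
  shows "(f has_derivative (\<lambda>h. \<Sum>b\<in>Basis. (h \<bullet> b) * partial_derivative b f x)) (at x)"
proof -
  have D: "(f has_derivative frechet_derivative f (at x)) (at x)"
    using assms frechet_derivative_works by blast
  then have lin: "linear (frechet_derivative f (at x))"
    using has_derivative_linear by blast
  have "frechet_derivative f (at x) h = (\<Sum>b\<in>Basis. (h \<bullet> b) * partial_derivative b f x)" for h
  proof -
    have "frechet_derivative f (at x) h = frechet_derivative f (at x) (\<Sum>b\<in>Basis. (h \<bullet> b) *\<^sub>R b)"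
      by (simp add: euclidean_representation)
    then show ?thesis
      by (simp add: linear_sum[OF lin] linear_scale[OF lin] partial_derivative_def)
  qed
  then have "frechet_derivative f (at x) = (\<lambda>h. \<Sum>b\<in>Basis. (h \<bullet> b) * partial_derivative b f x)"
    by blast
  with D show ?thesis by simp
qed

lemma has_real_derivative_partial_along_axis:
  fixes f :: "'a::euclidean_space \<Rightarrow> real"
  assumes "f differentiable (at (x + t *\<^sub>R b))" "b \<in> Basis"
  shows "((\<lambda>t. f (x + t *\<^sub>R b)) has_real_derivative partial_derivative b f (x + t *\<^sub>R b)) (at t within T)"
proof -
  have "((\<lambda>t. f (x + t *\<^sub>R b)) has_derivative
        (\<lambda>h. frechet_derivative f (at (x + t *\<^sub>R b)) (h *\<^sub>R b))) (at t within T)"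
    by (rule has_derivative_compose[where g = f])
       (use assms in \<open>auto intro!: derivative_eq_intros simp: frechet_derivative_works\<close>)
  moreover have "frechet_derivative f (at (x + t *\<^sub>R b)) (h *\<^sub>R b)
        = partial_derivative b f (x + t *\<^sub>R b) * h" for h
    using linear_scale[OF linear_frechet_derivative[OF assms(1)]]
    by (simp add: partial_derivative_def)
  ultimately show ?thesis
    by (simp add: has_field_derivative_def)
qed

lemma has_derivative_cong_open:
  assumes "open S" "x \<in> S" "\<And>y. y \<in> S \<Longrightarrow> f y = g y"
  shows "(f has_derivative f') (at x) \<longleftrightarrow> (g has_derivative f') (at x)"
  using assms has_derivative_transform_within_open[of f f' x UNIV S g]
    has_derivative_transform_within_open[of g f' x UNIV S f] by auto

lemma differentiable_cong_open:
  assumes "open S" "x \<in> S" "\<And>y. y \<in> S \<Longrightarrow> f y = g y"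
  shows "f differentiable (at x) \<longleftrightarrow> g differentiable (at x)"
  using has_derivative_cong_open[OF assms] by (auto simp: differentiable_def)

lemma partial_derivative_cong:
  assumes "open S" "x \<in> S" "\<And>y. y \<in> S \<Longrightarrow> f y = g y"
  shows "partial_derivative b f x = partial_derivative b g x"
  using has_derivative_cong_open[OF assms]
  by (simp add: partial_derivative_def frechet_derivative_def)

lemma Ck_on_cong:
  assumes "open S" "\<And>x. x \<in> S \<Longrightarrow> f x = g x"
  shows "Ck_on k S f \<longleftrightarrow> Ck_on k S g"
  using assms(2)
proof (induction k arbitrary: f g)
  case 0
  then show ?case by (auto cong: continuous_on_cong)
next
  case (Suc k)
  have "Ck_on k S (partial_derivative b f) = Ck_on k S (partial_derivative b g)" for b
    by (rule Suc.IH) (rule partial_derivative_cong[OF assms(1) _ Suc.prems])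
  then show ?case
    using differentiable_cong_open[OF assms(1) _ Suc.prems] by simp
qed

lemma Ck_on_subset: "Ck_on k S f \<Longrightarrow> T \<subseteq> S \<Longrightarrow> Ck_on k T f"
  by (induction k arbitrary: f) (auto intro: continuous_on_subset)

lemma Ck_on_SucD: "Ck_on (Suc k) S f \<Longrightarrow> Ck_on k S f"
proof (induction k arbitrary: f)
  case 0
  then show ?case
    by (auto intro!: continuous_at_imp_continuous_on differentiable_imp_continuous_within)
qed auto

lemma Ck_on_le: "Ck_on k S f \<Longrightarrow> j \<le> k \<Longrightarrow> Ck_on j S f"
proof (induction k)
  case (Suc k)
  then show ?case using Ck_on_SucD le_Suc_eq by blast
qed simp

lemma Ck_on_imp_continuous_on: "Ck_on k S f \<Longrightarrow> continuous_on S f"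
  using Ck_on_le[of k S f 0] by simp

lemma Ck_on_locally:
  assumes "\<And>x. x \<in> S \<Longrightarrow> \<exists>T. open T \<and> x \<in> T \<and> Ck_on k T f"
  shows "Ck_on k S f"
  using assms
proof (induction k arbitrary: f)
  case 0
  show ?case unfolding Ck_on.simps
  proof (rule continuous_at_imp_continuous_on, rule ballI)
    fix x assume "x \<in> S"
    then obtain T where "open T" "x \<in> T" "continuous_on T f" using 0 by auto
    then show "isCont f x" by (simp add: continuous_on_eq_continuous_at)
  qed
next
  case (Suc k)
  have "Ck_on k S (partial_derivative b f)" if "b \<in> Basis" for b
    using Suc.prems that by (intro Suc.IH) fastforce
  moreover have "f differentiable (at x)" if "x \<in> S" for x
    using Suc.prems[OF that] by auto
  ultimately show ?case by simp
qed

lemma Cinf_on_partial_derivative: "Cinf_on S f \<Longrightarrow> b \<in> Basis \<Longrightarrow> Cinf_on S (partial_derivative b f)"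
  unfolding Cinf_on_def using Ck_on.simps(2) by blast

lemma partial_derivative_const [simp]: "partial_derivative b (\<lambda>x. c) = (\<lambda>x. 0)"
  by (rule ext, rule partial_derivative_eqI[THEN trans]) (auto intro: derivative_intros)

lemma partial_derivative_add:
  assumes "f differentiable (at x)" "g differentiable (at x)"
  shows "partial_derivative b (\<lambda>x. f x + g x) x = partial_derivative b f x + partial_derivative b g x"
  using assms unfolding partial_derivative_def frechet_derivative_works
  by (metis (no_types) frechet_derivative_at has_derivative_add)

lemma partial_derivative_diff:
  assumes "f differentiable (at x)" "g differentiable (at x)"
  shows "partial_derivative b (\<lambda>x. f x - g x) x = partial_derivative b f x - partial_derivative b g x"
  using assms unfolding partial_derivative_def frechet_derivative_works
  by (metis (no_types) frechet_derivative_at has_derivative_diff)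

lemma partial_derivative_mult:
  assumes "f differentiable (at x)" "g differentiable (at x)"
  shows "partial_derivative b (\<lambda>x. f x * g x) x =
    f x * partial_derivative b g x + partial_derivative b f x * g x"
  by (rule partial_derivative_eqI[THEN trans], rule has_derivative_mult)
     (use assms in \<open>auto simp: frechet_derivative_works partial_derivative_def\<close>)

lemma partial_derivative_cmult:
  assumes "f differentiable (at x)"
  shows "partial_derivative b (\<lambda>x. c * f x) x = c * partial_derivative b f x"
  using partial_derivative_mult[of "\<lambda>x. c" x f] assms by simp

lemma has_derivative_chain_real:
  fixes f :: "'a::euclidean_space \<Rightarrow> real"
  assumes "f differentiable (at x)" "(\<phi> has_real_derivative d) (at (f x))"
  shows "((\<lambda>x. \<phi> (f x)) has_derivative (\<lambda>h. d * frechet_derivative f (at x) h)) (at x)"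
  using has_derivative_compose[of f "frechet_derivative f (at x)" x UNIV \<phi> "(*) d"] assms
  by (simp add: frechet_derivative_works has_field_derivative_def)

lemma partial_derivative_chain:
  fixes f :: "'a::euclidean_space \<Rightarrow> real"
  assumes "f differentiable (at x)" "(\<phi> has_real_derivative d) (at (f x))"
  shows "partial_derivative b (\<lambda>x. \<phi> (f x)) x = d * partial_derivative b f x"
  using partial_derivative_eqI[OF has_derivative_chain_real[OF assms]]
  by (simp add: partial_derivative_def)

lemma Ck_on_const: "Ck_on k S (\<lambda>x. c)"
  by (induction k arbitrary: c) auto

lemma Ck_on_add:
  assumes "open S" "Ck_on k S f" "Ck_on k S g"
  shows "Ck_on k S (\<lambda>x. f x + g x)"
  using assms(2,3)
proof (induction k arbitrary: f g)
  case (Suc k)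
  have "Ck_on k S (partial_derivative b (\<lambda>x. f x + g x))" if "b \<in> Basis" for b
  proof (rule Ck_on_cong[OF assms(1), THEN iffD2, OF partial_derivative_add])
    show "Ck_on k S (\<lambda>x. partial_derivative b f x + partial_derivative b g x)"
      using Suc.prems that by (intro Suc.IH) auto
  qed (use Suc.prems in auto)
  then show ?case using Suc.prems by (auto intro: differentiable_add differentiable_mult)
qed (auto intro!: continuous_intros)

lemma Ck_on_mult:
  assumes "open S" "Ck_on k S f" "Ck_on k S g"
  shows "Ck_on k S (\<lambda>x. f x * g x)"
  using assms(2,3)
proof (induction k arbitrary: f g)
  case (Suc k)
  have "Ck_on k S (partial_derivative b (\<lambda>x. f x * g x))" if b: "b \<in> Basis" for b
  proof (rule Ck_on_cong[OF assms(1), THEN iffD2, OF partial_derivative_mult])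
    show "Ck_on k S (\<lambda>x. f x * partial_derivative b g x + partial_derivative b f x * g x)"
      using Suc.prems Suc.prems[THEN Ck_on_SucD] b
      by (intro Ck_on_add[OF assms(1)] Suc.IH) (simp_all del: Ck_on.simps add: Ck_on.simps(2))
  qed (use Suc.prems in auto)
  then show ?case using Suc.prems by (auto intro: differentiable_add differentiable_mult)
qed (auto intro!: continuous_intros)

lemma Ck_on_cmult: "open S \<Longrightarrow> Ck_on k S f \<Longrightarrow> Ck_on k S (\<lambda>x. c * f x)"
  by (intro Ck_on_mult Ck_on_const)

lemma Ck_on_diff:
  assumes "open S" "Ck_on k S f" "Ck_on k S g"
  shows "Ck_on k S (\<lambda>x. f x - g x)"
  using Ck_on_add[OF assms(1,2) Ck_on_cmult[OF assms(1,3), of "-1"]] by simp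

lemma Ck_on_exp:
  assumes "open S" "Ck_on k S f"
  shows "Ck_on k S (\<lambda>x. exp (f x))"
  using assms(2)
proof (induction k arbitrary: f)
  case (Suc k)
  have "Ck_on k S (partial_derivative b (\<lambda>x. exp (f x)))" if b: "b \<in> Basis" for b
  proof (rule Ck_on_cong[OF assms(1), THEN iffD2, OF partial_derivative_chain[OF _ DERIV_exp]])
    show "Ck_on k S (\<lambda>x. exp (f x) * partial_derivative b f x)"
      using Suc.prems Suc.prems[THEN Ck_on_SucD] b
      by (intro Ck_on_mult[OF assms(1)] Suc.IH) (simp_all del: Ck_on.simps add: Ck_on.simps(2))
  qed (use Suc.prems in auto)
  moreover have "(\<lambda>x. exp (f x)) differentiable (at x)" if "x \<in> S" for x
    using Suc.prems that has_derivative_chain_real[OF _ DERIV_exp, of f x] differentiableI by auto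
  ultimately show ?case by auto
qed (auto intro!: continuous_intros)

lemma Ck_on_2D:
  assumes "Ck_on 2 S f" "b \<in> Basis" "x \<in> S"
  shows "f differentiable (at x)" "partial_derivative b f differentiable (at x)"
  using assms by (auto simp: numeral_2_eq_2)

lemma laplacian_add:
  assumes "open S" "Ck_on 2 S f" "Ck_on 2 S g" "x \<in> S"
  shows "laplacian (\<lambda>x. f x + g x) x = laplacian f x + laplacian g x"
proof -
  have "partial_derivative b (partial_derivative b (\<lambda>x. f x + g x)) x
     = partial_derivative b (partial_derivative b f) x + partial_derivative b (partial_derivative b g) x"
    if b: "b \<in> Basis" for b
    by (subst partial_derivative_cong[OF assms(1,4) partial_derivative_add])
       (use assms b in \<open>auto intro!: partial_derivative_add Ck_on_2D\<close>)
  then show ?thesis by (simp add: laplacian_def sum.distrib)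
qed

lemma laplacian_cmult:
  assumes "open S" "Ck_on 2 S f" "x \<in> S"
  shows "laplacian (\<lambda>x. c * f x) x = c * laplacian f x"
proof -
  have "partial_derivative b (partial_derivative b (\<lambda>x. c * f x)) x
     = c * partial_derivative b (partial_derivative b f) x"
    if b: "b \<in> Basis" for b
    by (subst partial_derivative_cong[OF assms(1,3) partial_derivative_cmult])
       (use assms b in \<open>auto intro!: partial_derivative_cmult Ck_on_2D\<close>)
  then show ?thesis by (simp add: laplacian_def sum_distrib_left)
qed

lemma laplacian_diff:
  assumes "open S" "Ck_on 2 S f" "Ck_on 2 S g" "x \<in> S"
  shows "laplacian (\<lambda>x. f x - g x) x = laplacian f x - laplacian g x"
  using laplacian_add[OF assms(1,2) Ck_on_cmult[OF assms(1,3), of "-1"] assms(4)]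
    laplacian_cmult[OF assms(1,3,4), of "-1"] by simp

lemma laplacian_const [simp]: "laplacian (\<lambda>x. c) x = 0"
  by (simp add: laplacian_def)

text \<open>The barriers below are functions of a single polynomial of degree at most two, whose gradient and
  Laplacian are explicit; the chain rule then gives their Laplacians. The set \<open>T\<close> only has to contain the
  values of \<open>f\<close>, so \<open>\<phi>\<close> may be singular elsewhere, like a logarithm.\<close>

lemma
  fixes f :: "'a::euclidean_space \<Rightarrow> real"
  assumes S: "open S" and f: "Ck_on 2 S f" and fT: "\<And>x. x \<in> S \<Longrightarrow> f x \<in> T"
    and d1: "\<And>t. t \<in> T \<Longrightarrow> (\<phi> has_real_derivative \<phi>' t) (at t)"
    and d2: "\<And>t. t \<in> T \<Longrightarrow> (\<phi>' has_real_derivative \<phi>'' t) (at t)"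
    and c: "continuous_on T \<phi>''"
  shows Ck_on_2_chain: "Ck_on 2 S (\<lambda>x. \<phi> (f x))"
    and laplacian_chain: "x \<in> S \<Longrightarrow> laplacian (\<lambda>x. \<phi> (f x)) x =
      \<phi>' (f x) * laplacian f x + \<phi>'' (f x) * (\<Sum>b\<in>Basis. (partial_derivative b f x)\<^sup>2)"
proof -
  have D: "f differentiable (at x)" if "x \<in> S" for x
    using f that by (auto simp: numeral_2_eq_2)
  have D\<phi>: "(\<lambda>x. \<phi> (f x)) differentiable (at x)" "(\<lambda>x. \<phi>' (f x)) differentiable (at x)" if "x \<in> S" for x
    using has_derivative_chain_real[OF D d1] has_derivative_chain_real[OF D d2] that fT
    by (auto simp: differentiable_def)
  have P1: "partial_derivative b (\<lambda>x. \<phi> (f x)) x = \<phi>' (f x) * partial_derivative b f x" if "x \<in> S" for x b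
    using that by (intro partial_derivative_chain D d1 fT)
  have P1': "partial_derivative b (\<lambda>x. \<phi>' (f x)) x = \<phi>'' (f x) * partial_derivative b f x" if "x \<in> S" for x b
    using that by (intro partial_derivative_chain D d2 fT)
  have P2: "partial_derivative c (partial_derivative b (\<lambda>x. \<phi> (f x))) x
    = \<phi>' (f x) * partial_derivative c (partial_derivative b f) x
      + \<phi>'' (f x) * partial_derivative c f x * partial_derivative b f x" if "x \<in> S" "b \<in> Basis" for x b c
  proof -
    have "partial_derivative c (partial_derivative b (\<lambda>x. \<phi> (f x))) x
      = partial_derivative c (\<lambda>x. \<phi>' (f x) * partial_derivative b f x) x"
      using that by (intro partial_derivative_cong[OF S _ P1])
    also have "\<dots> = \<phi>' (f x) * partial_derivative c (partial_derivative b f) x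
      + partial_derivative c (\<lambda>x. \<phi>' (f x)) x * partial_derivative b f x"
      using that Ck_on_2D[OF f] D\<phi> by (intro partial_derivative_mult)
    finally show ?thesis using P1'[OF that(1)] by simp
  qed
  have f0: "continuous_on S f" using f by (rule Ck_on_imp_continuous_on)
  have cc: "continuous_on S (\<lambda>x. \<phi>'' (f x))"
    using continuous_on_compose2[OF c f0] fT by blast
  have c': "continuous_on S (\<lambda>x. \<phi>' (f x))"
    using D\<phi>(2) by (auto intro!: continuous_at_imp_continuous_on differentiable_imp_continuous_within)
  have f1: "continuous_on S (partial_derivative b f)" if "b \<in> Basis" for b
    using f that by (intro Ck_on_imp_continuous_on[of "Suc 0" S]) (simp add: numeral_2_eq_2)
  have f2: "continuous_on S (partial_derivative c (partial_derivative b f))" if "b \<in> Basis" "c \<in> Basis" for b c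
    using f that by (simp add: numeral_2_eq_2)
  show "Ck_on 2 S (\<lambda>x. \<phi> (f x))"
    unfolding numeral_2_eq_2 Ck_on.simps
  proof (intro ballI conjI)
    fix b c :: 'a and x assume b: "b \<in> Basis" and cB: "c \<in> Basis"
    show "partial_derivative b (\<lambda>x. \<phi> (f x)) differentiable (at x)" if "x \<in> S"
      using differentiable_cong_open[OF S that P1, THEN iffD2]
        differentiable_mult[OF D\<phi>(2)[OF that] Ck_on_2D(2)[OF f b that]] by simp
    have "continuous_on S (\<lambda>x. \<phi>' (f x) * partial_derivative c (partial_derivative b f) x
      + \<phi>'' (f x) * partial_derivative c f x * partial_derivative b f x)"
      using b cB by (intro continuous_on_add continuous_on_mult f1 f2 cc c')
    then show "continuous_on S (partial_derivative c (partial_derivative b (\<lambda>x. \<phi> (f x))))"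
      by (rule continuous_on_eq) (use P2 b in simp)
  qed (use D\<phi> in auto)
  assume "x \<in> S"
  then show "laplacian (\<lambda>x. \<phi> (f x)) x =
      \<phi>' (f x) * laplacian f x + \<phi>'' (f x) * (\<Sum>b\<in>Basis. (partial_derivative b f x)\<^sup>2)"
    by (simp add: laplacian_def P2 sum.distrib sum_distrib_left power2_eq_square mult.assoc)
qed

text \<open>Translations and reflections in coordinate hyperplanes map each axis to a parallel one, so composing with
  them merely multiplies each partial derivative by a factor \<open>s b\<close>, and the Laplacian is unchanged if
  \<open>s b = \<plusminus>1\<close>.\<close>

lemma
  fixes f :: "'a::euclidean_space \<Rightarrow> real" and s :: "'a \<Rightarrow> real"
  assumes L: "linear L" and Ls: "L b = s b *\<^sub>R b" and b: "b \<in> Basis"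
    and D: "f differentiable (at (c + L x))"
  shows differentiable_axis_affine: "(\<lambda>x. f (c + L x)) differentiable (at x)"
    and partial_derivative_axis_affine:
      "partial_derivative b (\<lambda>x. f (c + L x)) x = s b * partial_derivative b f (c + L x)"
proof -
  let ?F = "frechet_derivative f (at (c + L x))"
  have "((\<lambda>x. f (c + L x)) has_derivative (\<lambda>h. ?F (L h))) (at x)"
    by (rule has_derivative_compose[where g = f])
       (use D in \<open>auto intro!: derivative_eq_intros linear_imp_has_derivative[OF L] simp: frechet_derivative_works\<close>)
  moreover from this show "(\<lambda>x. f (c + L x)) differentiable (at x)"
    by (auto simp: differentiable_def)
  ultimately show "partial_derivative b (\<lambda>x. f (c + L x)) x = s b * partial_derivative b f (c + L x)"
    using linear_scale[OF linear_frechet_derivative[OF D]]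
    by (simp add: partial_derivative_eqI Ls) (simp add: partial_derivative_def)
qed

lemma Ck_on_axis_affine:
  fixes f :: "'a::euclidean_space \<Rightarrow> real" and s :: "'a \<Rightarrow> real"
  assumes S: "open S" and L: "linear L" and Ls: "\<And>b. b \<in> Basis \<Longrightarrow> L b = s b *\<^sub>R b"
    and m: "\<And>x. x \<in> S \<Longrightarrow> c + L x \<in> T" and f: "Ck_on k T f"
  shows "Ck_on k S (\<lambda>x. f (c + L x))"
  using f
proof (induction k arbitrary: f)
  case 0
  have "continuous_on S (\<lambda>x. c + L x)"
    by (intro continuous_intros linear_continuous_on_compose[OF _ L])
  with 0 show ?case using m by (auto intro: continuous_on_compose2)
next
  case (Suc k)
  have D: "f differentiable (at (c + L x))" if "x \<in> S" for x
    using Suc.prems m that by auto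
  have "Ck_on k S (partial_derivative b (\<lambda>x. f (c + L x)))" if b: "b \<in> Basis" for b
  proof (rule Ck_on_cong[OF S, THEN iffD2, OF partial_derivative_axis_affine[where s = s, OF L Ls[OF b] b D]])
    show "Ck_on k S (\<lambda>x. s b * partial_derivative b f (c + L x))"
      using Suc b by (intro Ck_on_cmult S Suc.IH) auto
  qed
  then show ?case
    using differentiable_axis_affine[where s = s, OF L Ls[OF SOME_Basis] SOME_Basis D] by simp
qed

lemma laplacian_axis_affine:
  fixes f :: "'a::euclidean_space \<Rightarrow> real" and s :: "'a \<Rightarrow> real"
  assumes S: "open S" and L: "linear L" and Ls: "\<And>b. b \<in> Basis \<Longrightarrow> L b = s b *\<^sub>R b"
    and s: "\<And>b. b \<in> Basis \<Longrightarrow> (s b)\<^sup>2 = 1"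
    and m: "\<And>x. x \<in> S \<Longrightarrow> c + L x \<in> T" and f: "Ck_on 2 T f" and x: "x \<in> S"
  shows "laplacian (\<lambda>x. f (c + L x)) x = laplacian f (c + L x)"
  unfolding laplacian_def
proof (intro sum.cong refl)
  fix b :: 'a assume b: "b \<in> Basis"
  have "partial_derivative b (partial_derivative b (\<lambda>x. f (c + L x))) x
      = partial_derivative b (\<lambda>x. s b * partial_derivative b f (c + L x)) x"
    using Ck_on_2D[OF f b] m
    by (intro partial_derivative_cong[OF S x] partial_derivative_axis_affine L Ls b) auto
  also have "\<dots> = s b * partial_derivative b (\<lambda>x. partial_derivative b f (c + L x)) x"
    using Ck_on_2D[OF f b] m x
    by (intro partial_derivative_cmult differentiable_axis_affine[where s = s, OF L Ls[OF b] b]) auto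
  also have "\<dots> = (s b)\<^sup>2 * partial_derivative b (partial_derivative b f) (c + L x)"
    using Ck_on_2D[OF f b] m x
    by (subst partial_derivative_axis_affine[where s = s, OF L Ls[OF b] b]) (auto simp: power2_eq_square)
  finally show "partial_derivative b (partial_derivative b (\<lambda>x. f (c + L x))) x
      = partial_derivative b (partial_derivative b f) (c + L x)"
    using s[OF b] by simp
qed

lemma partial_derivative_inner:
  "partial_derivative b (\<lambda>x. (x - a) \<bullet> e) = (\<lambda>x. b \<bullet> e)"
  by (rule ext, rule partial_derivative_eqI[THEN trans]) (auto intro!: derivative_eq_intros)

lemma Ck_on_inner: "Ck_on k S (\<lambda>x. (x - a) \<bullet> e)"
proof (cases k)
  case (Suc j)
  have "(\<lambda>x. (x - a) \<bullet> e) differentiable (at x)" for x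
    unfolding differentiable_def by (auto intro!: derivative_eq_intros)
  with Suc show ?thesis by (simp add: partial_derivative_inner Ck_on_const)
qed (auto intro!: continuous_intros)

lemma laplacian_inner [simp]: "laplacian (\<lambda>x. (x - a) \<bullet> e) x = 0"
  by (simp add: laplacian_def partial_derivative_inner)

lemma partial_derivative_norm_square:
  "partial_derivative b (\<lambda>x. (x - a) \<bullet> (x - a)) = (\<lambda>x. 2 * ((x - a) \<bullet> b))"
  by (rule ext, rule partial_derivative_eqI[THEN trans])
     (auto intro!: derivative_eq_intros simp: inner_commute)

lemma Ck_on_norm_square: "Ck_on k S (\<lambda>x. (x - a) \<bullet> (x - a))"
proof (cases k)
  case (Suc j)
  have "(\<lambda>x. (x - a) \<bullet> (x - a)) differentiable (at x)" for x
    unfolding differentiable_def by (auto intro!: derivative_eq_intros)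
  with Suc show ?thesis
    using Ck_on_cmult[OF open_UNIV Ck_on_inner] Ck_on_subset[of j UNIV]
    by (simp add: partial_derivative_norm_square) blast
qed (auto intro!: continuous_intros)

lemma laplacian_norm_square:
  fixes a x :: "'a::euclidean_space"
  shows "laplacian (\<lambda>x. (x - a) \<bullet> (x - a)) x = 2 * real DIM('a)"
proof -
  have "partial_derivative b (\<lambda>x. 2 * ((x - a) \<bullet> b)) x = 2" if "b \<in> Basis" for b
    using that
    by (subst partial_derivative_cmult)
       (auto intro!: differentiable_inner simp: partial_derivative_inner differentiable_diff)
  then show ?thesis
    by (simp add: laplacian_def partial_derivative_norm_square)
qed

lemma sum_partial_norm_square:
  fixes a x :: "'a::euclidean_space"
  shows "(\<Sum>b\<in>Basis. (partial_derivative b (\<lambda>x. (x - a) \<bullet> (x - a)) x)\<^sup>2) = 4 * ((x - a) \<bullet> (x - a))"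
proof -
  have "(\<Sum>b\<in>Basis. (2 * ((x - a) \<bullet> b))\<^sup>2) = 4 * (\<Sum>b\<in>Basis. ((x - a) \<bullet> b) * ((x - a) \<bullet> b))"
    by (simp add: sum_distrib_left power2_eq_square algebra_simps)
  then show ?thesis
    by (simp add: partial_derivative_norm_square euclidean_inner[symmetric])
qed

section \<open>Maximum principle\<close>

lemma second_partial_derivative_nonpos_at_max:
  fixes f :: "'a::euclidean_space \<Rightarrow> real"
  assumes S: "open S" "x \<in> S" and f: "Ck_on 2 S f" and b: "b \<in> Basis"
    and max: "\<And>y. y \<in> S \<Longrightarrow> f y \<le> f x"
  shows "partial_derivative b (partial_derivative b f) x \<le> 0"
proof (rule ccontr)
  assume neg: "\<not> ?thesis"
  obtain e where e: "e > 0" "ball x e \<subseteq> S"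
    using S openE by blast
  have xS: "x + t *\<^sub>R b \<in> S" if "\<bar>t\<bar> < e" for t
    using e that b by (intro subsetD[OF e(2)]) (simp add: dist_norm)
  let ?g = "\<lambda>t. f (x + t *\<^sub>R b)" and ?g' = "\<lambda>t. partial_derivative b f (x + t *\<^sub>R b)"
  have d1: "(?g has_real_derivative ?g' t) (at t)" if "\<bar>t\<bar> < e" for t
    using xS[OF that] b f by (intro has_real_derivative_partial_along_axis Ck_on_2D) auto
  have d2: "(?g' has_real_derivative partial_derivative b (partial_derivative b f) x) (at 0)"
    using has_real_derivative_partial_along_axis[of "partial_derivative b f" x 0 b UNIV] S b f
    by (auto intro: Ck_on_2D)
  have "?g' 0 = 0"
  proof (rule DERIV_local_max[OF d1 e(1)])
    show "\<forall>y. \<bar>0 - y\<bar> < e \<longrightarrow> ?g y \<le> ?g 0" using max xS by auto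
  qed (use e in auto)
  moreover obtain d where d: "d > 0" "\<And>h. 0 < h \<Longrightarrow> h < d \<Longrightarrow> ?g' 0 < ?g' (0 + h)"
    using DERIV_pos_inc_right[OF d2] neg by auto
  ultimately have pos: "0 < ?g' h" if "0 < h" "h < d" for h
    using that by fastforce
  define h where "h = min d e / 2"
  have h: "0 < h" "h < d" "h < e" using d(1) e(1) by (auto simp: h_def min_def)
  obtain z where z: "0 < z" "z < h" "?g h - ?g 0 = (h - 0) * ?g' z"
    using MVT2[OF h(1), of ?g ?g'] d1 h by force
  moreover have "0 < h * ?g' z" using pos[of z] h z by (intro mult_pos_pos) auto
  ultimately have "?g 0 < ?g h" by simp
  moreover have "?g h \<le> ?g 0" using max[OF xS[of h]] h by simp
  ultimately show False by simp
qed

text \<open>At an interior maximum every pure second derivative is nonpositive, which contradicts a positive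
  Laplacian. The Laplacian is only constrained where \<open>f\<close> is positive, since for a difference of two
  solutions this is where the exponentials have a known order. The boundary condition is an upper bound in the limit,
  so that \<open>f\<close> may tend to \<open>-\<infinity>\<close> at the boundary; this covers comparison with blow-up solutions.\<close>

lemma maximum_principle:
  fixes f :: "'a::euclidean_space \<Rightarrow> real"
  assumes S: "open S" "bounded S" and f: "Ck_on 2 S f"
    and sub: "\<And>x. x \<in> S \<Longrightarrow> f x > 0 \<Longrightarrow> laplacian f x > 0"
    and bd: "\<And>z e. z \<in> frontier S \<Longrightarrow> e > 0 \<Longrightarrow> eventually (\<lambda>x. f x \<le> e) (at z within S)"
    and x: "x \<in> S"
  shows "f x \<le> 0"
proof (rule ccontr)
  assume pos: "\<not> f x \<le> 0"
  \<comment> \<open>The boundary condition keeps this superlevel set away from the frontier, so that it is compact.\<close>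
  define K where "K = {y \<in> S. f y \<ge> f x}"
  have f0: "continuous_on S f" using f by (rule Ck_on_imp_continuous_on)
  have "closed K"
    unfolding closed_sequential_limits
  proof (intro allI impI, elim conjE)
    fix y l assume y: "\<forall>n. y n \<in> K" and yl: "y \<longlonglongrightarrow> l"
    have lS: "l \<in> S"
    proof (rule ccontr)
      assume "l \<notin> S"
      moreover have "l \<in> closure S"
        using y yl unfolding K_def closure_sequential by blast
      ultimately have "l \<in> frontier S"
        using S by (simp add: frontier_def interior_open)
      then have "eventually (\<lambda>x'. f x' \<le> f x / 2) (at l within S)"
        using pos by (intro bd) auto
      then obtain d where "d > 0" "\<And>x'. x' \<in> S \<Longrightarrow> x' \<noteq> l \<Longrightarrow> dist x' l < d \<Longrightarrow> f x' \<le> f x / 2"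
        unfolding eventually_at by auto
      moreover obtain n where "dist (y n) l < d"
        using yl \<open>d > 0\<close> by (meson lim_sequentially order_refl)
      moreover have "y n \<noteq> l" "y n \<in> S" using y \<open>l \<notin> S\<close> by (auto simp: K_def)
      ultimately have "f (y n) \<le> f x / 2" by blast
      moreover have "f (y n) \<ge> f x" using y by (simp add: K_def)
      ultimately show False using pos by simp
    qed
    have "(\<lambda>n. f (y n)) \<longlonglongrightarrow> f l"
      using continuous_on_tendsto_compose[OF f0 yl lS] y by (auto simp: K_def)
    then have "f x \<le> f l"
      using y by (intro LIMSEQ_le_const) (auto simp: K_def)
    with lS show "l \<in> K" by (simp add: K_def)
  qed
  moreover have "bounded K" using S(2) by (rule bounded_subset) (auto simp: K_def)
  ultimately have "compact K" by (simp add: compact_eq_bounded_closed)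
  moreover have "x \<in> K" using x by (simp add: K_def)
  moreover have "continuous_on K f" using f0 by (rule continuous_on_subset) (auto simp: K_def)
  ultimately obtain m where m: "m \<in> K" "\<And>y. y \<in> K \<Longrightarrow> f y \<le> f m"
    using continuous_attains_sup[of K f] by blast
  have mS: "m \<in> S" "f m \<ge> f x" using m by (auto simp: K_def)
  have "f y \<le> f m" if "y \<in> S" for y
    using m(2)[of y] mS that by (cases "f y \<ge> f x") (auto simp: K_def)
  then have "laplacian f m \<le> 0"
    unfolding laplacian_def
    by (intro sum_nonpos second_partial_derivative_nonpos_at_max[OF S(1) mS(1) f])
  with sub[OF mS(1)] mS(2) pos show False by simp
qed

section \<open>Interior gradient estimate\<close>

text \<open>The function \<open>\<phi>(y) = (f(y) - f(y'))/2\<close>, with \<open>y'\<close> the mirror image of \<open>y\<close> in the hyperplane through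
  \<open>x\<close> orthogonal to \<open>e\<close>, vanishes on this hyperplane and has the same derivative in direction \<open>e\<close> at \<open>x\<close> as
  \<open>f\<close>. On the half ball of radius \<open>d\<close> it lies below a quadratic polynomial \<open>\<psi>\<close> with \<open>\<psi>(x) = 0\<close>, by the
  maximum principle, so this derivative is at most that of \<open>\<psi>\<close>.\<close>

lemma gradient_estimate_one_sided:
  fixes f :: "'a::euclidean_space \<Rightarrow> real"
  assumes r: "r > 0" and f: "Ck_on 2 (ball x r) f" and e: "e \<in> Basis"
    and M: "\<And>y. y \<in> ball x r \<Longrightarrow> \<bar>f y\<bar> \<le> M"
    and N: "\<And>y. y \<in> ball x r \<Longrightarrow> \<bar>laplacian f y\<bar> \<le> N" "N > 0"
  shows "partial_derivative e f x \<le> 2 * real DIM('a) * M / r + N * r"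
proof -
  \<comment> \<open>On a ball of smaller radius \<open>f\<close> is continuous up to the boundary.\<close>
  define d where "d = r / 2"
  have d: "d > 0" "d < r" using r by (auto simp: d_def)
  define n where "n = real DIM('a)"
  have n: "n > 0" by (simp add: n_def)
  have M0: "M \<ge> 0" using M[of x] r by force
  define L where "L = (\<lambda>y. y - (2 * (y \<bullet> e)) *\<^sub>R e)"
  define s where "s = (\<lambda>b. if b = e then -1 else 1::real)"
  define c where "c = x - L x"
  have ee: "e \<bullet> e = 1" using e by simp
  have L: "linear L"
    unfolding L_def by (rule linearI) (simp_all add: inner_add_left algebra_simps)
  have Lb: "L b = s b *\<^sub>R b" if "b \<in> Basis" for b
    using that e by (auto simp: L_def s_def inner_Basis scaleR_2)
  have cL: "c + L y - x = L (y - x)" for y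
    by (simp add: c_def linear_diff[OF L])
  have nL: "norm (L y) = norm y" for y
  proof -
    have "L y \<bullet> L y = y \<bullet> y"
      by (simp add: L_def inner_diff_left inner_diff_right ee inner_commute algebra_simps)
    then show ?thesis by (simp add: norm_eq)
  qed
  have refl: "c + L y \<in> ball x r" if "y \<in> ball x r" for y
    using that nL[of "y - x"] cL[of y] by (metis dist_commute dist_norm mem_ball)
  define p where "p = (\<lambda>y. (y - x) \<bullet> e)"
  define A where "A = M / d\<^sup>2"
  define C where "C = n * A + N"
  have AC: "A \<ge> 0" "C \<ge> 0" using M0 N n d by (auto simp: A_def C_def)
  define \<phi> where "\<phi> = (\<lambda>y. (1/2) * (f y - f (c + L y)))"
  \<comment> \<open>The first term dominates \<open>\<bar>\<phi>\<bar> \<le> M\<close> on the sphere of radius \<open>d\<close>, and the second vanishes on the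
    hyperplane. With this \<open>C\<close> the Laplacian \<open>2 n A - 2 C\<close> is \<open>-2 N\<close>, strictly below \<open>-N\<close>.\<close>
  define \<psi> where "\<psi> = (\<lambda>y. A * ((y - x) \<bullet> (y - x)) + C * (p y * (d - p y)))"
  have \<phi>2: "Ck_on 2 (ball x r) \<phi>"
    unfolding \<phi>_def
    by (intro Ck_on_cmult Ck_on_diff f open_ball Ck_on_axis_affine[OF open_ball L Lb refl f])
  have lap\<phi>: "\<bar>laplacian \<phi> y\<bar> \<le> N" if y: "y \<in> ball x r" for y
  proof -
    have fr: "Ck_on 2 (ball x r) (\<lambda>y. f (c + L y))"
      by (rule Ck_on_axis_affine[OF open_ball L Lb refl f])
    have "laplacian \<phi> y = (1/2) * laplacian (\<lambda>y. f y - f (c + L y)) y"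
      unfolding \<phi>_def by (rule laplacian_cmult[OF open_ball Ck_on_diff[OF open_ball f fr] y])
    also have "laplacian (\<lambda>y. f y - f (c + L y)) y = laplacian f y - laplacian (\<lambda>y. f (c + L y)) y"
      by (rule laplacian_diff[OF open_ball f fr y])
    also have "laplacian (\<lambda>y. f (c + L y)) y = laplacian f (c + L y)"
      by (rule laplacian_axis_affine[OF open_ball L Lb _ refl f y]) (auto simp: s_def)
    finally show ?thesis
      using N(1)[OF y] N(1)[OF refl[OF y]] by (simp add: abs_le_iff)
  qed
  have p2: "Ck_on 2 S (\<lambda>y. (p y * (d - p y)))" if "open S" for S
    unfolding p_def by (intro Ck_on_mult Ck_on_diff Ck_on_const Ck_on_inner that)
  have \<psi>2: "Ck_on 2 S \<psi>" if "open S" for S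
    unfolding \<psi>_def by (intro Ck_on_add Ck_on_cmult Ck_on_norm_square p2 that)
  have lap\<psi>: "laplacian \<psi> y = - 2 * N" for y
  proof -
    have "laplacian (\<lambda>y. p y * (d - p y)) y
      = (d - 2 * p y) * laplacian p y + (-2) * (\<Sum>b\<in>Basis. (partial_derivative b p y)\<^sup>2)"
      unfolding p_def
      by (rule laplacian_chain[OF open_UNIV Ck_on_inner, where T = UNIV])
         (auto intro!: derivative_eq_intros continuous_intros)
    also have "(\<Sum>b\<in>Basis. (partial_derivative b p y)\<^sup>2) = 1"
      using ee euclidean_inner[of e e]
      unfolding p_def partial_derivative_inner by (simp add: power2_eq_square inner_commute)
    finally have "laplacian (\<lambda>y. p y * (d - p y)) y = -2"
      by (simp add: p_def)
    moreover have "laplacian \<psi> y = laplacian (\<lambda>y. A * ((y - x) \<bullet> (y - x))) y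
        + laplacian (\<lambda>y. C * (p y * (d - p y))) y"
      unfolding \<psi>_def
      by (rule laplacian_add[OF open_UNIV]) (auto intro!: Ck_on_cmult Ck_on_norm_square p2)
    moreover have "laplacian (\<lambda>y. A * ((y - x) \<bullet> (y - x))) y = A * (2 * n)"
      by (simp add: laplacian_cmult[OF open_UNIV Ck_on_norm_square] laplacian_norm_square n_def)
    moreover have "laplacian (\<lambda>y. C * (p y * (d - p y))) y = C * laplacian (\<lambda>y. p y * (d - p y)) y"
      by (rule laplacian_cmult[OF open_UNIV p2]) auto
    ultimately show ?thesis by (simp add: C_def algebra_simps)
  qed
  define H where "H = ball x d \<inter> {y. p y > 0}"
  have pc: "continuous_on UNIV p" unfolding p_def by (intro continuous_intros)
  have pd: "\<bar>p y\<bar> \<le> norm (y - x)" for y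
    using Cauchy_Schwarz_ineq2[of "y - x" e] e by (simp add: p_def)
  have H: "open H"
    unfolding H_def using open_Collect_less[OF continuous_on_const pc] by blast
  have Hr: "H \<subseteq> ball x r" using d by (auto simp: H_def)
  have le: "\<phi> y \<le> \<psi> y" if "y \<in> H" for y
  proof -
    have "\<phi> y - \<psi> y \<le> 0"
    proof (rule maximum_principle[OF H _ _ _ _ that, of "\<lambda>y. \<phi> y - \<psi> y"])
      show "bounded H" using bounded_subset[OF bounded_ball, of H x d] by (auto simp: H_def)
      show "Ck_on 2 H (\<lambda>y. \<phi> y - \<psi> y)"
        by (intro Ck_on_diff H \<psi>2 Ck_on_subset[OF \<phi>2 Hr])
      show "laplacian (\<lambda>y. \<phi> y - \<psi> y) y > 0" if "y \<in> H" for y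
        using laplacian_diff[OF H Ck_on_subset[OF \<phi>2 Hr] \<psi>2[OF H] that] lap\<phi>[of y] lap\<psi>[of y]
          that Hr N(2) by auto
      fix z \<epsilon> :: _ assume z: "z \<in> frontier H" and \<epsilon>: "(\<epsilon>::real) > 0"
      have zc: "z \<in> closure H" using z by (simp add: frontier_def)
      have "closure H \<subseteq> cball x d \<inter> {y. p y \<ge> 0}"
        by (rule closure_minimal)
           (auto simp: H_def intro!: closed_Int closed_Collect_le continuous_on_const pc)
      with zc have zd: "z \<in> cball x d" "p z \<ge> 0" by auto
      have "z \<notin> H" using z H by (simp add: frontier_def interior_open)
      then have alt: "norm (z - x) = d \<or> p z = 0"
        using zd by (auto simp: H_def dist_norm norm_minus_commute)
      have zr: "z \<in> ball x r" using zd d by auto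
      have "0 \<le> C * (p z * (d - p z))"
        using AC zd pd[of z] by (intro mult_nonneg_nonneg) (auto simp: dist_norm norm_minus_commute)
      moreover have "\<phi> z \<le> A * ((z - x) \<bullet> (z - x))"
      proof (cases "norm (z - x) = d")
        case True
        have "\<phi> z \<le> M" using M[OF zr] M[OF refl[OF zr]] by (simp add: \<phi>_def abs_le_iff)
        also have "M = A * ((z - x) \<bullet> (z - x))"
          using d True by (simp add: A_def power2_norm_eq_inner[symmetric])
        finally show ?thesis .
      next
        case False
        with alt have "L (z - x) = z - x" by (simp add: L_def p_def)
        then have "c + L z = z" using cL[of z] by simp
        then show ?thesis using AC by (simp add: \<phi>_def)
      qed
      ultimately have "\<phi> z - \<psi> z \<le> 0" by (simp add: \<psi>_def)
      have "continuous_on (ball x r) (\<lambda>y. \<phi> y - \<psi> y)"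
        by (rule Ck_on_imp_continuous_on[OF Ck_on_diff[OF open_ball \<phi>2 \<psi>2[OF open_ball]]])
      then have "((\<lambda>y. \<phi> y - \<psi> y) \<longlongrightarrow> \<phi> z - \<psi> z) (at z)"
        using zr by (simp add: continuous_on_eq_continuous_at isCont_def)
      then have "eventually (\<lambda>y. \<phi> y - \<psi> y < \<epsilon>) (at z)"
        by (rule order_tendstoD(2)) (use \<open>\<phi> z - \<psi> z \<le> 0\<close> \<epsilon> in linarith)
      then show "eventually (\<lambda>y. \<phi> y - \<psi> y \<le> \<epsilon>) (at z within H)"
        unfolding eventually_at_topological using less_imp_le by blast
    qed
    then show ?thesis by simp
  qed
  have xte: "x + t *\<^sub>R e \<in> ball x r" if "\<bar>t\<bar> < d" for t
    using that d e by (simp add: dist_norm)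
  have ax: "\<phi> (x + t *\<^sub>R e) = (1/2) * (f (x + t *\<^sub>R e) - f (x - t *\<^sub>R e))" for t
  proof -
    have "c + L (x + t *\<^sub>R e) = x + L (t *\<^sub>R e)" by (simp add: c_def linear_add[OF L])
    also have "L (t *\<^sub>R e) = (- t) *\<^sub>R e" using Lb[OF e] by (simp add: linear_scale[OF L] s_def)
    finally show ?thesis by (simp add: \<phi>_def)
  qed
  \<comment> \<open>\<open>k\<close> is \<open>\<phi> - \<psi>\<close> along the axis: it vanishes at \<open>0\<close> and is nonpositive to the right of \<open>0\<close>.\<close>
  define k where "k = (\<lambda>t. (1/2) * (f (x + t *\<^sub>R e) - f (x - t *\<^sub>R e)) - (A * t\<^sup>2 + C * (t * (d - t))))"
  have kle: "k t \<le> 0" if "0 < t" "t < d" for t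
  proof -
    have "x + t *\<^sub>R e \<in> H" using that e ee by (simp add: H_def p_def dist_norm)
    from le[OF this] show ?thesis
      using ee by (simp add: k_def ax \<psi>_def p_def power2_eq_square)
  qed
  have D: "((\<lambda>t. f (x + t *\<^sub>R e)) has_real_derivative partial_derivative e f x) (at 0)"
    using has_real_derivative_partial_along_axis[of f x 0 e UNIV] Ck_on_2D[OF f e, of x] e r by simp
  have D': "((\<lambda>t. f (x - t *\<^sub>R e)) has_real_derivative - partial_derivative e f x) (at 0)"
    using DERIV_chain2[of "\<lambda>t. f (x + t *\<^sub>R e)" "partial_derivative e f x" "\<lambda>t. - t" 0 "-1" UNIV]
      DERIV_minus[OF DERIV_ident, of 0 UNIV] D
    by simp
  have kD: "(k has_real_derivative (partial_derivative e f x - C * d)) (at 0)"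
    unfolding k_def by (auto intro!: derivative_eq_intros D D')
  have "partial_derivative e f x - C * d \<le> 0"
  proof (rule ccontr)
    assume "\<not> partial_derivative e f x - C * d \<le> 0"
    then obtain h where h: "h > 0" "\<And>t. 0 < t \<Longrightarrow> t < h \<Longrightarrow> k 0 < k (0 + t)"
      using DERIV_pos_inc_right[OF kD] by auto
    define t where "t = min h d / 2"
    have "0 < t" "t < h" "t < d" using h(1) d by (auto simp: t_def min_def)
    with kle[of t] h(2)[of t] show False by (simp add: k_def)
  qed
  moreover have "C * d = 2 * n * M / r + N * d"
    using d r by (simp add: C_def A_def d_def power2_eq_square field_simps)
  moreover have "N * d \<le> N * r" using N(2) d by simp
  ultimately show ?thesis by (simp add: n_def)
qed

lemma gradient_estimate:
  fixes f :: "'a::euclidean_space \<Rightarrow> real"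
  assumes r: "r > 0" and f: "Ck_on 2 (ball x r) f" and e: "e \<in> Basis"
    and M: "\<And>y. y \<in> ball x r \<Longrightarrow> \<bar>f y\<bar> \<le> M"
    and N: "\<And>y. y \<in> ball x r \<Longrightarrow> \<bar>laplacian f y\<bar> \<le> N" "N > 0"
  shows "\<bar>partial_derivative e f x\<bar> \<le> 2 * real DIM('a) * M / r + N * r"
proof -
  have x: "x \<in> ball x r" using r by simp
  have "partial_derivative e (\<lambda>y. (-1) * f y) x \<le> 2 * real DIM('a) * M / r + N * r"
  proof (rule gradient_estimate_one_sided[OF r _ e _ _ N(2)])
    show "Ck_on 2 (ball x r) (\<lambda>y. (-1) * f y)" by (intro Ck_on_cmult f open_ball)
    show "\<bar>laplacian (\<lambda>y. (-1) * f y) y\<bar> \<le> N" if "y \<in> ball x r" for y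
      using N(1)[OF that] laplacian_cmult[OF open_ball f that, of "-1"] by simp
  qed (use M in auto)
  moreover have "partial_derivative e (\<lambda>y. (-1) * f y) x = - partial_derivative e f x"
    using partial_derivative_cmult[of f x e "-1"] Ck_on_2D[OF f e x] by simp
  moreover have "partial_derivative e f x \<le> 2 * real DIM('a) * M / r + N * r"
    using assms by (rule gradient_estimate_one_sided)
  ultimately show ?thesis by linarith
qed

text \<open>The gradient estimate for \<open>f m - f n\<close> turns Cauchy sequences of functions and of Laplacians into
  Cauchy sequences of partial derivatives.\<close>

lemma partial_derivatives_uniform_limit:
  fixes f :: "nat \<Rightarrow> 'a::euclidean_space \<Rightarrow> real"
  assumes r: "r > 0" and f: "\<And>n. Ck_on 2 (ball x r) (f n)"
    and fg: "uniform_limit (ball x r) f g sequentially"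
    and fq: "uniform_limit (ball x r) (\<lambda>n. laplacian (f n)) q sequentially"
  shows "Ck_on 1 (ball x (r/2)) g"
    and "b \<in> Basis \<Longrightarrow> uniform_limit (ball x (r/2)) (\<lambda>n. partial_derivative b (f n)) (partial_derivative b g) sequentially"
proof -
  have sub: "ball x (r/2) \<subseteq> ball x r" using r by auto
  have "\<exists>G. uniform_limit (ball x (r/2)) (\<lambda>n. partial_derivative b (f n)) G sequentially"
    if b: "b \<in> Basis" for b
  proof -
    have "uniformly_Cauchy_on (ball x (r/2)) (\<lambda>n. partial_derivative b (f n))"
    proof (rule uniformly_Cauchy_onI)
      fix e :: real assume e: "e > 0"
      define C where "C = 2 * real DIM('a) / (r/2) + r/2"
      have C: "C > 0" using r by (simp add: C_def add_pos_pos)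
      define \<epsilon> where "\<epsilon> = e / (2 * C)"
      have \<epsilon>: "\<epsilon> > 0" "C * \<epsilon> < e" using e C by (auto simp: \<epsilon>_def)
      have "uniformly_Cauchy_on (ball x r) f" "uniformly_Cauchy_on (ball x r) (\<lambda>n. laplacian (f n))"
        using fg fq by (auto simp: uniformly_convergent_on_def intro!: uniformly_convergent_Cauchy)
      then obtain K1 K2
        where K1: "\<And>y m n. y \<in> ball x r \<Longrightarrow> m \<ge> K1 \<Longrightarrow> n \<ge> K1 \<Longrightarrow> dist (f m y) (f n y) < \<epsilon>"
          and K2: "\<And>y m n. y \<in> ball x r \<Longrightarrow> m \<ge> K2 \<Longrightarrow> n \<ge> K2 \<Longrightarrow> dist (laplacian (f m) y) (laplacian (f n) y) < \<epsilon>"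
        unfolding uniformly_Cauchy_on_def using \<epsilon>(1) by meson
      have "dist (partial_derivative b (f m) y) (partial_derivative b (f n) y) < e"
        if y: "y \<in> ball x (r/2)" and m: "m \<ge> max K1 K2" and n: "n \<ge> max K1 K2" for y m n
      proof -
        have s: "ball y (r/2) \<subseteq> ball x r"
        proof
          fix z assume "z \<in> ball y (r/2)"
          then show "z \<in> ball x r" using y dist_triangle[of x z y] by auto
        qed
        have "\<bar>partial_derivative b (\<lambda>y. f m y - f n y) y\<bar> \<le> 2 * real DIM('a) * \<epsilon> / (r/2) + \<epsilon> * (r/2)"
        proof (rule gradient_estimate[OF _ _ b])
          show "Ck_on 2 (ball y (r/2)) (\<lambda>y. f m y - f n y)"
            by (intro Ck_on_diff open_ball Ck_on_subset[OF f s])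
          show "\<bar>f m z - f n z\<bar> \<le> \<epsilon>" if "z \<in> ball y (r/2)" for z
            using K1[of z m n] that s m n by (auto simp: dist_real_def)
          show "\<bar>laplacian (\<lambda>y. f m y - f n y) z\<bar> \<le> \<epsilon>" if "z \<in> ball y (r/2)" for z
          proof -
            have z: "z \<in> ball x r" using that s by blast
            have "laplacian (\<lambda>y. f m y - f n y) z = laplacian (f m) z - laplacian (f n) z"
              by (rule laplacian_diff[OF open_ball f f z])
            with K2[OF z, of m n] m n show ?thesis by (simp add: dist_real_def)
          qed
        qed (use r \<epsilon> in auto)
        also have "\<dots> = C * \<epsilon>" by (simp add: C_def algebra_simps)
        also have "partial_derivative b (\<lambda>y. f m y - f n y) y = partial_derivative b (f m) y - partial_derivative b (f n) y"
          using y sub by (intro partial_derivative_diff Ck_on_2D(1)[OF f b]) auto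
        finally show ?thesis using \<epsilon> by (simp add: dist_real_def)
      qed
      then show "\<exists>K. \<forall>y\<in>ball x (r/2). \<forall>m\<ge>K. \<forall>n\<ge>K.
          dist (partial_derivative b (f m) y) (partial_derivative b (f n) y) < e"
        by blast
    qed
    then show ?thesis
      using Cauchy_uniformly_convergent by (auto simp: uniformly_convergent_on_def)
  qed
  then obtain G where G: "\<And>b. b \<in> Basis \<Longrightarrow>
      uniform_limit (ball x (r/2)) (\<lambda>n. partial_derivative b (f n)) (G b) sequentially"
    by metis
  have der: "(g has_derivative (\<lambda>h. \<Sum>b\<in>Basis. (h \<bullet> b) * G b y)) (at y)" if y: "y \<in> ball x (r/2)" for y
  proof -
    have "\<exists>g'. \<forall>y\<in>ball x (r/2). (\<lambda>n. f n y) \<longlonglongrightarrow> g' y \<and>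
       (g' has_derivative (\<lambda>h. \<Sum>b\<in>Basis. (h \<bullet> b) * G b y)) (at y within ball x (r/2))"
    proof (rule has_derivative_sequence)
      show "convex (ball x (r/2))" by simp
      show "(f n has_derivative (\<lambda>h. \<Sum>b\<in>Basis. (h \<bullet> b) * partial_derivative b (f n) y)) (at y within ball x (r/2))"
        if "y \<in> ball x (r/2)" for n y
        by (rule has_derivative_at_withinI, rule has_derivative_partial_derivatives,
            rule Ck_on_2D(1)[OF f SOME_Basis subsetD[OF sub that]])
      show "x \<in> ball x (r/2)" using r by simp
      show "(\<lambda>n. f n x) \<longlonglongrightarrow> g x"
        by (rule tendsto_uniform_limitI[OF fg]) (use r in simp)
      fix e :: real assume e: "e > 0"
      let ?e = "e / real DIM('a)"
      have "\<forall>\<^sub>F n in sequentially. \<forall>b\<in>Basis. \<forall>y\<in>ball x (r/2). dist (partial_derivative b (f n) y) (G b y) < ?e"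
        using e by (intro eventually_ball_finite) (auto intro!: uniform_limitD[OF G])
      then show "\<forall>\<^sub>F n in sequentially. \<forall>y\<in>ball x (r/2). \<forall>h.
        norm ((\<Sum>b\<in>Basis. (h \<bullet> b) * partial_derivative b (f n) y) - (\<Sum>b\<in>Basis. (h \<bullet> b) * G b y)) \<le> e * norm h"
      proof eventually_elim
        case (elim n)
        show ?case
        proof (intro ballI allI)
          fix y h assume y: "y \<in> ball x (r/2)"
          have "norm ((\<Sum>b\<in>Basis. (h \<bullet> b) * partial_derivative b (f n) y) - (\<Sum>b\<in>Basis. (h \<bullet> b) * G b y))
             = \<bar>\<Sum>b\<in>Basis. (h \<bullet> b) * (partial_derivative b (f n) y - G b y)\<bar>"
            by (simp add: sum_subtractf[symmetric] right_diff_distrib)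
          also have "\<dots> \<le> (\<Sum>b\<in>Basis. \<bar>(h \<bullet> b) * (partial_derivative b (f n) y - G b y)\<bar>)"
            by (rule sum_abs)
          also have "\<dots> \<le> (\<Sum>b\<in>(Basis :: 'a set). norm h * ?e)"
          proof (rule sum_mono)
            fix b :: 'a assume b: "b \<in> Basis"
            show "\<bar>(h \<bullet> b) * (partial_derivative b (f n) y - G b y)\<bar> \<le> norm h * ?e"
              unfolding abs_mult using elim y b Basis_le_norm[OF b, of h]
              by (intro mult_mono) (auto simp: dist_real_def less_imp_le)
          qed
          also have "\<dots> = e * norm h" by simp
          finally show "norm ((\<Sum>b\<in>Basis. (h \<bullet> b) * partial_derivative b (f n) y) - (\<Sum>b\<in>Basis. (h \<bullet> b) * G b y))
              \<le> e * norm h" .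
        qed
      qed
    qed
    then obtain g' where g': "\<And>y. y \<in> ball x (r/2) \<Longrightarrow> (\<lambda>n. f n y) \<longlonglongrightarrow> g' y"
       "\<And>y. y \<in> ball x (r/2) \<Longrightarrow> (g' has_derivative (\<lambda>h. \<Sum>b\<in>Basis. (h \<bullet> b) * G b y)) (at y within ball x (r/2))"
      by blast
    have "g' y = g y" if "y \<in> ball x (r/2)" for y
      using LIMSEQ_unique[OF g'(1)[OF that] tendsto_uniform_limitI[OF fg]] that sub by auto
    moreover have "(g' has_derivative (\<lambda>h. \<Sum>b\<in>Basis. (h \<bullet> b) * G b y)) (at y)"
      using g'(2)[OF y] at_within_open[OF y open_ball] by simp
    ultimately show ?thesis
      using has_derivative_cong_open[OF open_ball y, of g' g] by blast
  qed
  have GP: "partial_derivative b g y = G b y" if "y \<in> ball x (r/2)" "b \<in> Basis" for y b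
  proof -
    have "(\<Sum>c\<in>Basis. (b \<bullet> c) * G c y) = (\<Sum>c\<in>Basis. if c = b then G c y else 0)"
      using that(2) by (intro sum.cong) (auto simp: inner_Basis)
    then show ?thesis
      using partial_derivative_eqI[OF der[OF that(1)], of b] that(2) by simp
  qed
  show lim: "uniform_limit (ball x (r/2)) (\<lambda>n. partial_derivative b (f n)) (partial_derivative b g) sequentially"
    if "b \<in> Basis" for b
    using G[OF that] by (rule uniform_limit_cong'[THEN iffD1, rotated 2]) (use GP that in auto)
  have "continuous_on (ball x (r/2)) (partial_derivative b g)" if b: "b \<in> Basis" for b
  proof (rule uniform_limit_theorem[OF _ lim[OF b]])
    have "Ck_on (Suc (Suc 0)) (ball x (r/2)) (f n)" for n
      using Ck_on_subset[OF f sub] by (simp add: numeral_2_eq_2 del: Ck_on.simps)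
    then have "Ck_on (Suc 0) (ball x (r/2)) (partial_derivative b (f n))" for n
      using b Ck_on.simps(2) by blast
    then show "\<forall>\<^sub>F n in sequentially. continuous_on (ball x (r/2)) (partial_derivative b (f n))"
      by (intro always_eventually allI Ck_on_imp_continuous_on)
  qed simp
  then show "Ck_on 1 (ball x (r/2)) g"
    using differentiableI[OF der] by simp
qed

section \<open>Smoothness of solutions\<close>

lemma Ck_on_translate:
  fixes f :: "'a::euclidean_space \<Rightarrow> real"
  assumes "open S" "\<And>x. x \<in> S \<Longrightarrow> c + x \<in> T" "Ck_on k T f"
  shows "Ck_on k S (\<lambda>x. f (c + x))"
  by (rule Ck_on_axis_affine[where L = "\<lambda>x. x" and s = "\<lambda>b. 1", OF _ _ _ assms(2,3)])
     (use assms in \<open>auto intro: linear_id[unfolded id_def]\<close>)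

lemma laplacian_translate:
  fixes f :: "'a::euclidean_space \<Rightarrow> real"
  assumes "open S" "\<And>x. x \<in> S \<Longrightarrow> c + x \<in> T" "Ck_on 2 T f" "x \<in> S"
  shows "laplacian (\<lambda>x. f (c + x)) x = laplacian f (c + x)"
  by (rule laplacian_axis_affine[where L = "\<lambda>x. x" and s = "\<lambda>b. 1", OF _ _ _ _ assms(2,3,4)])
     (use assms in \<open>auto intro: linear_id[unfolded id_def]\<close>)

text \<open>The shifts stand to the left of \<open>x\<close>, so that each term has the form \<open>f (c + x)\<close> of a translate.\<close>

definition second_difference_quotient ::
  "'a::euclidean_space \<Rightarrow> 'a \<Rightarrow> real \<Rightarrow> ('a \<Rightarrow> real) \<Rightarrow> 'a \<Rightarrow> real" where
  "second_difference_quotient a b h f x =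
     (1 / h\<^sup>2) * ((f (h *\<^sub>R (a + b) + x) - f (h *\<^sub>R a + x)) - (f (h *\<^sub>R b + x) - f x))"

text \<open>The mean value theorem is applied first in direction \<open>a\<close>, to the increment of \<open>f\<close> in direction
  \<open>b\<close>, and then in direction \<open>b\<close> to the derivative obtained.\<close>

lemma second_difference_quotient_mean_value:
  fixes f :: "'a::euclidean_space \<Rightarrow> real"
  assumes f: "Ck_on 2 (ball x r) f" and h: "h > 0" "2 * h < r" and a: "a \<in> Basis" and b: "b \<in> Basis"
  obtains y where "dist x y \<le> 2 * h"
    "second_difference_quotient a b h f x = partial_derivative b (partial_derivative a f) y"
proof -
  have near: "dist x (x + s *\<^sub>R a + t *\<^sub>R b) \<le> s + t" if "0 \<le> s" "0 \<le> t" for s t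
  proof -
    have "dist x (x + s *\<^sub>R a + t *\<^sub>R b) = norm (s *\<^sub>R a + t *\<^sub>R b)"
      unfolding dist_commute[of x] by (simp add: dist_norm add.assoc)
    also have "\<dots> \<le> s + t"
      using norm_triangle_ineq[of "s *\<^sub>R a" "t *\<^sub>R b"] that a b by simp
    finally show ?thesis .
  qed
  have inb: "x + s *\<^sub>R a + t *\<^sub>R b \<in> ball x r" if "0 \<le> s" "s \<le> h" "0 \<le> t" "t \<le> h" for s t
    using near[of s t] that h by simp
  let ?u = "\<lambda>s. f ((x + h *\<^sub>R b) + s *\<^sub>R a) - f (x + s *\<^sub>R a)"
  let ?u' = "\<lambda>s. partial_derivative a f ((x + h *\<^sub>R b) + s *\<^sub>R a) - partial_derivative a f (x + s *\<^sub>R a)"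
  have du: "(?u has_real_derivative ?u' s) (at s)" if "0 \<le> s" "s \<le> h" for s
    using inb[of s h] inb[of s 0] that h
    by (intro DERIV_diff has_real_derivative_partial_along_axis a Ck_on_2D(1)[OF f a]) (auto simp: ac_simps)
  obtain s where s: "0 < s" "s < h" "?u h - ?u 0 = (h - 0) * ?u' s"
    using MVT2[OF h(1), of ?u ?u'] du by auto
  let ?v = "\<lambda>t. partial_derivative a f ((x + s *\<^sub>R a) + t *\<^sub>R b)"
  let ?v' = "\<lambda>t. partial_derivative b (partial_derivative a f) ((x + s *\<^sub>R a) + t *\<^sub>R b)"
  have dv: "(?v has_real_derivative ?v' t) (at t)" if "0 \<le> t" "t \<le> h" for t
    using inb[of s t] that s h
    by (intro has_real_derivative_partial_along_axis b Ck_on_2D(2)[OF f a]) auto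
  obtain t where t: "0 < t" "t < h" "?v h - ?v 0 = (h - 0) * ?v' t"
    using MVT2[OF h(1), of ?v ?v'] dv by auto
  have "?u' s = ?v h - ?v 0" by (simp add: ac_simps)
  then have "?u h - ?u 0 = h\<^sup>2 * ?v' t"
    using s(3) t(3) by (simp add: power2_eq_square)
  moreover have "second_difference_quotient a b h f x = (1 / h\<^sup>2) * (?u h - ?u 0)"
    by (simp add: second_difference_quotient_def scaleR_add_right ac_simps)
  ultimately have "second_difference_quotient a b h f x = ?v' t" using h by simp
  moreover have "dist x ((x + s *\<^sub>R a) + t *\<^sub>R b) \<le> 2 * h"
    using near[of s t] s t by simp
  ultimately show ?thesis by (intro that)
qed

lemma second_difference_quotient_uniform_limit:
  fixes f :: "'a::euclidean_space \<Rightarrow> real"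
  assumes r: "r > 0" and f: "Ck_on 2 (ball x (3 * r)) f" and a: "a \<in> Basis" and b: "b \<in> Basis"
    and h: "h \<longlonglongrightarrow> 0" "\<And>n. 0 < h n" "\<And>n. 2 * h n < r"
  shows "uniform_limit (ball x r) (\<lambda>n. second_difference_quotient a b (h n) f)
           (partial_derivative b (partial_derivative a f)) sequentially"
proof (rule uniform_limitI)
  fix e :: real assume e: "e > 0"
  let ?P = "partial_derivative b (partial_derivative a f)"
  have "continuous_on (ball x (3 * r)) ?P" using f a b by (simp add: numeral_2_eq_2)
  then have "continuous_on (cball x (2 * r)) ?P"
    by (rule continuous_on_subset) (use r in auto)
  then have "uniformly_continuous_on (cball x (2 * r)) ?P"
    by (intro compact_uniformly_continuous) auto
  then obtain d where d: "d > 0"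
    "\<And>y z. y \<in> cball x (2 * r) \<Longrightarrow> z \<in> cball x (2 * r) \<Longrightarrow> dist z y < d \<Longrightarrow> dist (?P z) (?P y) < e"
    using e unfolding uniformly_continuous_on_def by metis
  have "\<forall>\<^sub>F n in sequentially. h n < d / 2"
    by (rule order_tendstoD(2)[OF h(1)]) (use d in simp)
  then show "\<forall>\<^sub>F n in sequentially. \<forall>y\<in>ball x r. dist (second_difference_quotient a b (h n) f y) (?P y) < e"
  proof eventually_elim
    case (elim n)
    show ?case
    proof
      fix y assume y: "y \<in> ball x r"
      have s: "ball y r \<subseteq> ball x (3 * r)"
      proof
        fix z assume "z \<in> ball y r"
        then show "z \<in> ball x (3 * r)" using y r dist_triangle[of x z y] by auto
      qed
      obtain z where z: "dist y z \<le> 2 * h n" "second_difference_quotient a b (h n) f y = ?P z"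
        using second_difference_quotient_mean_value[OF Ck_on_subset[OF f s] h(2,3) a b] by blast
      have "dist x z \<le> 2 * r" using z(1) y h(3)[of n] dist_triangle[of x z y] by auto
      moreover have "dist x y \<le> 2 * r" using y r by auto
      moreover have "dist z y < d" using z(1) elim by (simp add: dist_commute)
      ultimately show "dist (second_difference_quotient a b (h n) f y) (?P y) < e"
        using d(2)[of y z] z(2) by simp
    qed
  qed
qed

lemma
  fixes f :: "'a::euclidean_space \<Rightarrow> real"
  assumes f: "Ck_on 2 (ball x (3 * r)) f" and a: "a \<in> Basis" and b: "b \<in> Basis"
    and h: "0 < h" "2 * h < r"
  shows Ck_on_second_difference_quotient: "Ck_on 2 (ball x r) (second_difference_quotient a b h f)"
    and laplacian_second_difference_quotient: "y \<in> ball x r \<Longrightarrow>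
      laplacian (second_difference_quotient a b h f) y = second_difference_quotient a b h (laplacian f) y"
proof -
  have m: "h *\<^sub>R c + y \<in> ball x (3 * r)" if "y \<in> ball x r" "norm c \<le> 2" for c y
  proof -
    have "dist x (h *\<^sub>R c + y) \<le> dist x y + norm (h *\<^sub>R c)"
      using dist_triangle[of x "h *\<^sub>R c + y" y] by (simp add: dist_norm)
    also have "norm (h *\<^sub>R c) \<le> h * 2" using that h by simp
    finally show ?thesis using that h by simp
  qed
  have n: "norm a \<le> 2" "norm b \<le> 2" "norm (a + b) \<le> 2"
    using a b norm_triangle_ineq[of a b] by auto
  have C: "Ck_on 2 (ball x r) (\<lambda>y. f (h *\<^sub>R c + y))" if "norm c \<le> 2" for c
    using m that by (intro Ck_on_translate[OF open_ball _ f])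
  have T: "laplacian (\<lambda>y. f (h *\<^sub>R c + y)) y = laplacian f (h *\<^sub>R c + y)"
    if "norm c \<le> 2" "y \<in> ball x r" for c y
    using m that by (intro laplacian_translate[OF open_ball _ f])
  have C0: "Ck_on 2 (ball x r) f" by (rule Ck_on_subset[OF f]) (use h in auto)
  have eq: "second_difference_quotient a b h f = (\<lambda>x. (1 / h\<^sup>2) *
     ((f (h *\<^sub>R (a + b) + x) - f (h *\<^sub>R a + x)) - (f (h *\<^sub>R b + x) - f x)))"
    by (simp add: fun_eq_iff second_difference_quotient_def)
  note D1 = Ck_on_diff[OF open_ball C[OF n(3)] C[OF n(1)]]
  note D2 = Ck_on_diff[OF open_ball C[OF n(2)] C0]
  note D = Ck_on_diff[OF open_ball D1 D2]
  show "Ck_on 2 (ball x r) (second_difference_quotient a b h f)"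
    unfolding eq by (rule Ck_on_cmult[OF open_ball D])
  assume y: "y \<in> ball x r"
  show "laplacian (second_difference_quotient a b h f) y = second_difference_quotient a b h (laplacian f) y"
    unfolding eq second_difference_quotient_def laplacian_cmult[OF open_ball D y]
      laplacian_diff[OF open_ball D1 D2 y] laplacian_diff[OF open_ball C[OF n(3)] C[OF n(1)] y]
      laplacian_diff[OF open_ball C[OF n(2)] C0 y] T[OF n(1) y] T[OF n(2) y] T[OF n(3) y] ..
qed

lemma ball_steps:
  assumes "open (S :: 'a::euclidean_space set)" "x \<in> S"
  obtains r where "r > 0" "ball x (3 * r) \<subseteq> S"
proof -
  obtain e where "e > 0" "ball x e \<subseteq> S" using assms openE by blast
  then show ?thesis by (intro that[of "e / 3"]) auto
qed

lemma vanishing_steps: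
  assumes "r > (0::real)"
  obtains h :: "nat \<Rightarrow> real" where "h \<longlonglongrightarrow> 0" "\<And>n. 0 < h n" "\<And>n. 2 * h n < r"
proof (rule that[of "\<lambda>n. (r / 3) / real (Suc n)"])
  show "(\<lambda>n. (r / 3) / real (Suc n)) \<longlonglongrightarrow> 0"
    using tendsto_mult_right_zero[OF LIMSEQ_inverse_real_of_nat, of "r / 3"] by (simp add: field_simps)
  fix n
  show "0 < (r / 3) / real (Suc n)" using assms by simp
  have "(r / 3) / real (Suc n) \<le> r / 3"
    using assms by (simp add: divide_le_eq mult_left_mono)
  then show "2 * ((r / 3) / real (Suc n)) < r" using assms by linarith
qed

text \<open>The second difference quotient is symmetric in \<open>a\<close> and \<open>b\<close>, so both mixed derivatives are its limit.\<close>

lemma partial_derivative_commute: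
  fixes f :: "'a::euclidean_space \<Rightarrow> real"
  assumes S: "open S" "x \<in> S" and f: "Ck_on 2 S f" and a: "a \<in> Basis" and b: "b \<in> Basis"
  shows "partial_derivative a (partial_derivative b f) x = partial_derivative b (partial_derivative a f) x"
proof -
  obtain r where r: "r > 0" "ball x (3 * r) \<subseteq> S" using S by (rule ball_steps)
  obtain h :: "nat \<Rightarrow> real" where h: "h \<longlonglongrightarrow> 0" "\<And>n. 0 < h n" "\<And>n. 2 * h n < r"
    using vanishing_steps[OF r(1)] by blast
  have "second_difference_quotient a b t f = second_difference_quotient b a t f" for t
    by (simp add: fun_eq_iff second_difference_quotient_def add.commute[of b a])
  moreover have "(\<lambda>n. second_difference_quotient a b (h n) f x) \<longlonglongrightarrow> partial_derivative b (partial_derivative a f) x"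
    by (rule tendsto_uniform_limitI[OF second_difference_quotient_uniform_limit[OF r(1) Ck_on_subset[OF f r(2)] a b h]])
       (use r in simp)
  moreover have "(\<lambda>n. second_difference_quotient b a (h n) f x) \<longlonglongrightarrow> partial_derivative a (partial_derivative b f) x"
    by (rule tendsto_uniform_limitI[OF second_difference_quotient_uniform_limit[OF r(1) Ck_on_subset[OF f r(2)] b a h]])
       (use r in simp)
  ultimately show ?thesis using LIMSEQ_unique by simp
qed

lemma partial_derivative_sum:
  assumes "finite I" "\<And>i. i \<in> I \<Longrightarrow> f i differentiable (at x)"
  shows "partial_derivative b (\<lambda>x. \<Sum>i\<in>I. f i x) x = (\<Sum>i\<in>I. partial_derivative b (f i) x)"
  using assms
proof (induction I rule: finite_induct)
  case (insert i I)
  then show ?case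
    by (simp add: partial_derivative_add differentiable_sum)
qed simp

lemma laplacian_partial_derivative:
  fixes f :: "'a::euclidean_space \<Rightarrow> real"
  assumes S: "open S" "x \<in> S" and f: "Ck_on 3 S f" and e: "e \<in> Basis"
  shows "laplacian (partial_derivative e f) x = partial_derivative e (laplacian f) x"
proof -
  have f2: "Ck_on 2 S f" by (rule Ck_on_le[OF f]) simp
  have f2': "Ck_on 2 S (partial_derivative b f)" if "b \<in> Basis" for b
    using f that by (simp add: numeral_3_eq_3 numeral_2_eq_2)
  have "laplacian (partial_derivative e f) x
      = (\<Sum>b\<in>Basis. partial_derivative e (partial_derivative b (partial_derivative b f)) x)"
    unfolding laplacian_def
  proof (rule sum.cong[OF refl])
    fix b :: 'a assume b: "b \<in> Basis"
    have "partial_derivative b (partial_derivative b (partial_derivative e f)) x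
       = partial_derivative b (partial_derivative e (partial_derivative b f)) x"
      by (rule partial_derivative_cong[OF S partial_derivative_commute[OF S(1) _ f2 b e]])
    also have "\<dots> = partial_derivative e (partial_derivative b (partial_derivative b f)) x"
      by (rule partial_derivative_commute[OF S f2'[OF b] b e])
    finally show "partial_derivative b (partial_derivative b (partial_derivative e f)) x
      = partial_derivative e (partial_derivative b (partial_derivative b f)) x" .
  qed
  also have "\<dots> = partial_derivative e (\<lambda>x. \<Sum>b\<in>Basis. partial_derivative b (partial_derivative b f) x) x"
    using Ck_on_2D(2)[OF f2' _ S(2)] by (intro partial_derivative_sum[symmetric]) auto
  finally show ?thesis by (simp add: laplacian_def[abs_def])
qed

text \<open>The second difference quotients \<open>D\<^sub>h f\<close> are \<open>C\<^sup>2\<close> and satisfy \<open>\<Delta>(D\<^sub>h f) = D\<^sub>h q\<close>. As \<open>f\<close> and \<open>q\<close> are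
  \<open>C\<^sup>2\<close>, both sides converge locally uniformly, so the limit \<open>\<partial>\<^sub>b\<partial>\<^sub>a f\<close> of \<open>D\<^sub>h f\<close> is \<open>C\<^sup>1\<close>.
  Asking for two derivatives of \<open>q\<close>, where Schauder theory would ask for a Hoelder condition on the first ones, costs
  nothing in the bootstrap below, where \<open>q = exp f\<close> is as smooth as \<open>f\<close>.\<close>

lemma Ck_on_3_if_laplacian_Ck_on_2:
  fixes f :: "'a::euclidean_space \<Rightarrow> real"
  assumes S: "open S" and f: "Ck_on 2 S f" and q: "Ck_on 2 S q"
    and lap: "\<And>x. x \<in> S \<Longrightarrow> laplacian f x = q x"
  shows "Ck_on 3 S f"
proof (rule Ck_on_locally)
  fix x assume x: "x \<in> S"
  obtain r where r: "r > 0" "ball x (3 * r) \<subseteq> S" using S x by (rule ball_steps)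
  obtain h :: "nat \<Rightarrow> real" where h: "h \<longlonglongrightarrow> 0" "\<And>n. 0 < h n" "\<And>n. 2 * h n < r"
    using vanishing_steps[OF r(1)] by blast
  have f': "Ck_on 2 (ball x (3 * r)) f" and q': "Ck_on 2 (ball x (3 * r)) q"
    using f q r(2) by (auto intro: Ck_on_subset)
  have C1: "Ck_on 1 (ball x (r/2)) (partial_derivative b (partial_derivative a f))"
    if a: "a \<in> Basis" and b: "b \<in> Basis" for a b
  proof (rule partial_derivatives_uniform_limit(1)[OF r(1)])
    show "Ck_on 2 (ball x r) (second_difference_quotient a b (h n) f)" for n
      by (rule Ck_on_second_difference_quotient[OF f' a b h(2,3)])
    show "uniform_limit (ball x r) (\<lambda>n. second_difference_quotient a b (h n) f)
      (partial_derivative b (partial_derivative a f)) sequentially"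
      by (rule second_difference_quotient_uniform_limit[OF r(1) f' a b h])
    have "second_difference_quotient a b (h n) q y = laplacian (second_difference_quotient a b (h n) f) y"
      if y: "y \<in> ball x r" for n y
    proof -
      have m: "h n *\<^sub>R c + y \<in> S" if "norm c \<le> 2" for c
      proof -
        have "dist x (h n *\<^sub>R c + y) \<le> dist x y + norm (h n *\<^sub>R c)"
          using dist_triangle[of x "h n *\<^sub>R c + y" y] by (simp add: dist_norm)
        also have "norm (h n *\<^sub>R c) \<le> h n * 2" using that h(2)[of n] by simp
        finally show ?thesis using y h(3)[of n] r by (intro subsetD[OF r(2)]) simp
      qed
      have "norm (a + b) \<le> 2" using a b norm_triangle_ineq[of a b] by auto
      then have "second_difference_quotient a b (h n) (laplacian f) y = second_difference_quotient a b (h n) q y"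
        unfolding second_difference_quotient_def using a b m[of 0]
        by (simp add: lap m)
      then show ?thesis
        using laplacian_second_difference_quotient[OF f' a b h(2,3) y] by simp
    qed
    then show "uniform_limit (ball x r) (\<lambda>n. laplacian (second_difference_quotient a b (h n) f))
      (partial_derivative b (partial_derivative a q)) sequentially"
      by (intro uniform_limit_cong'[THEN iffD1, OF _ _
            second_difference_quotient_uniform_limit[OF r(1) q' a b h]]) auto
  qed
  have "Ck_on 2 (ball x (r/2)) f" by (rule Ck_on_subset[OF f']) (use r in auto)
  then have "Ck_on 3 (ball x (r/2)) f"
    using C1 by (simp add: numeral_3_eq_3 numeral_2_eq_2)
  then show "\<exists>T. open T \<and> x \<in> T \<and> Ck_on 3 T f"
    using r by (intro exI[of _ "ball x (r/2)"]) auto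
qed

text \<open>One derivative of \<open>f\<close> more than of \<open>q\<close> is gained (ellipticity would give two). The induction
  differentiates the equation, which is possible once \<open>f\<close> is known to be \<open>C\<^sup>3\<close>.\<close>

lemma Ck_on_Suc_if_laplacian_Ck_on:
  fixes f :: "'a::euclidean_space \<Rightarrow> real"
  assumes S: "open S" and f: "Ck_on 2 S f" and q: "Ck_on (Suc (Suc m)) S q"
    and lap: "\<And>x. x \<in> S \<Longrightarrow> laplacian f x = q x"
  shows "Ck_on (Suc (Suc (Suc m))) S f"
  using f q lap
proof (induction m arbitrary: f q)
  case 0
  have "Ck_on 2 S q" using 0(2) unfolding numeral_2_eq_2 .
  then have "Ck_on 3 S f" by (rule Ck_on_3_if_laplacian_Ck_on_2[OF S 0(1) _ 0(3)])
  then show ?case unfolding numeral_3_eq_3 .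
next
  case (Suc m)
  have qm: "Ck_on (Suc (Suc m)) S q" using Suc.prems(2) by (rule Ck_on_SucD)
  have fm: "Ck_on (Suc (Suc (Suc m))) S f" by (rule Suc.IH[OF Suc.prems(1) qm Suc.prems(3)])
  have f3: "Ck_on 3 S f" by (rule Ck_on_le[OF fm]) simp
  have "Ck_on (Suc (Suc (Suc m))) S (partial_derivative e f)" if e: "e \<in> Basis" for e
  proof (rule Suc.IH)
    show "Ck_on 2 S (partial_derivative e f)" using f3 e by (simp add: numeral_3_eq_3 numeral_2_eq_2)
    show "Ck_on (Suc (Suc m)) S (partial_derivative e q)" using Suc.prems(2) e
      unfolding Ck_on.simps(2)[of "Suc (Suc m)"] by blast
    fix x assume x: "x \<in> S"
    show "laplacian (partial_derivative e f) x = partial_derivative e q x"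
      using laplacian_partial_derivative[OF S x f3 e] partial_derivative_cong[OF S x Suc.prems(3)] by simp
  qed
  moreover have "f differentiable (at x)" if "x \<in> S" for x
    using Ck_on_2D(1)[OF Suc.prems(1) SOME_Basis that] .
  ultimately show ?case unfolding Ck_on.simps(2)[of "Suc (Suc (Suc m))"] by blast
qed

lemma Cinf_on_if_laplacian_eq_exp:
  fixes f :: "'a::euclidean_space \<Rightarrow> real"
  assumes S: "open S" and f: "Ck_on 2 S f" and lap: "\<And>x. x \<in> S \<Longrightarrow> laplacian f x = exp (f x)"
  shows "Cinf_on S f"
proof -
  have *: "Ck_on (Suc (Suc m)) S f" for m
  proof (induction m)
    case 0
    show ?case using f unfolding numeral_2_eq_2 .
  next
    case (Suc m)
    show ?case by (rule Ck_on_Suc_if_laplacian_Ck_on[OF S f Ck_on_exp[OF S Suc] lap])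
  qed
  have "Ck_on k S f" for k by (rule Ck_on_le[OF *[of k]]) simp
  then show ?thesis by (simp add: Cinf_on_def)
qed

section \<open>Comparison principle and local upper bounds\<close>

text \<open>Where \<open>f > g\<close> one has \<open>\<Delta>(f - g) \<ge> exp f - exp g > 0\<close>, so the maximum principle applies.\<close>

lemma comparison_principle:
  fixes f g :: "'a::euclidean_space \<Rightarrow> real"
  assumes S: "open S" "bounded S" and f: "Ck_on 2 S f" and g: "Ck_on 2 S g"
    and sub: "\<And>x. x \<in> S \<Longrightarrow> exp (f x) \<le> laplacian f x"
    and super: "\<And>x. x \<in> S \<Longrightarrow> laplacian g x \<le> exp (g x)"
    and bd: "\<And>z e. z \<in> frontier S \<Longrightarrow> e > 0 \<Longrightarrow> eventually (\<lambda>x. f x \<le> g x + e) (at z within S)"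
    and x: "x \<in> S"
  shows "f x \<le> g x"
proof -
  have "f x - g x \<le> 0"
  proof (rule maximum_principle[OF S Ck_on_diff[OF S(1) f g] _ _ x])
    show "laplacian (\<lambda>x. f x - g x) y > 0" if "y \<in> S" "f y - g y > 0" for y
    proof -
      have "laplacian g y \<le> exp (g y)" using super that by blast
      also have "exp (g y) < exp (f y)" using that by simp
      also have "exp (f y) \<le> laplacian f y" using sub that by blast
      finally show ?thesis using laplacian_diff[OF S(1) f g that(1)] by simp
    qed
    show "eventually (\<lambda>x. f x - g x \<le> e) (at z within S)" if "z \<in> frontier S" "e > 0" for z e
      using bd[OF that] by eventually_elim simp
  qed
  then show ?thesis by simp
qed

text \<open>The function \<open>V(y) = k - 2 ln (\<rho>\<^sup>2 - |y - x|\<^sup>2)\<close> is infinite on the sphere of radius \<open>\<rho>\<close>, so it lies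
  above any solution as soon as it is a supersolution, whatever the boundary values of \<open>w\<close>. Its value at the
  centre is the bound.\<close>

lemma Keller_Osserman_bound:
  fixes w :: "'a::euclidean_space \<Rightarrow> real"
  assumes r: "r > 0" and w: "Ck_on 2 (ball x r) w"
    and lap: "\<And>y. y \<in> ball x r \<Longrightarrow> laplacian w y = exp (w y)"
  shows "w x \<le> ln (4 * real DIM('a) + 8) - 2 * ln (r / 2)"
proof -
  define \<rho> where "\<rho> = r / 2"
  have \<rho>: "\<rho> > 0" "\<rho> < r" using r by (auto simp: \<rho>_def)
  define n where "n = real DIM('a)"
  have n: "n \<ge> 0" by (simp add: n_def)
  define R where "R = \<rho>\<^sup>2"
  have R: "R > 0" using \<rho> by (simp add: R_def)
  \<comment> \<open>With \<open>q = R - t\<close> the Laplacian of the barrier is \<open>(4 n q + 8 t) / q\<^sup>2\<close>, whereas its exponential is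
    \<open>exp k / q\<^sup>2\<close>; this is the least \<open>k\<close> given by the crude bounds \<open>q \<le> R\<close> and \<open>t \<le> R\<close>.\<close>
  define k where "k = ln ((4 * n + 8) * R)"
  have k: "exp k = (4 * n + 8) * R" using n R by (simp add: k_def)
  define t where "t = (\<lambda>y. (y - x) \<bullet> (y - x))"
  define \<phi> where "\<phi> = (\<lambda>t. k - 2 * ln (R - t))"
  have tS: "t y < R" if "y \<in> ball x \<rho>" for y
    using that \<rho> by (simp add: t_def R_def dist_norm norm_minus_commute power2_norm_eq_inner[symmetric] power_strict_mono)
  have t0: "t y \<ge> 0" for y by (simp add: t_def)
  have t2: "Ck_on 2 S t" for S unfolding t_def by (rule Ck_on_norm_square)
  have d1: "(\<phi> has_real_derivative 2 / (R - s)) (at s)" if "s \<in> {..<R}" for s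
    unfolding \<phi>_def using that by (auto intro!: derivative_eq_intros simp: field_simps)
  have d2: "((\<lambda>s. 2 / (R - s)) has_real_derivative 2 / (R - s)\<^sup>2) (at s)" if "s \<in> {..<R}" for s
    using that by (auto intro!: derivative_eq_intros simp: field_simps power2_eq_square)
  have c: "continuous_on {..<R} (\<lambda>s. 2 / (R - s)\<^sup>2)"
    by (intro continuous_intros) auto
  note V = Ck_on_2_chain[OF open_ball t2 _ d1 d2 c, of x \<rho>]
  note lapV = laplacian_chain[OF open_ball t2 _ d1 d2 c, of x \<rho>]
  have sub: "ball x \<rho> \<subseteq> ball x r" using \<rho> by auto
  have "w x \<le> \<phi> (t x)"
  proof (rule comparison_principle[OF open_ball bounded_ball Ck_on_subset[OF w sub], of "\<lambda>y. \<phi> (t y)"])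
    show "Ck_on 2 (ball x \<rho>) (\<lambda>y. \<phi> (t y))" using V tS by blast
    show "exp (w y) \<le> laplacian w y" if "y \<in> ball x \<rho>" for y
      using lap that sub by (metis order_refl subsetD)
    show "laplacian (\<lambda>y. \<phi> (t y)) y \<le> exp (\<phi> (t y))" if y: "y \<in> ball x \<rho>" for y
    proof -
      define q where "q = R - t y"
      have q: "q > 0" "q \<le> R" using tS[OF y] t0[of y] by (auto simp: q_def)
      have "laplacian (\<lambda>y. \<phi> (t y)) y = 2 / (R - t y) * laplacian t y
          + 2 / (R - t y)\<^sup>2 * (\<Sum>b\<in>Basis. (partial_derivative b t y)\<^sup>2)"
        using lapV tS y by blast
      also have "\<dots> = 2 / q * (2 * n) + 2 / q\<^sup>2 * (4 * t y)"
        unfolding t_def laplacian_norm_square sum_partial_norm_square n_def q_def ..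
      also have "\<dots> = (4 * n * q + 8 * t y) / q\<^sup>2"
        using q by (simp add: field_simps power2_eq_square)
      also have "\<dots> \<le> ((4 * n + 8) * R) / q\<^sup>2"
      proof (rule divide_right_mono)
        have "4 * n * q \<le> 4 * n * R" using n q by (intro mult_left_mono) auto
        moreover have "8 * t y \<le> 8 * R" using tS[OF y] by simp
        ultimately show "4 * n * q + 8 * t y \<le> (4 * n + 8) * R" by (simp add: algebra_simps)
      qed simp
      also have "\<dots> = exp (\<phi> (t y))"
        using q k exp_of_nat_mult[of 2 "ln q"] by (simp add: \<phi>_def q_def[symmetric] exp_diff)
      finally show ?thesis .
    qed
    show "x \<in> ball x \<rho>" using \<rho> by simp
    fix z e assume z: "z \<in> frontier (ball x \<rho>)" and e: "(e::real) > 0"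
    have "continuous_on (cball x \<rho>) w"
      by (rule continuous_on_subset[OF Ck_on_imp_continuous_on[OF w]]) (use \<rho> in auto)
    then have "bounded (w ` cball x \<rho>)"
      by (intro compact_imp_bounded compact_continuous_image) auto
    then obtain B where B: "\<And>y. y \<in> cball x \<rho> \<Longrightarrow> w y \<le> B"
      unfolding bounded_iff by (metis abs_le_D1 imageI real_norm_def)
    define c where "c = exp ((k - B) / 2)"
    have "t z = R" using z \<rho>
      by (simp add: t_def R_def frontier_ball dist_norm norm_minus_commute power2_norm_eq_inner[symmetric])
    moreover have "(t \<longlongrightarrow> t z) (at z within ball x \<rho>)"
    proof -
      have "isCont t z" using Ck_on_imp_continuous_on[OF t2[of UNIV]]
        by (simp add: continuous_on_eq_continuous_within)
      then show ?thesis using continuous_at_imp_continuous_at_within continuous_within by blast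
    qed
    ultimately have "eventually (\<lambda>y. t y > R - c) (at z within ball x \<rho>)"
      by (intro order_tendstoD(1)) (auto simp: c_def)
    moreover have "eventually (\<lambda>y. y \<in> ball x \<rho>) (at z within ball x \<rho>)"
      by (simp add: eventually_at_filter)
    ultimately show "eventually (\<lambda>y. w y \<le> \<phi> (t y) + e) (at z within ball x \<rho>)"
    proof eventually_elim
      case (elim y)
      have "ln (R - t y) \<le> ln c" using elim tS[of y] by (subst ln_le_cancel_iff) (auto simp: c_def)
      then have "B \<le> \<phi> (t y)" by (simp add: c_def \<phi>_def)
      moreover have "w y \<le> B" using elim by (intro B) auto
      ultimately show ?case using e by simp
    qed
  qed
  also have "\<phi> (t x) = ln (4 * n + 8) - 2 * ln \<rho>"
    using n \<rho> by (simp add: t_def \<phi>_def k_def R_def ln_mult ln_realpow)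
  finally show ?thesis by (simp add: n_def \<rho>_def)
qed

section \<open>Locally uniform convergence\<close>

lemma uniform_limit_exp:
  fixes f :: "'i \<Rightarrow> 'b \<Rightarrow> real"
  assumes fg: "uniform_limit K f g F" and g: "bounded (g ` K)"
  shows "uniform_limit K (\<lambda>i x. exp (f i x)) (\<lambda>x. exp (g x)) F"
proof -
  obtain B where B: "\<And>x. x \<in> K \<Longrightarrow> \<bar>g x\<bar> \<le> B"
    using g unfolding bounded_iff by auto
  show ?thesis
  proof (rule uniform_limit_compose_uniformly_continuous_on[OF fg])
    show "uniformly_continuous_on (cball 0 (B + 1)) (exp :: real \<Rightarrow> real)"
      by (intro compact_uniformly_continuous continuous_intros) auto
    show "eventually (\<lambda>i. \<forall>y\<in>K. f i y \<in> cball 0 (B + 1)) F"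
      using uniform_limitD[OF fg zero_less_one]
    proof eventually_elim
      case (elim i)
      show ?case
      proof
        fix y assume y: "y \<in> K"
        have "\<bar>f i y\<bar> \<le> \<bar>g y\<bar> + dist (f i y) (g y)" by (simp add: dist_real_def)
        also have "\<dots> \<le> B + 1" using elim y B[OF y] by (meson add_mono less_imp_le)
        finally show "f i y \<in> cball 0 (B + 1)" by simp
      qed
    qed
  qed simp
qed

lemma uniform_limit_compact_if_locally:
  assumes "\<And>x. x \<in> S \<Longrightarrow> \<exists>r>0. uniform_limit (ball x r) f g F"
    and K: "compact K" "K \<subseteq> S"
  shows "uniform_limit K f g F"
proof -
  have "\<forall>x\<in>K. \<exists>r>0. uniform_limit (ball x r) f g F" using assms by blast
  then obtain r where r: "\<And>x. x \<in> K \<Longrightarrow> r x > 0" "\<And>x. x \<in> K \<Longrightarrow> uniform_limit (ball x (r x)) f g F"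
    by metis
  obtain D where D: "D \<subseteq> K" "finite D" "K \<subseteq> (\<Union>x\<in>D. ball x (r x))"
  proof (rule compactE_image[OF K(1), of K "\<lambda>x. ball x (r x)"])
    show "K \<subseteq> (\<Union>x\<in>K. ball x (r x))"
    proof
      fix x assume "x \<in> K"
      with r(1) have "x \<in> ball x (r x)" by simp
      with \<open>x \<in> K\<close> show "x \<in> (\<Union>x\<in>K. ball x (r x))" by blast
    qed
  qed simp
  have "uniform_limit (\<Union>x\<in>D. ball x (r x)) f g F"
    using D r by (intro uniform_limit_on_UNION) auto
  then show ?thesis using D(3) by (rule uniform_limit_on_subset)
qed

text \<open>A finite net with mesh \<open>d\<close> reduces uniform convergence to convergence at its finitely many points.\<close>

lemma uniform_limit_if_equi_Lipschitz:
  fixes f :: "nat \<Rightarrow> 'a::metric_space \<Rightarrow> real"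
  assumes K: "compact K" and L: "\<And>n x y. x \<in> K \<Longrightarrow> y \<in> K \<Longrightarrow> \<bar>f n x - f n y\<bar> \<le> L * dist x y"
    and lim: "\<And>x. x \<in> K \<Longrightarrow> (\<lambda>n. f n x) \<longlonglongrightarrow> g x"
  shows "uniform_limit K f g sequentially"
proof (rule uniform_limitI)
  fix e :: real assume e: "e > 0"
  define d where "d = e / (3 * (\<bar>L\<bar> + 1))"
  have d: "d > 0" using e by (simp add: d_def)
  have Ld: "L * s \<le> e / 3" if "0 \<le> s" "s \<le> d" for s
  proof -
    have "L * s \<le> (\<bar>L\<bar> + 1) * d" using that by (intro mult_mono) auto
    also have "(\<bar>L\<bar> + 1) * d = e / 3"
    proof -
      have "\<bar>L\<bar> + 1 \<noteq> 0" by linarith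
      then show ?thesis unfolding d_def by (simp add: divide_simps)
    qed
    finally show ?thesis .
  qed
  obtain D where D: "D \<subseteq> K" "finite D" "K \<subseteq> (\<Union>x\<in>D. ball x d)"
  proof (rule compactE_image[OF K, of K "\<lambda>x. ball x d"])
    show "K \<subseteq> (\<Union>x\<in>K. ball x d)" using d by auto
  qed simp
  have Lg: "\<bar>g x - g y\<bar> \<le> L * dist x y" if "x \<in> K" "y \<in> K" for x y
    by (rule LIMSEQ_le_const2[OF tendsto_rabs[OF tendsto_diff[OF lim lim]]]) (use L that in auto)
  have "eventually (\<lambda>n. \<forall>y\<in>D. dist (f n y) (g y) < e / 3) sequentially"
    using D e by (intro eventually_ball_finite tendstoD lim ballI) auto
  then show "\<forall>\<^sub>F n in sequentially. \<forall>x\<in>K. dist (f n x) (g x) < e"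
  proof eventually_elim
    case (elim n)
    show ?case
    proof
      fix x assume x: "x \<in> K"
      then obtain y where y: "y \<in> D" "dist y x < d" using D(3) by auto
      then have "y \<in> K" using D by blast
      have "\<bar>f n x - f n y\<bar> \<le> e / 3" "\<bar>g x - g y\<bar> \<le> e / 3"
        using L[OF x \<open>y \<in> K\<close>, of n] Lg[OF x \<open>y \<in> K\<close>] Ld[of "dist x y"] y by (auto simp: dist_commute)
      moreover have "\<bar>f n y - g y\<bar> < e / 3" using elim y by (simp add: dist_real_def)
      ultimately show "dist (f n x) (g x) < e" unfolding dist_real_def by linarith
    qed
  qed
qed

lemma Lipschitz_if_partial_derivatives_bounded:
  fixes f :: "'a::euclidean_space \<Rightarrow> real"
  assumes S: "convex S" "open S" and f: "\<And>z. z \<in> S \<Longrightarrow> f differentiable (at z)"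
    and B: "\<And>b z. b \<in> Basis \<Longrightarrow> z \<in> S \<Longrightarrow> \<bar>partial_derivative b f z\<bar> \<le> B"
    and x: "x \<in> S" and y: "y \<in> S"
  shows "\<bar>f x - f y\<bar> \<le> (real DIM('a) * B) * dist x y"
proof -
  have "norm (f x - f y) \<le> (real DIM('a) * B) * norm (x - y)"
  proof (rule differentiable_bound[OF S(1) _ _ x y])
    show "(f has_derivative (\<lambda>h. \<Sum>b\<in>Basis. (h \<bullet> b) * partial_derivative b f z)) (at z within S)" if "z \<in> S" for z
      by (rule has_derivative_at_withinI[OF has_derivative_partial_derivatives[OF f[OF that]]])
    show "onorm (\<lambda>h. \<Sum>b\<in>Basis. (h \<bullet> b) * partial_derivative b f z) \<le> real DIM('a) * B" if z: "z \<in> S" for z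
    proof (rule onorm_le)
      fix h :: 'a
      have "norm (\<Sum>b\<in>Basis. (h \<bullet> b) * partial_derivative b f z) \<le> (\<Sum>b\<in>(Basis :: 'a set). norm h * B)"
      proof (rule order_trans[OF norm_sum], rule sum_mono)
        fix b :: 'a assume b: "b \<in> Basis"
        show "norm ((h \<bullet> b) * partial_derivative b f z) \<le> norm h * B"
          unfolding real_norm_def abs_mult using B[OF b z] Basis_le_norm[OF b, of h] by (intro mult_mono) auto
      qed
      then show "norm (\<Sum>b\<in>Basis. (h \<bullet> b) * partial_derivative b f z) \<le> (real DIM('a) * B) * norm h"
        by (simp add: algebra_simps)
    qed
  qed
  then show ?thesis by (simp add: dist_norm)
qed

text \<open>The gradient estimate makes the sequence equi-Lipschitz on smaller balls.\<close>

lemma uniform_limit_if_laplacian_bounded: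
  fixes f :: "nat \<Rightarrow> 'a::euclidean_space \<Rightarrow> real"
  assumes r: "r > 0" and f: "\<And>n. Ck_on 2 (ball x r) (f n)"
    and M: "\<And>n y. y \<in> ball x r \<Longrightarrow> \<bar>f n y\<bar> \<le> M"
    and N: "\<And>n y. y \<in> ball x r \<Longrightarrow> \<bar>laplacian (f n) y\<bar> \<le> N"
    and lim: "\<And>y. y \<in> ball x r \<Longrightarrow> (\<lambda>n. f n y) \<longlonglongrightarrow> g y"
  shows "uniform_limit (ball x (r/3)) f g sequentially"
proof -
  define N' where "N' = \<bar>N\<bar> + 1"
  have N': "N' > 0" "\<And>n y. y \<in> ball x r \<Longrightarrow> \<bar>laplacian (f n) y\<bar> \<le> N'"
  proof -
    show "\<bar>laplacian (f n) y\<bar> \<le> N'" if "y \<in> ball x r" for n y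
      using N[OF that, of n] abs_ge_self[of N] by (simp add: N'_def)
  qed (simp add: N'_def)
  define B where "B = 2 * real DIM('a) * M / (r/2) + N' * (r/2)"
  have s: "ball y (r/2) \<subseteq> ball x r" if y: "y \<in> ball x (r/2)" for y
  proof
    fix z assume "z \<in> ball y (r/2)"
    then show "z \<in> ball x r" using y dist_triangle[of x z y] by auto
  qed
  have B: "\<bar>partial_derivative b (f n) y\<bar> \<le> B" if "b \<in> Basis" "y \<in> ball x (r/2)" for b y n
    unfolding B_def
    by (rule gradient_estimate[OF _ Ck_on_subset[OF f s[OF that(2)]] that(1)])
       (use r N' M s[OF that(2)] in auto)
  have "uniform_limit (cball x (r/3)) f g sequentially"
  proof (rule uniform_limit_if_equi_Lipschitz)
    show "\<bar>f n y - f n z\<bar> \<le> (real DIM('a) * B) * dist y z" if "y \<in> cball x (r/3)" "z \<in> cball x (r/3)" for n y z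
    proof (rule Lipschitz_if_partial_derivatives_bounded[OF convex_ball open_ball _ B])
      show "f n differentiable (at y)" if "y \<in> ball x (r/2)" for y
        by (rule Ck_on_2D(1)[OF f SOME_Basis]) (use that r in auto)
    qed (use that r in auto)
    show "(\<lambda>n. f n y) \<longlonglongrightarrow> g y" if "y \<in> cball x (r/3)" for y
      by (rule lim) (use that r in auto)
  qed simp
  then show ?thesis by (rule uniform_limit_on_subset) auto
qed

section \<open>Solutions with constant boundary values\<close>

text \<open>The boundary value is attained as a limit from inside, so that nothing is said about the values of \<open>w\<close> outside
  \<open>\<Omega>\<close>.\<close>

definition dirichlet_solution :: "'a::euclidean_space set \<Rightarrow> real \<Rightarrow> ('a \<Rightarrow> real) \<Rightarrow> bool" where
  "dirichlet_solution \<Omega> c w \<longleftrightarrow> Ck_on 2 \<Omega> w \<and> (\<forall>x\<in>\<Omega>. laplacian w x = exp (w x)) \<and>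
     (\<forall>z\<in>frontier \<Omega>. (w \<longlongrightarrow> c) (at z within \<Omega>))"

text \<open>Adding \<open>c = ln (-\<lambda>)\<close> absorbs the factor \<open>\<lambda>\<close> into the exponential.\<close>

lemma dirichlet_solution_if_negative_solution:
  assumes \<Omega>: "open \<Omega>" and u: "negative_solution \<Omega> (- exp c) u"
  shows "dirichlet_solution \<Omega> c (\<lambda>x. u x + c)"
  unfolding dirichlet_solution_def
proof (intro conjI ballI)
  have u2: "Ck_on 2 \<Omega> u" using u by (simp add: negative_solution_def)
  show "Ck_on 2 \<Omega> (\<lambda>x. u x + c)" by (intro Ck_on_add \<Omega> u2 Ck_on_const)
  show "laplacian (\<lambda>x. u x + c) x = exp (u x + c)" if "x \<in> \<Omega>" for x
  proof -
    have "- laplacian u x = - exp c * exp (u x)" using u that by (simp add: negative_solution_def)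
    then show ?thesis using laplacian_add[OF \<Omega> u2 Ck_on_const that, of c] by (simp add: exp_add)
  qed
  fix z assume z: "z \<in> frontier \<Omega>"
  have "continuous_on (closure \<Omega>) u" "u z = 0" using u z by (auto simp: negative_solution_def)
  then have "(u \<longlongrightarrow> 0) (at z within closure \<Omega>)"
    using z by (auto simp: continuous_on_def frontier_def)
  then have "(u \<longlongrightarrow> 0) (at z within \<Omega>)" by (rule tendsto_within_subset) (rule closure_subset)
  then show "((\<lambda>x. u x + c) \<longlongrightarrow> c) (at z within \<Omega>)" using tendsto_add[of u 0 _ "\<lambda>x. c" c] by simp
qed

lemma dirichlet_solution_le:
  assumes \<Omega>: "open \<Omega>" "bounded \<Omega>" and w: "dirichlet_solution \<Omega> c w" and v: "Ck_on 2 \<Omega> v"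
    "\<And>x. x \<in> \<Omega> \<Longrightarrow> laplacian v x \<le> exp (v x)"
    and bd: "\<And>z e. z \<in> frontier \<Omega> \<Longrightarrow> e > 0 \<Longrightarrow> eventually (\<lambda>x. c - e < v x) (at z within \<Omega>)"
    and x: "x \<in> \<Omega>"
  shows "w x \<le> v x"
proof (rule comparison_principle[OF \<Omega> _ v(1) _ v(2) _ x])
  show "eventually (\<lambda>x. w x \<le> v x + e) (at z within \<Omega>)" if z: "z \<in> frontier \<Omega>" and e: "e > 0" for z e
  proof -
    have "(w \<longlongrightarrow> c) (at z within \<Omega>)" using w z by (simp add: dirichlet_solution_def)
    then have "eventually (\<lambda>x. w x < c + e / 2) (at z within \<Omega>)"
      using e by (intro order_tendstoD(2)) auto
    then show ?thesis using bd[OF z half_gt_zero[OF e]] by eventually_elim linarith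
  qed
qed (use w in \<open>auto simp: dirichlet_solution_def\<close>)

lemma dirichlet_solution_mono:
  assumes \<Omega>: "open \<Omega>" "bounded \<Omega>" and w: "dirichlet_solution \<Omega> c w" and v: "dirichlet_solution \<Omega> d v"
    and "c \<le> d" and x: "x \<in> \<Omega>"
  shows "w x \<le> v x"
proof (rule dirichlet_solution_le[OF \<Omega> w _ _ _ x])
  show "eventually (\<lambda>x. c - e < v x) (at z within \<Omega>)" if "z \<in> frontier \<Omega>" "e > 0" for z e
    by (rule order_tendstoD(1)[of v d]) (use that v \<open>c \<le> d\<close> in \<open>auto simp: dirichlet_solution_def\<close>)
qed (use v in \<open>auto simp: dirichlet_solution_def\<close>)

text \<open>A first application of the convergence theorem shows that the gradients of \<open>f n\<close> converge. As
  \<open>\<Delta>\<partial>\<^sub>b f\<^sub>n = exp f\<^sub>n \<cdot> \<partial>\<^sub>b f\<^sub>n\<close>, the Laplacians of the gradients then converge too, and a second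
  application gives convergence of the second derivatives, hence of both sides of the equation. The radius
  is halved in each application and once more to have \<open>\<partial>\<^sub>b g\<close> bounded.\<close>

lemma uniform_limit_laplacian_exp_limit:
  fixes f :: "nat \<Rightarrow> 'a::euclidean_space \<Rightarrow> real"
  assumes r: "r > 0" and f: "\<And>n. Cinf_on (ball x r) (f n)"
    and lap: "\<And>n y. y \<in> ball x r \<Longrightarrow> laplacian (f n) y = exp (f n y)"
    and M: "\<And>n y. y \<in> ball x r \<Longrightarrow> \<bar>f n y\<bar> \<le> M"
    and lim: "uniform_limit (ball x r) f g sequentially"
  shows "Ck_on 2 (ball x (r/8)) g" and "laplacian g x = exp (g x)"
proof -
  have Ck: "Ck_on k (ball x r) (f n)" for k n using f by (simp add: Cinf_on_def)
  have limy: "(\<lambda>n. f n y) \<longlonglongrightarrow> g y" if "y \<in> ball x r" for y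
    using tendsto_uniform_limitI[OF lim that] .
  have g: "\<bar>g y\<bar> \<le> M" if "y \<in> ball x r" for y
    by (rule LIMSEQ_le_const2[OF tendsto_rabs[OF limy[OF that]]]) (use M that in auto)
  have elim: "uniform_limit (ball x r) (\<lambda>n y. exp (f n y)) (\<lambda>y. exp (g y)) sequentially"
    by (rule uniform_limit_exp[OF lim]) (use g in \<open>auto simp: bounded_iff intro!: exI[of _ M]\<close>)
  then have "uniform_limit (ball x r) (\<lambda>n. laplacian (f n)) (\<lambda>y. exp (g y)) sequentially"
    by (rule uniform_limit_cong'[THEN iffD1, rotated 2]) (use lap in auto)
  note P = partial_derivatives_uniform_limit[OF r Ck lim this]
  have g1: "continuous_on (cball x (r/4)) (partial_derivative b g)" if "b \<in> Basis" for b
    by (rule continuous_on_subset[of "ball x (r/2)"]) (use P(1) that r in auto)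
  have sub: "ball x (r/4) \<subseteq> ball x r" "ball x (r/4) \<subseteq> ball x (r/2)" "ball x (r/8) \<subseteq> ball x (r/2)"
    using r by auto
  have Q: "Ck_on 1 (ball x (r/8)) (partial_derivative b g)"
    "c \<in> Basis \<Longrightarrow> uniform_limit (ball x (r/8)) (\<lambda>n. partial_derivative c (partial_derivative b (f n)))
        (partial_derivative c (partial_derivative b g)) sequentially"
    if b: "b \<in> Basis" for b c
  proof -
    have P': "uniform_limit (ball x (r/4)) (\<lambda>n. partial_derivative b (f n)) (partial_derivative b g) sequentially"
      using P(2)[OF b] sub(2) by (rule uniform_limit_on_subset)
    have prod: "uniform_limit (ball x (r/4)) (\<lambda>n y. exp (f n y) * partial_derivative b (f n) y)
       (\<lambda>y. exp (g y) * partial_derivative b g y) sequentially"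
    proof (rule uniform_lim_mult[OF uniform_limit_on_subset[OF elim sub(1)] P'])
      show "bounded ((\<lambda>y. exp (g y)) ` ball x (r/4))"
        using g sub(1) by (intro boundedI[of _ "exp M"]) (fastforce simp: abs_le_iff)
      have "bounded (partial_derivative b g ` cball x (r/4))"
        by (intro compact_imp_bounded compact_continuous_image g1 b) auto
      then show "bounded (partial_derivative b g ` ball x (r/4))"
        by (rule bounded_subset) auto
    qed
    have eqn: "exp (f n y) * partial_derivative b (f n) y = laplacian (partial_derivative b (f n)) y"
      if y: "y \<in> ball x (r/4)" for n y
    proof -
      have yr: "y \<in> ball x r" using y sub by blast
      have "laplacian (partial_derivative b (f n)) y = partial_derivative b (laplacian (f n)) y"
        by (rule laplacian_partial_derivative[OF open_ball yr Ck b])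
      also have "\<dots> = partial_derivative b (\<lambda>y. exp (f n y)) y"
        by (rule partial_derivative_cong[OF open_ball yr lap])
      also have "\<dots> = exp (f n y) * partial_derivative b (f n) y"
        by (rule partial_derivative_chain[OF Ck_on_2D(1)[OF Ck b yr] DERIV_exp])
      finally show ?thesis by simp
    qed
    from prod have lim': "uniform_limit (ball x (r/4)) (\<lambda>n. laplacian (partial_derivative b (f n)))
       (\<lambda>y. exp (g y) * partial_derivative b g y) sequentially"
      by (rule uniform_limit_cong'[THEN iffD1, rotated 2]) (use eqn in auto)
    have C: "Ck_on 2 (ball x (r/4)) (partial_derivative b (f n))" for n
    proof -
      have "Ck_on (Suc 2) (ball x (r/4)) (f n)" by (rule Ck_on_subset[OF Ck sub(1)])
      then show ?thesis using b unfolding Ck_on.simps(2)[of 2] by blast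
    qed
    have r4: "r / 4 > 0" using r by simp
    have eq: "r / 4 / 2 = r / 8" by simp
    note R = partial_derivatives_uniform_limit[OF r4 C P' lim', unfolded eq]
    show "Ck_on 1 (ball x (r/8)) (partial_derivative b g)" by (rule R(1))
    show "c \<in> Basis \<Longrightarrow> uniform_limit (ball x (r/8)) (\<lambda>n. partial_derivative c (partial_derivative b (f n)))
        (partial_derivative c (partial_derivative b g)) sequentially" by (rule R(2))
  qed
  have "Ck_on 1 (ball x (r/8)) g" using P(1) sub(3) by (rule Ck_on_subset)
  then show "Ck_on 2 (ball x (r/8)) g"
    using Q(1) by (simp add: numeral_2_eq_2)
  have "(\<lambda>n. laplacian (f n) x) \<longlonglongrightarrow> laplacian g x"
    unfolding laplacian_def
    by (intro tendsto_sum tendsto_uniform_limitI[OF Q(2)]) (use r in auto)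
  moreover have "(\<lambda>n. laplacian (f n) x) \<longlonglongrightarrow> exp (g x)"
    using tendsto_exp[OF limy[of x]] lap[of x] r by simp
  ultimately show "laplacian g x = exp (g x)" by (rule LIMSEQ_unique)
qed

text \<open>The solutions increase with their boundary values and are bounded above on compact sets by the
  Keller-Osserman bound and below by the solution with boundary value \<open>0\<close>. The limit inherits the
  equation, and it exceeds each \<open>w c\<close>, whence the blow-up on the frontier.\<close>

lemma large_solution_limit:
  fixes \<Omega> :: "'a::euclidean_space set" and w :: "real \<Rightarrow> 'a \<Rightarrow> real"
  assumes \<Omega>: "open \<Omega>" "bounded \<Omega>" and w: "\<And>c. dirichlet_solution \<Omega> c (w c)"
  obtains v where "boundary_blowup_solution \<Omega> v" "\<And>c x. x \<in> \<Omega> \<Longrightarrow> w c x \<le> v x"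
    "\<And>x. x \<in> \<Omega> \<Longrightarrow> \<exists>r>0. uniform_limit (ball x r) (\<lambda>n. w (real n)) v sequentially"
proof -
  have w2: "Ck_on 2 \<Omega> (w c)" for c using w by (auto simp: dirichlet_solution_def)
  have lap: "laplacian (w c) x = exp (w c x)" if "x \<in> \<Omega>" for c x
    using w that by (auto simp: dirichlet_solution_def)
  have mono: "w c x \<le> w d x" if "x \<in> \<Omega>" "c \<le> d" for c d x
    using dirichlet_solution_mono[OF \<Omega> w w that(2,1)] .
  have KO: "w c y \<le> ln (4 * real DIM('a) + 8) - 2 * ln (r / 2)" if "r > 0" "ball y r \<subseteq> \<Omega>" for c y r
    by (rule Keller_Osserman_bound[OF that(1) Ck_on_subset[OF w2 that(2)]]) (use lap that in auto)
  define v where "v = (\<lambda>x. lim (\<lambda>n. w (real n) x))"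
  have lim: "(\<lambda>n. w (real n) x) \<longlonglongrightarrow> v x" and le: "w c x \<le> v x" if x: "x \<in> \<Omega>" for x c
  proof -
    obtain r where r: "r > 0" "ball x r \<subseteq> \<Omega>" using \<Omega>(1) x openE by blast
    have inc: "incseq (\<lambda>n. w (real n) x)" using mono x by (auto simp: incseq_def)
    from incseq_convergent[OF this] KO[OF r]
    obtain L where L: "(\<lambda>n. w (real n) x) \<longlonglongrightarrow> L" by blast
    then show l: "(\<lambda>n. w (real n) x) \<longlonglongrightarrow> v x" by (simp add: v_def limI)
    obtain n where "c \<le> real n" using real_arch_simple by blast
    then have "w c x \<le> w (real n) x" by (intro mono x)
    also have "\<dots> \<le> v x" using incseq_le[OF inc l] .
    finally show "w c x \<le> v x" .
  qed
  have local: "\<exists>r>0. ball x r \<subseteq> \<Omega> \<and> uniform_limit (ball x r) (\<lambda>n. w (real n)) v sequentially \<and>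
      (\<exists>M. \<forall>n. \<forall>y\<in>ball x r. \<bar>w (real n) y\<bar> \<le> M)" if x: "x \<in> \<Omega>" for x
  proof -
    obtain r where r: "r > 0" "ball x (3 * r) \<subseteq> \<Omega>" using \<Omega>(1) x by (rule ball_steps)
    have sub: "ball x r \<subseteq> \<Omega>" "cball x r \<subseteq> \<Omega>" using r by (auto intro!: subsetD[OF r(2)])
    have suby: "ball y r \<subseteq> \<Omega>" if "y \<in> ball x r" for y
    proof
      fix z assume "z \<in> ball y r"
      then have "z \<in> ball x (3 * r)" using that dist_triangle[of x z y] r by auto
      then show "z \<in> \<Omega>" using r by blast
    qed
    have "bounded (w 0 ` cball x r)"
      using Ck_on_imp_continuous_on[OF w2] sub
      by (intro compact_imp_bounded compact_continuous_image) (auto intro: continuous_on_subset)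
    then obtain B where B: "\<And>y. y \<in> cball x r \<Longrightarrow> \<bar>w 0 y\<bar> \<le> B"
      unfolding bounded_iff by (metis imageI real_norm_def)
    define A where "A = ln (4 * real DIM('a) + 8) - 2 * ln (r / 2)"
    define M where "M = max A B"
    have M: "\<bar>w (real n) y\<bar> \<le> M" if y: "y \<in> ball x r" for n y
    proof -
      have "w (real n) y \<le> A" unfolding A_def by (rule KO[OF r(1) suby[OF y]])
      moreover have "w 0 y \<le> w (real n) y" using y sub by (intro mono) auto
      moreover have "\<bar>w 0 y\<bar> \<le> B" using y by (intro B) auto
      ultimately show ?thesis by (simp add: M_def abs_le_iff max_def)
    qed
    have "uniform_limit (ball x (r/3)) (\<lambda>n. w (real n)) v sequentially"
    proof (rule uniform_limit_if_laplacian_bounded[OF r(1) Ck_on_subset[OF w2 sub(1)] M])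
      show "\<bar>laplacian (w (real n)) y\<bar> \<le> exp M" if "y \<in> ball x r" for n y
      proof -
        have "laplacian (w (real n)) y = exp (w (real n) y)" using sub that by (intro lap) auto
        then show ?thesis using M[OF that, of n] by (simp add: abs_le_iff)
      qed
    qed (use lim sub in auto)
    moreover have "ball x (r/3) \<subseteq> ball x r" using r by auto
    ultimately show ?thesis
      using r(1) sub(1) M by (intro exI[of _ "r/3"]) (auto intro!: exI[of _ M])
  qed
  have C: "Cinf_on \<Omega> (w c)" for c
    by (rule Cinf_on_if_laplacian_eq_exp[OF \<Omega>(1) w2 lap])
  have sol: "\<exists>T. open T \<and> x \<in> T \<and> Ck_on 2 T v" "laplacian v x = exp (v x)" if x: "x \<in> \<Omega>" for x
  proof -
    obtain r M where r: "r > 0" "ball x r \<subseteq> \<Omega>"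
      and ul: "uniform_limit (ball x r) (\<lambda>n. w (real n)) v sequentially"
      and M: "\<And>n y. y \<in> ball x r \<Longrightarrow> \<bar>w (real n) y\<bar> \<le> M"
      using local[OF x] by blast
    have Cb: "Cinf_on (ball x r) (w (real n))" for n
      using C Ck_on_subset[OF _ r(2)] unfolding Cinf_on_def by blast
    have lapb: "laplacian (w (real n)) y = exp (w (real n) y)" if "y \<in> ball x r" for n y
      using lap r(2) that by blast
    note R = uniform_limit_laplacian_exp_limit[OF r(1) Cb lapb M ul]
    show "laplacian v x = exp (v x)" by (rule R(2))
    show "\<exists>T. open T \<and> x \<in> T \<and> Ck_on 2 T v"
      using R(1) r(1) by (intro exI[of _ "ball x (r/8)"]) auto
  qed
  have "boundary_blowup_solution \<Omega> v"
    unfolding boundary_blowup_solution_def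
  proof (intro conjI ballI)
    show "Ck_on 2 \<Omega> v" by (rule Ck_on_locally) (rule sol)
    show "filterlim v at_top (at z within \<Omega>)" if z: "z \<in> frontier \<Omega>" for z
      unfolding filterlim_at_top
    proof
      fix Z
      have "(w (Z + 1) \<longlongrightarrow> Z + 1) (at z within \<Omega>)" using w z by (auto simp: dirichlet_solution_def)
      then have "eventually (\<lambda>x. Z < w (Z + 1) x) (at z within \<Omega>)"
        by (intro order_tendstoD(1)) auto
      moreover have "eventually (\<lambda>x. x \<in> \<Omega>) (at z within \<Omega>)" by (simp add: eventually_at_filter)
      ultimately show "eventually (\<lambda>x. Z \<le> v x) (at z within \<Omega>)"
      proof eventually_elim
        case (elim x)
        then show ?case using le[of x "Z + 1"] by simp
      qed
    qed
  qed (rule sol)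
  with le local show ?thesis by (intro that[of v]) blast+
qed

section \<open>Convergence of all derivatives\<close>

text \<open>Locally uniform convergence with \<open>k\<close> derivatives, with the recursion of \<open>Ck_on\<close>: the derivatives are
  taken on the functions themselves, so that the Leibniz and chain rules lead to simple inductions.\<close>

primrec Ck_tendsto ::
  "nat \<Rightarrow> 'a::euclidean_space set \<Rightarrow> ('i \<Rightarrow> 'a \<Rightarrow> real) \<Rightarrow> ('a \<Rightarrow> real) \<Rightarrow> 'i filter \<Rightarrow> bool" where
  "Ck_tendsto 0 S f g F \<longleftrightarrow> (\<forall>K. compact K \<and> K \<subseteq> S \<longrightarrow> uniform_limit K f g F)"
| "Ck_tendsto (Suc k) S f g F \<longleftrightarrow> (\<forall>K. compact K \<and> K \<subseteq> S \<longrightarrow> uniform_limit K f g F) \<and>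
     (\<forall>b\<in>Basis. Ck_tendsto k S (\<lambda>i. partial_derivative b (f i)) (partial_derivative b g) F)"

lemma Ck_tendsto_Suc:
  "Ck_tendsto (Suc k) S f g F \<longleftrightarrow> Ck_tendsto 0 S f g F \<and>
     (\<forall>b\<in>Basis. Ck_tendsto k S (\<lambda>i. partial_derivative b (f i)) (partial_derivative b g) F)"
  by simp

lemma Ck_tendsto_cong:
  assumes "open S" "\<And>i x. x \<in> S \<Longrightarrow> f i x = f' i x" "\<And>x. x \<in> S \<Longrightarrow> g x = g' x"
  shows "Ck_tendsto k S f g F \<longleftrightarrow> Ck_tendsto k S f' g' F"
  using assms(2,3)
proof (induction k arbitrary: f f' g g')
  case 0
  have "uniform_limit K f g F \<longleftrightarrow> uniform_limit K f' g' F" if "K \<subseteq> S" for K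
    by (rule uniform_limit_cong') (use 0 that in auto)
  then show ?case by auto
next
  case (Suc k)
  have *: "uniform_limit K f g F \<longleftrightarrow> uniform_limit K f' g' F" if "K \<subseteq> S" for K
    by (rule uniform_limit_cong') (use Suc.prems that in auto)
  have "Ck_tendsto k S (\<lambda>i. partial_derivative b (f i)) (partial_derivative b g) F \<longleftrightarrow>
        Ck_tendsto k S (\<lambda>i. partial_derivative b (f' i)) (partial_derivative b g') F" for b
    by (rule Suc.IH)
       (rule partial_derivative_cong[OF assms(1)], assumption, rule Suc.prems, assumption)+
  then show ?case using * by auto
qed

lemma Ck_tendsto_SucD: "Ck_tendsto (Suc k) S f g F \<Longrightarrow> Ck_tendsto k S f g F"
proof (induction k arbitrary: f g)
  case (Suc k)
  then show ?case unfolding Ck_tendsto_Suc by blast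
qed simp

lemma Ck_tendsto_add:
  assumes S: "open S" and "\<And>i. Cinf_on S (f i)" "\<And>i. Cinf_on S (g i)" "Cinf_on S a" "Cinf_on S b"
    and "Ck_tendsto k S f a F" "Ck_tendsto k S g b F"
  shows "Ck_tendsto k S (\<lambda>i x. f i x + g i x) (\<lambda>x. a x + b x) F"
  using assms(2-)
proof (induction k arbitrary: f g a b)
  case 0
  then show ?case by (auto intro: uniform_limit_add)
next
  case (Suc k)
  have D: "h differentiable (at x)" if "Cinf_on S h" "x \<in> S" for h x
    using that Ck_on.simps(2) unfolding Cinf_on_def by blast
  have "Ck_tendsto k S (\<lambda>i. partial_derivative e (\<lambda>x. f i x + g i x)) (partial_derivative e (\<lambda>x. a x + b x)) F"
    if e: "e \<in> Basis" for e
  proof (rule Ck_tendsto_cong[OF S partial_derivative_add partial_derivative_add, THEN iffD2])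
    show "Ck_tendsto k S (\<lambda>i x. partial_derivative e (f i) x + partial_derivative e (g i) x)
      (\<lambda>x. partial_derivative e a x + partial_derivative e b x) F"
      using Suc.prems e by (intro Suc.IH Cinf_on_partial_derivative) auto
  qed (use D Suc.prems in auto)
  moreover have "Ck_tendsto 0 S (\<lambda>i x. f i x + g i x) (\<lambda>x. a x + b x) F"
    using Suc.prems by (auto intro: uniform_limit_add)
  ultimately show ?case unfolding Ck_tendsto_Suc by blast
qed

lemma Cinf_on_mult: "open S \<Longrightarrow> Cinf_on S f \<Longrightarrow> Cinf_on S g \<Longrightarrow> Cinf_on S (\<lambda>x. f x * g x)"
  unfolding Cinf_on_def by (blast intro: Ck_on_mult)

lemma Cinf_on_exp: "open S \<Longrightarrow> Cinf_on S f \<Longrightarrow> Cinf_on S (\<lambda>x. exp (f x))"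
  unfolding Cinf_on_def by (blast intro: Ck_on_exp)

lemma bounded_image_if_Cinf_on: "Cinf_on S f \<Longrightarrow> compact K \<Longrightarrow> K \<subseteq> S \<Longrightarrow> bounded (f ` K)"
  unfolding Cinf_on_def
  by (meson Ck_on.simps(1) compact_continuous_image compact_imp_bounded continuous_on_subset)

lemma Cinf_on_differentiable: "Cinf_on S f \<Longrightarrow> x \<in> S \<Longrightarrow> f differentiable (at x)"
  unfolding Cinf_on_def using Ck_on.simps(2) by blast

lemma Ck_tendsto_mult:
  assumes S: "open S" and "\<And>i. Cinf_on S (f i)" "\<And>i. Cinf_on S (g i)" "Cinf_on S a" "Cinf_on S b"
    and "Ck_tendsto k S f a F" "Ck_tendsto k S g b F"
  shows "Ck_tendsto k S (\<lambda>i x. f i x * g i x) (\<lambda>x. a x * b x) F"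
proof -
  have zero: "Ck_tendsto 0 S (\<lambda>i x. f i x * g i x) (\<lambda>x. a x * b x) F"
    if "Cinf_on S a" "Cinf_on S b" "Ck_tendsto 0 S f a F" "Ck_tendsto 0 S g b F" for f g a b
    using that by (auto intro!: uniform_lim_mult bounded_image_if_Cinf_on)
  show ?thesis
    using assms(2-)
  proof (induction k arbitrary: f g a b)
    case 0
    then show ?case by (intro zero)
  next
    case (Suc k)
    have "Ck_tendsto k S (\<lambda>i. partial_derivative e (\<lambda>x. f i x * g i x)) (partial_derivative e (\<lambda>x. a x * b x)) F"
      if e: "e \<in> Basis" for e
    proof (rule Ck_tendsto_cong[OF S partial_derivative_mult partial_derivative_mult, THEN iffD2])
      have fg: "Ck_tendsto k S f a F" "Ck_tendsto k S g b F" using Suc.prems by (auto dest: Ck_tendsto_SucD simp del: Ck_tendsto.simps)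
      have de: "Ck_tendsto k S (\<lambda>i. partial_derivative e (f i)) (partial_derivative e a) F"
        "Ck_tendsto k S (\<lambda>i. partial_derivative e (g i)) (partial_derivative e b) F" using Suc.prems e by auto
      show "Ck_tendsto k S (\<lambda>i x. f i x * partial_derivative e (g i) x + partial_derivative e (f i) x * g i x)
        (\<lambda>x. a x * partial_derivative e b x + partial_derivative e a x * b x) F"
        by (intro Ck_tendsto_add Suc.IH Cinf_on_mult Cinf_on_partial_derivative S Suc.prems(1-4) e fg de)
    qed (use Cinf_on_differentiable[where S = S] Suc.prems in auto)
    moreover have "Ck_tendsto 0 S (\<lambda>i x. f i x * g i x) (\<lambda>x. a x * b x) F"
      using Suc.prems by (intro zero) auto
    ultimately show ?case unfolding Ck_tendsto_Suc by blast
  qed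
qed

lemma Ck_tendsto_exp:
  assumes S: "open S" and f: "\<And>i. Cinf_on S (f i)" and g: "Cinf_on S g" and "Ck_tendsto k S f g F"
  shows "Ck_tendsto k S (\<lambda>i x. exp (f i x)) (\<lambda>x. exp (g x)) F"
  using assms(4)
proof (induction k)
  case 0
  then show ?case by (auto intro!: uniform_limit_exp bounded_image_if_Cinf_on[OF g])
next
  case (Suc k)
  have fg: "Ck_tendsto k S f g F" using Suc.prems by (rule Ck_tendsto_SucD)
  have "Ck_tendsto k S (\<lambda>i. partial_derivative e (\<lambda>x. exp (f i x))) (partial_derivative e (\<lambda>x. exp (g x))) F"
    if e: "e \<in> Basis" for e
  proof (rule Ck_tendsto_cong[OF S partial_derivative_chain[OF _ DERIV_exp] partial_derivative_chain[OF _ DERIV_exp], THEN iffD2])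
    have de: "Ck_tendsto k S (\<lambda>i. partial_derivative e (f i)) (partial_derivative e g) F" using Suc.prems e by auto
    show "Ck_tendsto k S (\<lambda>i x. exp (f i x) * partial_derivative e (f i) x) (\<lambda>x. exp (g x) * partial_derivative e g x) F"
      by (intro Ck_tendsto_mult Cinf_on_exp Cinf_on_partial_derivative S f g e Suc.IH fg de)
  qed (use Cinf_on_differentiable[where S = S] f g in auto)
  moreover have "Ck_tendsto 0 S (\<lambda>i x. exp (f i x)) (\<lambda>x. exp (g x)) F"
    using Suc.prems by (auto intro!: uniform_limit_exp bounded_image_if_Cinf_on[OF g])
  ultimately show ?case unfolding Ck_tendsto_Suc by blast
qed

text \<open>Here the limit is known to be smooth, so the gradient estimate applies to \<open>f i - g\<close> directly and the
  filter is arbitrary.\<close>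

lemma partial_derivative_tendsto_if_laplacian_tendsto:
  fixes f :: "'i \<Rightarrow> 'a::euclidean_space \<Rightarrow> real"
  assumes S: "open S" and f: "\<And>i. Cinf_on S (f i)" and g: "Cinf_on S g"
    and fg: "Ck_tendsto 0 S f g F"
    and lap: "Ck_tendsto 0 S (\<lambda>i. laplacian (f i)) (laplacian g) F"
    and b: "b \<in> Basis"
  shows "Ck_tendsto 0 S (\<lambda>i. partial_derivative b (f i)) (partial_derivative b g) F"
  unfolding Ck_tendsto.simps(1)
proof (intro allI impI, elim conjE, rule uniform_limit_compact_if_locally)
  fix x assume x: "x \<in> S"
  obtain r where r: "r > 0" "ball x (3 * r) \<subseteq> S" using S x by (rule ball_steps)
  have sub: "cball x (2 * r) \<subseteq> S" using r by (auto intro!: subsetD[OF r(2)])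
  have f2: "Ck_on 2 S (f i)" and g2: "Ck_on 2 S g" for i using f g by (auto simp: Cinf_on_def)
  have "uniform_limit (ball x r) (\<lambda>i. partial_derivative b (f i)) (partial_derivative b g) F"
  proof (rule uniform_limitI)
    fix e :: real assume e: "e > 0"
    define C where "C = 2 * real DIM('a) / r + r"
    have C: "C > 0" using r by (simp add: C_def add_pos_pos)
    define d where "d = e / (2 * C)"
    have d: "d > 0" "C * d < e" using e C by (auto simp: d_def)
    have "uniform_limit (cball x (2 * r)) f g F" "uniform_limit (cball x (2 * r)) (\<lambda>i. laplacian (f i)) (laplacian g) F"
      using fg lap sub by auto
    from uniform_limitD[OF this(1) d(1)] uniform_limitD[OF this(2) d(1)]
    show "\<forall>\<^sub>F i in F. \<forall>y\<in>ball x r. dist (partial_derivative b (f i) y) (partial_derivative b g y) < e"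
    proof eventually_elim
      case (elim i)
      show ?case
      proof
        fix y assume y: "y \<in> ball x r"
        have s: "z \<in> cball x (2 * r)" "z \<in> S" if "z \<in> ball y r" for z
        proof -
          show "z \<in> cball x (2 * r)" using y that dist_triangle[of x z y] by auto
          then show "z \<in> S" using sub by blast
        qed
        have yS: "y \<in> S" using s[of y] r by simp
        have "\<bar>partial_derivative b (\<lambda>z. f i z - g z) y\<bar> \<le> 2 * real DIM('a) * d / r + d * r"
        proof (rule gradient_estimate[OF r(1) _ b])
          show "Ck_on 2 (ball y r) (\<lambda>z. f i z - g z)"
            by (rule Ck_on_subset[OF Ck_on_diff[OF S f2 g2]]) (use s in auto)
          show "\<bar>f i z - g z\<bar> \<le> d" if "z \<in> ball y r" for z
            using elim(1) s[OF that] by (auto simp: dist_real_def less_imp_le)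
          show "\<bar>laplacian (\<lambda>z. f i z - g z) z\<bar> \<le> d" if "z \<in> ball y r" for z
            using elim(2) s[OF that] laplacian_diff[OF S f2 g2 s(2)[OF that]]
            by (auto simp: dist_real_def less_imp_le)
        qed (rule d)
        also have "\<dots> = C * d" by (simp add: C_def algebra_simps)
        also have "partial_derivative b (\<lambda>z. f i z - g z) y = partial_derivative b (f i) y - partial_derivative b g y"
          by (intro partial_derivative_diff Cinf_on_differentiable[OF _ yS] f g)
        finally show "dist (partial_derivative b (f i) y) (partial_derivative b g y) < e"
          using d by (simp add: dist_real_def)
      qed
    qed
  qed
  then show "\<exists>r>0. uniform_limit (ball x r) (\<lambda>i. partial_derivative b (f i)) (partial_derivative b g) F"
    using r by blast
qed

lemma Ck_tendsto_Suc_if_laplacian_tendsto: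
  fixes f :: "'i \<Rightarrow> 'a::euclidean_space \<Rightarrow> real"
  assumes S: "open S" and f: "\<And>i. Cinf_on S (f i)" and g: "Cinf_on S g"
    and fg: "Ck_tendsto 0 S f g F"
    and lap: "Ck_tendsto k S (\<lambda>i. laplacian (f i)) (laplacian g) F"
  shows "Ck_tendsto (Suc k) S f g F"
  using f g fg lap
proof (induction k arbitrary: f g)
  case 0
  then show ?case
    unfolding Ck_tendsto_Suc using partial_derivative_tendsto_if_laplacian_tendsto[OF S 0] by blast
next
  case (Suc k)
  have lap0: "Ck_tendsto 0 S (\<lambda>i. laplacian (f i)) (laplacian g) F" using Suc.prems(4) by simp
  have "Ck_tendsto (Suc k) S (\<lambda>i. partial_derivative b (f i)) (partial_derivative b g) F" if b: "b \<in> Basis" for b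
  proof (rule Suc.IH)
    show "Ck_tendsto 0 S (\<lambda>i. partial_derivative b (f i)) (partial_derivative b g) F"
      by (rule partial_derivative_tendsto_if_laplacian_tendsto[OF S Suc.prems(1-3) lap0 b])
    have "Ck_tendsto k S (\<lambda>i. partial_derivative b (laplacian (f i))) (partial_derivative b (laplacian g)) F"
      using Suc.prems(4) b by simp
    then show "Ck_tendsto k S (\<lambda>i. laplacian (partial_derivative b (f i))) (laplacian (partial_derivative b g)) F"
      by (rule Ck_tendsto_cong[OF S, THEN iffD2, rotated 2])
         (use Suc.prems b in \<open>auto intro!: laplacian_partial_derivative[OF S] simp: Cinf_on_def\<close>)
  qed (intro Cinf_on_partial_derivative b Suc.prems)+
  with Suc.prems(3) show ?case unfolding Ck_tendsto_Suc[of "Suc k"] by blast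
qed

text \<open>If \<open>f\<close> converges with \<open>k\<close> derivatives, then so does \<open>exp f\<close>, which is its Laplacian, and this yields
  convergence with one more derivative.\<close>

lemma Ck_tendsto_if_laplacian_eq_exp:
  fixes f :: "'i \<Rightarrow> 'a::euclidean_space \<Rightarrow> real"
  assumes S: "open S" and f: "\<And>i. Cinf_on S (f i)" and g: "Cinf_on S g"
    and lapf: "\<And>i x. x \<in> S \<Longrightarrow> laplacian (f i) x = exp (f i x)"
    and lapg: "\<And>x. x \<in> S \<Longrightarrow> laplacian g x = exp (g x)"
    and fg: "Ck_tendsto 0 S f g F"
  shows "Ck_tendsto k S f g F"
proof (induction k)
  case (Suc k)
  from Ck_tendsto_exp[OF S f g Suc]
  have "Ck_tendsto k S (\<lambda>i. laplacian (f i)) (laplacian g) F"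
    by (rule Ck_tendsto_cong[OF S, THEN iffD2, rotated 2]) (use lapf lapg in auto)
  then show ?case by (rule Ck_tendsto_Suc_if_laplacian_tendsto[OF S f g fg])
qed (rule fg)

lemma iterated_partial_append: "iterated_partial (bs @ [b]) f = iterated_partial bs (partial_derivative b f)"
  by (simp add: iterated_partial_def)

lemma uniform_limit_iterated_partial:
  assumes "Ck_tendsto (length bs) S f g F" "set bs \<subseteq> Basis" "compact K" "K \<subseteq> S"
  shows "uniform_limit K (\<lambda>i. iterated_partial bs (f i)) (iterated_partial bs g) F"
  using assms(1,2)
proof (induction bs arbitrary: f g rule: rev_induct)
  case Nil
  then show ?case using assms(3,4) by (simp add: iterated_partial_def)
next
  case (snoc b bs)
  then show ?case by (simp add: iterated_partial_append)
qed

lemma Cinf_on_iterated_partial: "Cinf_on S f \<Longrightarrow> set bs \<subseteq> Basis \<Longrightarrow> Cinf_on S (iterated_partial bs f)"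
  by (induction bs) (auto simp: iterated_partial_def Cinf_on_partial_derivative)

lemma iterated_partial_diff:
  assumes S: "open S" "x \<in> S" and f: "Cinf_on S f" and g: "Cinf_on S g" and bs: "set bs \<subseteq> Basis"
  shows "iterated_partial bs (\<lambda>x. f x - g x) x = iterated_partial bs f x - iterated_partial bs g x"
  using S(2) bs
proof (induction bs arbitrary: x)
  case Nil
  then show ?case by (simp add: iterated_partial_def)
next
  case (Cons b bs)
  have "partial_derivative b (iterated_partial bs (\<lambda>x. f x - g x)) x
      = partial_derivative b (\<lambda>x. iterated_partial bs f x - iterated_partial bs g x) x"
    by (rule partial_derivative_cong[OF S(1) Cons.prems(1) Cons.IH]) (use Cons.prems in auto)
  also have "\<dots> = partial_derivative b (iterated_partial bs f) x - partial_derivative b (iterated_partial bs g) x"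
    using Cons.prems f g
    by (intro partial_derivative_diff Cinf_on_differentiable[OF Cinf_on_iterated_partial]) auto
  finally show ?case by (simp add: iterated_partial_def)
qed

lemma iterated_partial_zero: "iterated_partial bs (\<lambda>x. 0) = (\<lambda>x. 0)"
  by (induction bs) (auto simp: iterated_partial_def)

lemma Cinf_on_diff: "open S \<Longrightarrow> Cinf_on S f \<Longrightarrow> Cinf_on S g \<Longrightarrow> Cinf_on S (\<lambda>x. f x - g x)"
  unfolding Cinf_on_def by (blast intro: Ck_on_diff)

lemma tendsto_Cinf_loc_diff:
  fixes f :: "'i \<Rightarrow> 'a::euclidean_space \<Rightarrow> real"
  assumes S: "open S" and f: "\<And>i. Cinf_on S (f i)" and g: "Cinf_on S g"
    and fg: "\<And>k. Ck_tendsto k S f g F"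
  shows "tendsto_Cinf_loc S (\<lambda>i x. f i x - g x) (\<lambda>x. 0) F"
  unfolding tendsto_Cinf_loc_def
proof (intro conjI allI impI)
  show "Cinf_on S (\<lambda>x. 0)" by (simp add: Cinf_on_def Ck_on_const)
  show "\<forall>\<^sub>F i in F. Cinf_on S (\<lambda>x. f i x - g x)" by (intro always_eventually allI Cinf_on_diff S f g)
  fix K :: "'a set" and bs :: "'a list" assume K: "compact K \<and> K \<subseteq> S \<and> set bs \<subseteq> Basis"
  then have "uniform_limit K (\<lambda>i. iterated_partial bs (f i)) (iterated_partial bs g) F"
    using uniform_limit_iterated_partial[OF fg] by blast
  from uniform_limit_minus[OF this uniform_limit_const]
  show "uniform_limit K (\<lambda>i. iterated_partial bs (\<lambda>x. f i x - g x)) (iterated_partial bs (\<lambda>x. 0)) F"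
    by (rule uniform_limit_cong'[THEN iffD1, rotated 2])
       (use K in \<open>auto simp: iterated_partial_diff[OF S _ f g] iterated_partial_zero subset_iff\<close>)
qed

section \<open>Exterior balls of smooth domains\<close>

text \<open>The second derivatives are bounded by some \<open>B\<close> on the compact ball, so the gradient is Lipschitz, and the
  function minus its linearisation at \<open>p\<close> has a gradient of size at most a multiple of \<open>|q - p|\<close> in the ball of
  radius \<open>2 |q - p|\<close> around \<open>p\<close>.\<close>

lemma quadratic_Taylor_bound:
  fixes f :: "'a::euclidean_space \<Rightarrow> real"
  assumes f: "Cinf_on UNIV f"
  obtains C where "C \<ge> 0" "\<And>p q. p \<in> ball z R \<Longrightarrow> q \<in> ball z R \<Longrightarrow>
     \<bar>f q - f p - (\<Sum>b\<in>Basis. ((q - p) \<bullet> b) * partial_derivative b f p)\<bar> \<le> C * (norm (q - p))\<^sup>2"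
proof -
  let ?P = "\<lambda>a b. partial_derivative a (partial_derivative b f)"
  define B where "B = (\<Sum>a\<in>(Basis :: 'a set). \<Sum>b\<in>(Basis :: 'a set). Sup ((\<lambda>x. \<bar>?P a b x\<bar>) ` cball z R))"
  have bdd: "bdd_above ((\<lambda>x. \<bar>?P a b x\<bar>) ` cball z R)" if "a \<in> Basis" "b \<in> Basis" for a b
  proof -
    have "Cinf_on UNIV (?P a b)" using f that by (intro Cinf_on_partial_derivative)
    then have "bounded (?P a b ` cball z R)" by (rule bounded_image_if_Cinf_on) auto
    then show ?thesis unfolding bounded_iff bdd_above_def by auto
  qed
  have Sup: "\<bar>?P a b x\<bar> \<le> Sup ((\<lambda>x. \<bar>?P a b x\<bar>) ` cball z R)"
    if "a \<in> Basis" "b \<in> Basis" "x \<in> cball z R" for a b x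
    using bdd that by (intro cSup_upper) auto
  have B: "\<bar>?P a b x\<bar> \<le> B" if ab: "a \<in> Basis" "b \<in> Basis" and x: "x \<in> ball z R" for a b x
  proof -
    have xc: "x \<in> cball z R" using x by auto
    have nonneg: "0 \<le> Sup ((\<lambda>x. \<bar>?P a b x\<bar>) ` cball z R)" if "a \<in> Basis" "b \<in> Basis" for a b
      using Sup[OF that xc] by linarith
    have "\<bar>?P a b x\<bar> \<le> Sup ((\<lambda>x. \<bar>?P a b x\<bar>) ` cball z R)" by (rule Sup[OF ab xc])
    also have "\<dots> \<le> (\<Sum>b\<in>(Basis :: 'a set). Sup ((\<lambda>x. \<bar>?P a b x\<bar>) ` cball z R))"
      using ab nonneg by (intro member_le_sum) auto
    also have "\<dots> \<le> B" unfolding B_def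
      by (rule member_le_sum[of a, where f = "\<lambda>a. \<Sum>b\<in>(Basis :: 'a set). Sup ((\<lambda>x. \<bar>?P a b x\<bar>) ` cball z R)"])
         (use ab nonneg in \<open>auto intro: sum_nonneg\<close>)
    finally show ?thesis .
  qed
  define n where "n = real DIM('a)"
  have lip: "\<bar>partial_derivative b f p - partial_derivative b f q\<bar> \<le> (n * B) * dist p q"
    if "p \<in> ball z R" "q \<in> ball z R" "b \<in> Basis" for p q b
    unfolding n_def
    by (rule Lipschitz_if_partial_derivatives_bounded[OF convex_ball open_ball _ B that(1,2)])
       (use that f in \<open>auto intro!: Cinf_on_differentiable[of UNIV] Cinf_on_partial_derivative\<close>)
  have main: "\<bar>f q - f p - (\<Sum>b\<in>Basis. ((q - p) \<bullet> b) * partial_derivative b f p)\<bar> \<le> \<bar>2 * n * n * B\<bar> * (norm (q - p))\<^sup>2"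
    if p: "p \<in> ball z R" and q: "q \<in> ball z R" for p q
  proof (cases "q = p")
    case True
    then show ?thesis by simp
  next
    case False
    define d where "d = dist p q"
    have d: "d > 0" using False by (simp add: d_def)
    define g where "g = (\<lambda>x. f x - (\<Sum>b\<in>Basis. partial_derivative b f p * ((x - p) \<bullet> b)))"
    have inner: "(\<lambda>x. partial_derivative b f p * ((x - p) \<bullet> b)) differentiable (at x)" for b x
      by (intro differentiable_mult differentiable_const differentiable_inner differentiable_diff differentiable_ident)
    have fd: "f differentiable (at x)" for x by (rule Cinf_on_differentiable[OF f]) simp
    have sumd: "(\<lambda>x. \<Sum>b\<in>Basis. partial_derivative b f p * ((x - p) \<bullet> b)) differentiable (at x)" for x
      by (intro differentiable_sum inner ballI) simp
    have gd: "g differentiable (at x)" for x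
      unfolding g_def by (intro differentiable_diff fd sumd)
    have gp: "partial_derivative c g x = partial_derivative c f x - partial_derivative c f p" if c: "c \<in> Basis" for c x
    proof -
      have "partial_derivative c (\<lambda>x. partial_derivative b f p * ((x - p) \<bullet> b)) x = partial_derivative b f p * (c \<bullet> b)" for b
        by (subst partial_derivative_cmult)
           (auto intro!: differentiable_inner differentiable_diff simp: partial_derivative_inner)
      then have "partial_derivative c g x = partial_derivative c f x - (\<Sum>b\<in>Basis. partial_derivative b f p * (c \<bullet> b))"
        unfolding g_def by (simp add: partial_derivative_diff[OF fd sumd] partial_derivative_sum[OF finite_Basis inner])
      also have "(\<Sum>b\<in>Basis. partial_derivative b f p * (c \<bullet> b)) = (\<Sum>b\<in>Basis. if b = c then partial_derivative b f p else 0)"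
        using c by (intro sum.cong) (auto simp: inner_Basis)
      finally show ?thesis using c by simp
    qed
    define S where "S = ball z R \<inter> ball p (2 * d)"
    have "\<bar>g q - g p\<bar> \<le> (real DIM('a) * (\<bar>n * B\<bar> * (2 * d))) * dist q p"
    proof (rule Lipschitz_if_partial_derivatives_bounded[of S])
      show "\<bar>partial_derivative b g x\<bar> \<le> \<bar>n * B\<bar> * (2 * d)" if "b \<in> Basis" "x \<in> S" for b x
      proof -
        have "\<bar>partial_derivative b g x\<bar> \<le> (n * B) * dist x p"
          using lip[of x p b] that p by (simp add: gp S_def)
        also have "\<dots> \<le> \<bar>n * B\<bar> * (2 * d)"
          using that(2) by (intro mult_mono) (auto simp: S_def dist_commute)
        finally show ?thesis .
      qed
    qed (use p q d gd in \<open>auto simp: S_def d_def intro: convex_Int\<close>)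
    also have "\<dots> = \<bar>2 * n * n * B\<bar> * (norm (q - p))\<^sup>2"
      by (simp add: n_def d_def dist_norm norm_minus_commute power2_eq_square abs_mult)
    finally show ?thesis by (simp add: g_def mult.commute algebra_simps)
  qed
  show ?thesis by (rule that[OF _ main]) auto
qed

text \<open>Near \<open>z\<close> the domain is the part above the graph of \<open>\<gamma>\<close>, and \<open>\<gamma>\<close> lies above its tangent planes up to a quadratic
  error with a common constant \<open>C\<close>. A ball touching the graph from below whose curvature \<open>1/\<rho>\<close> exceeds \<open>2 C\<close>
  therefore stays below the graph. The linear map \<open>P\<close> is the orthogonal projection to the hyperplane \<open>\<nu>\<^sup>\<bottom>\<close> on which
  \<open>\<gamma>\<close> is evaluated.\<close>

lemma uniform_exterior_ball_near:
  fixes \<Omega> :: "'a::euclidean_space set"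
  assumes \<Omega>: "open \<Omega>" and r: "r > 0" and \<nu>: "norm \<nu> = 1" and \<gamma>: "Cinf_on UNIV \<gamma>"
    and graph: "\<Omega> \<inter> ball z r = {x \<in> ball z r. x \<bullet> \<nu> > \<gamma> (x - (x \<bullet> \<nu>) *\<^sub>R \<nu>)}"
  obtains R where "R > 0"
    "\<And>\<rho> x. 0 < \<rho> \<Longrightarrow> \<rho> \<le> R \<Longrightarrow> x \<in> frontier \<Omega> \<Longrightarrow> x \<in> ball z (r/2) \<Longrightarrow> \<exists>y. dist y x = \<rho> \<and> ball y \<rho> \<inter> \<Omega> = {}"
proof -
  define P where "P = (\<lambda>x::'a. x - (x \<bullet> \<nu>) *\<^sub>R \<nu>)"
  have \<nu>1: "\<nu> \<bullet> \<nu> = 1" using \<nu> by (simp add: norm_eq_1)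
  have Pdiff: "P x - P y = P (x - y)" for x y by (simp add: P_def inner_diff_left algebra_simps)
  have P\<nu>: "P x \<bullet> \<nu> = 0" for x by (simp add: P_def inner_diff_left \<nu>1)
  have Psym: "P x \<bullet> y = x \<bullet> P y" for x y
    by (simp add: P_def inner_diff_left inner_diff_right inner_commute algebra_simps)
  have Pnorm: "norm (P x) \<le> norm x" for x
  proof -
    have "(norm (P x))\<^sup>2 = (norm x)\<^sup>2 - (x \<bullet> \<nu>)\<^sup>2"
      unfolding power2_norm_eq_inner
      by (simp add: P_def inner_diff_left inner_diff_right \<nu>1 inner_commute power2_eq_square)
    then have "(norm (P x))\<^sup>2 \<le> (norm x)\<^sup>2" by simp
    then show ?thesis by (rule power2_le_imp_le) simp
  qed
  obtain C where C: "C \<ge> 0" "\<And>p q. p \<in> ball (P z) r \<Longrightarrow> q \<in> ball (P z) r \<Longrightarrow>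
     \<bar>\<gamma> q - \<gamma> p - (\<Sum>b\<in>Basis. ((q - p) \<bullet> b) * partial_derivative b \<gamma> p)\<bar> \<le> C * (norm (q - p))\<^sup>2"
    using quadratic_Taylor_bound[OF \<gamma>] by blast
  have Pball: "P x \<in> ball (P z) r" if "x \<in> ball z r" for x
    using that Pnorm[of "z - x"] by (simp add: dist_norm Pdiff)
  have D: "continuous_on UNIV (\<lambda>x. x \<bullet> \<nu> - \<gamma> (P x))"
  proof -
    have "continuous_on UNIV \<gamma>" using \<gamma> by (metis Cinf_on_def Ck_on.simps(1))
    then have "continuous_on UNIV (\<lambda>x. \<gamma> (P x))"
      by (rule continuous_on_compose2) (auto simp: P_def intro!: continuous_intros)
    then show ?thesis by (intro continuous_intros)
  qed
  have on_graph: "x \<bullet> \<nu> = \<gamma> (P x)" if x: "x \<in> frontier \<Omega>" "x \<in> ball z r" for x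
  proof (rule ccontr)
    assume "x \<bullet> \<nu> \<noteq> \<gamma> (P x)"
    then consider "x \<bullet> \<nu> > \<gamma> (P x)" | "x \<bullet> \<nu> < \<gamma> (P x)" by linarith
    then show False
    proof cases
      case 1
      then have "x \<in> \<Omega>" using graph x(2) by (auto simp: P_def)
      then show False using x(1) \<Omega> by (simp add: frontier_def interior_open)
    next
      case 2
      define U where "U = ball z r \<inter> {x. x \<bullet> \<nu> - \<gamma> (P x) < 0}"
      have "open U" unfolding U_def
        by (intro open_Int open_ball open_Collect_less D continuous_on_const)
      moreover have "U \<inter> \<Omega> = {}"
      proof -
        have False if "y \<in> U" "y \<in> \<Omega>" for y
        proof -
          have "y \<in> \<Omega> \<inter> ball z r" using that by (simp add: U_def)
          then have "y \<bullet> \<nu> > \<gamma> (P y)" unfolding graph P_def by blast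
          then show False using that by (simp add: U_def)
        qed
        then show ?thesis by blast
      qed
      ultimately have "U \<inter> closure \<Omega> = {}" by (simp add: open_Int_closure_eq_empty)
      moreover have "x \<in> U" using 2 x(2) by (simp add: U_def)
      moreover have "x \<in> closure \<Omega>" using x(1) by (simp add: frontier_def)
      ultimately show False by blast
    qed
  qed
  \<comment> \<open>\<open>r / 4\<close> keeps the exterior balls inside \<open>ball z r\<close>, and the second bound gives \<open>2 \<rho> C \<le> 1\<close>.\<close>
  define R where "R = min (r / 4) (1 / (2 * (C + 1)))"
  have R: "R > 0" using r C by (simp add: R_def)
  have ext: "\<exists>y. dist y x = \<rho> \<and> ball y \<rho> \<inter> \<Omega> = {}"
    if \<rho>: "0 < \<rho>" "\<rho> \<le> R" and x: "x \<in> frontier \<Omega>" "x \<in> ball z (r/2)" for \<rho> x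
  proof -
    have xr: "x \<in> ball z r" using x(2) r by auto
    define G where "G = (\<Sum>b\<in>Basis. partial_derivative b \<gamma> (P x) *\<^sub>R b)"
    \<comment> \<open>This vector is normal to the graph at \<open>x\<close> and points downwards, out of the domain.\<close>
    define N where "N = P G - \<nu>"
    have "N \<bullet> N = P G \<bullet> P G + 1"
      using P\<nu>[of G] \<nu>1 inner_commute[of \<nu> "P G"]
      by (simp add: N_def inner_diff_left inner_diff_right)
    then have "(norm N)\<^sup>2 \<ge> 1\<^sup>2" by (simp add: power2_norm_eq_inner)
    then have N1: "norm N \<ge> 1" by (rule power2_le_imp_le) simp
    define n where "n = N /\<^sub>R norm N"
    have "norm N \<noteq> 0" using N1 by linarith
    then have n: "norm n = 1" and hN: "h \<bullet> N = norm N * (h \<bullet> n)" for h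
      by (simp_all add: n_def)
    have "ball (x + \<rho> *\<^sub>R n) \<rho> \<inter> \<Omega> = {}"
    proof (rule ccontr)
      assume "ball (x + \<rho> *\<^sub>R n) \<rho> \<inter> \<Omega> \<noteq> {}"
      then obtain y where y: "y \<in> \<Omega>" "dist (x + \<rho> *\<^sub>R n) y < \<rho>" by auto
      define h where "h = y - x"
      have "norm (h - \<rho> *\<^sub>R n) < \<rho>"
        using y(2) by (simp add: h_def dist_norm norm_minus_commute algebra_simps)
      then have "(norm (h - \<rho> *\<^sub>R n))\<^sup>2 < \<rho>\<^sup>2" by (simp add: power_strict_mono)
      also have "(norm (h - \<rho> *\<^sub>R n))\<^sup>2 = (norm h)\<^sup>2 - 2 * \<rho> * (h \<bullet> n) + \<rho>\<^sup>2"
        using n unfolding power2_norm_eq_inner norm_eq_1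
        by (simp add: inner_diff_left inner_diff_right inner_commute power2_eq_square)
      finally have hn: "(norm h)\<^sup>2 < 2 * \<rho> * (h \<bullet> n)" by simp
      have "norm h < 2 * \<rho>"
      proof -
        have "dist x y \<le> dist x (x + \<rho> *\<^sub>R n) + dist (x + \<rho> *\<^sub>R n) y" by (rule dist_triangle)
        also have "dist x (x + \<rho> *\<^sub>R n) = \<rho>" using n \<rho> by (simp add: dist_norm)
        finally show ?thesis using y(2) by (simp add: h_def dist_norm norm_minus_commute)
      qed
      then have "dist x y < r / 2" using \<rho> by (simp add: h_def dist_norm norm_minus_commute R_def)
      then have yr: "y \<in> ball z r" using x(2) dist_triangle[of z y x] by simp
      with y(1) have "y \<in> \<Omega> \<inter> ball z r" by blast
      then have "y \<bullet> \<nu> > \<gamma> (P y)" unfolding graph P_def by blast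
      moreover have "\<gamma> (P y) \<ge> \<gamma> (P x) + h \<bullet> P G - C * (norm h)\<^sup>2"
      proof -
        have "(\<Sum>b\<in>Basis. ((P y - P x) \<bullet> b) * partial_derivative b \<gamma> (P x)) = (P y - P x) \<bullet> G"
          by (simp add: G_def inner_sum_right mult.commute)
        also have "\<dots> = h \<bullet> P G" by (simp add: Pdiff h_def Psym)
        finally have "\<bar>\<gamma> (P y) - \<gamma> (P x) - h \<bullet> P G\<bar> \<le> C * (norm (P h))\<^sup>2"
          using C(2)[OF Pball[OF xr] Pball[OF yr]] by (simp add: Pdiff h_def)
        also have "\<dots> \<le> C * (norm h)\<^sup>2"
          using C(1) Pnorm[of h] by (intro mult_left_mono power_mono) auto
        finally show ?thesis by linarith
      qed
      moreover have "x \<bullet> \<nu> = \<gamma> (P x)" by (rule on_graph[OF x(1) xr])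
      ultimately have "h \<bullet> N < C * (norm h)\<^sup>2"
        by (simp add: N_def h_def inner_diff_left inner_diff_right)
      moreover have "h \<bullet> n > 0" using hn \<rho> by (smt (verit) zero_le_power2 mult_nonneg_nonpos)
      then have "h \<bullet> n \<le> h \<bullet> N" using N1 by (simp add: hN)
      ultimately have "h \<bullet> n < C * (norm h)\<^sup>2" by linarith
      then have "2 * \<rho> * (h \<bullet> n) \<le> (2 * \<rho> * C) * (norm h)\<^sup>2"
        using \<rho> by (simp add: mult_left_mono)
      also have "\<dots> \<le> 1 * (norm h)\<^sup>2"
      proof (rule mult_right_mono)
        have "\<rho> \<le> 1 / (2 * (C + 1))" using \<rho> by (simp add: R_def)
        then have "2 * \<rho> * (C + 1) \<le> 1" using C(1) by (simp add: field_simps)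
        then show "2 * \<rho> * C \<le> 1" using \<rho> by (simp add: algebra_simps)
      qed simp
      finally show False using hn by simp
    qed
    moreover have "dist (x + \<rho> *\<^sub>R n) x = \<rho>" using n \<rho> by (simp add: dist_norm)
    ultimately show ?thesis by blast
  qed
  show ?thesis by (rule that[OF R ext])
qed

lemma uniform_exterior_ball:
  fixes \<Omega> :: "'a::euclidean_space set"
  assumes \<Omega>: "smooth_bounded_domain \<Omega>"
  obtains \<rho> where "\<rho> > 0" "\<And>z. z \<in> frontier \<Omega> \<Longrightarrow> \<exists>y. dist y z = \<rho> \<and> ball y \<rho> \<inter> \<Omega> = {}"
proof -
  have op: "open \<Omega>" and bd: "bounded \<Omega>" using \<Omega> by (auto simp: smooth_bounded_domain_def)
  have "\<exists>r R. r > 0 \<and> R > 0 \<and> (\<forall>\<rho> x. 0 < \<rho> \<longrightarrow> \<rho> \<le> R \<longrightarrow> x \<in> frontier \<Omega> \<longrightarrow> x \<in> ball z r \<longrightarrow>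
      (\<exists>y. dist y x = \<rho> \<and> ball y \<rho> \<inter> \<Omega> = {}))" if z: "z \<in> frontier \<Omega>" for z
  proof -
    obtain r \<nu> \<gamma> where "r > 0" "norm \<nu> = 1" "Cinf_on UNIV \<gamma>"
      "\<Omega> \<inter> ball z r = {x \<in> ball z r. x \<bullet> \<nu> > \<gamma> (x - (x \<bullet> \<nu>) *\<^sub>R \<nu>)}"
      using \<Omega> z unfolding smooth_bounded_domain_def by blast
    from uniform_exterior_ball_near[OF op this] \<open>r > 0\<close> show ?thesis
      by (metis half_gt_zero)
  qed
  then obtain r R where r: "\<And>z. z \<in> frontier \<Omega> \<Longrightarrow> r z > 0" "\<And>z. z \<in> frontier \<Omega> \<Longrightarrow> R z > 0"
    and ext: "\<And>z \<rho> x. z \<in> frontier \<Omega> \<Longrightarrow> 0 < \<rho> \<Longrightarrow> \<rho> \<le> R z \<Longrightarrow> x \<in> frontier \<Omega> \<Longrightarrow> x \<in> ball z (r z) \<Longrightarrow>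
      \<exists>y. dist y x = \<rho> \<and> ball y \<rho> \<inter> \<Omega> = {}"
    by metis
  have "compact (frontier \<Omega>)" by (rule compact_frontier_bounded[OF bd])
  then obtain D where D: "D \<subseteq> frontier \<Omega>" "finite D" "frontier \<Omega> \<subseteq> (\<Union>z\<in>D. ball z (r z))"
  proof (rule compactE_image[of _ "frontier \<Omega>" "\<lambda>z. ball z (r z)"])
    show "frontier \<Omega> \<subseteq> (\<Union>z\<in>frontier \<Omega>. ball z (r z))"
    proof
      fix z assume "z \<in> frontier \<Omega>"
      with r(1) have "z \<in> ball z (r z)" by simp
      with \<open>z \<in> frontier \<Omega>\<close> show "z \<in> (\<Union>z\<in>frontier \<Omega>. ball z (r z))" by blast
    qed
  qed simp
  define \<rho> where "\<rho> = Min (insert 1 (R ` D))"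
  have \<rho>: "\<rho> > 0" unfolding \<rho>_def using D r(2) by (subst Min_gr_iff) auto
  have "\<exists>y. dist y x = \<rho> \<and> ball y \<rho> \<inter> \<Omega> = {}" if x: "x \<in> frontier \<Omega>" for x
  proof -
    obtain z where z: "z \<in> D" "x \<in> ball z (r z)" using D(3) x by blast
    have "\<rho> \<le> R z" unfolding \<rho>_def using D(2) z(1) by (intro Min_le) auto
    then show ?thesis using ext[of z \<rho> x] z D(1) \<rho> x by blast
  qed
  with \<rho> show ?thesis by (rule that)
qed

section \<open>Lower bound near the boundary\<close>

text \<open>With \<open>t = |x - y|\<^sup>2\<close>, Hopf's function \<open>h = exp (-\<beta>\<rho>\<^sup>2) - exp (-\<beta>t)\<close> vanishes on the
  sphere of radius \<open>\<rho>\<close> around \<open>y\<close> and is superharmonic outside it if \<open>2 \<beta> \<rho>\<^sup>2 = n\<close>. Hence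
  \<open>\<Delta>(-2 ln (\<delta> + h)) \<ge> 2 |\<nabla>h|\<^sup>2 / (\<delta> + h)\<^sup>2\<close>, and adding \<open>ln k\<close> with \<open>k \<le> 2 |\<nabla>h|\<^sup>2\<close> gives a
  subsolution. The shift \<open>\<delta>\<close> makes it bounded, so that it is below \<open>v\<close> at the boundary.\<close>

lemma exterior_ball_barrier:
  fixes \<Omega> :: "'a::euclidean_space set"
  assumes \<Omega>: "open \<Omega>" "bounded \<Omega>" and v: "boundary_blowup_solution \<Omega> v"
    and \<rho>: "\<rho> > 0" and ext: "\<And>x. x \<in> \<Omega> \<Longrightarrow> \<rho>\<^sup>2 \<le> (x - y) \<bullet> (x - y)"
    and T: "\<And>x. x \<in> \<Omega> \<Longrightarrow> (x - y) \<bullet> (x - y) \<le> T" and \<delta>: "\<delta> > 0"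
    and \<beta>: "\<beta> = real DIM('a) / (2 * \<rho>\<^sup>2)" and k: "k = 8 * \<rho>\<^sup>2 * \<beta>\<^sup>2 * (exp (- \<beta> * T))\<^sup>2"
    and x: "x \<in> \<Omega>"
  shows "ln k - 2 * ln (\<delta> + exp (- \<beta> * \<rho>\<^sup>2) - exp (- \<beta> * ((x - y) \<bullet> (x - y)))) \<le> v x"
proof -
  have v2: "Ck_on 2 \<Omega> v" and lapv: "\<And>x. x \<in> \<Omega> \<Longrightarrow> laplacian v x = exp (v x)"
    and blow: "\<And>z. z \<in> frontier \<Omega> \<Longrightarrow> filterlim v at_top (at z within \<Omega>)"
    using v by (auto simp: boundary_blowup_solution_def)
  define n where "n = real DIM('a)"
  have n: "n > 0" by (simp add: n_def)
  have \<beta>0: "\<beta> > 0" using \<beta> \<rho> by simp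
  have k0: "k > 0" using \<beta>0 \<rho> by (simp add: k)
  define t where "t = (\<lambda>x. (x - y) \<bullet> (x - y))"
  define H where "H = (\<lambda>s. \<delta> + exp (- \<beta> * \<rho>\<^sup>2) - exp (- \<beta> * s))"
  define E where "E = (\<lambda>s. exp (- \<beta> * s))"
  define \<phi> where "\<phi> = (\<lambda>s. ln k - 2 * ln (H s))"
  have H: "H s \<ge> \<delta>" if "s \<ge> \<rho>\<^sup>2" for s
    using that \<beta>0 by (simp add: H_def)
  have H0: "H s > 0" if "s \<ge> \<rho>\<^sup>2" for s using H[OF that] \<delta> by linarith
  have E0: "E s > 0" for s by (simp add: E_def)
  have dE: "(E has_real_derivative (- \<beta> * E s)) (at s)" for s
    unfolding E_def by (auto intro!: derivative_eq_intros)
  have dH: "(H has_real_derivative (\<beta> * E s)) (at s)" for s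
    unfolding H_def E_def by (auto intro!: derivative_eq_intros)
  have t2: "Ck_on 2 S t" for S unfolding t_def by (rule Ck_on_norm_square)
  have tS: "t x \<in> {\<rho>\<^sup>2..}" if "x \<in> \<Omega>" for x using ext[OF that] by (simp add: t_def)
  have d1: "(\<phi> has_real_derivative (- 2 * \<beta> * E s / H s)) (at s)" if "s \<in> {\<rho>\<^sup>2..}" for s
    unfolding \<phi>_def using H0[of s] that by (auto intro!: derivative_eq_intros dH)
  have d2: "((\<lambda>s. - 2 * \<beta> * E s / H s) has_real_derivative
      (2 * \<beta>\<^sup>2 * E s / H s + 2 * \<beta>\<^sup>2 * (E s)\<^sup>2 / (H s)\<^sup>2)) (at s)" if "s \<in> {\<rho>\<^sup>2..}" for s
    using H0[of s] that
    by (auto intro!: derivative_eq_intros dE dH simp: field_simps power2_eq_square)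
  have c: "continuous_on {\<rho>\<^sup>2..} (\<lambda>s. 2 * \<beta>\<^sup>2 * E s / H s + 2 * \<beta>\<^sup>2 * (E s)\<^sup>2 / (H s)\<^sup>2)"
  proof -
    have "continuous_on {\<rho>\<^sup>2..} E" "continuous_on {\<rho>\<^sup>2..} H"
      unfolding E_def H_def by (intro continuous_intros)+
    moreover have "H s \<noteq> 0" if "s \<in> {\<rho>\<^sup>2..}" for s using H0[of s] that by simp
    ultimately show ?thesis by (intro continuous_intros) auto
  qed
  have "\<phi> (t x) \<le> v x"
  proof (rule comparison_principle[OF \<Omega> _ v2 _ _ _ x, of "\<lambda>x. \<phi> (t x)"])
    show "Ck_on 2 \<Omega> (\<lambda>x. \<phi> (t x))"
      by (rule Ck_on_2_chain[OF \<Omega>(1) t2 tS d1 d2 c])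
    show "exp (\<phi> (t x)) \<le> laplacian (\<lambda>x. \<phi> (t x)) x" if x: "x \<in> \<Omega>" for x
    proof -
      define s where "s = t x"
      have s: "\<rho>\<^sup>2 \<le> s" "s \<le> T" using tS[OF x] T[OF x] by (auto simp: s_def t_def)
      have Hs: "H s > 0" by (rule H0[OF s(1)])
      have "laplacian (\<lambda>x. \<phi> (t x)) x = - 2 * \<beta> * E (t x) / H (t x) * laplacian t x
          + (2 * \<beta>\<^sup>2 * E (t x) / H (t x) + 2 * \<beta>\<^sup>2 * (E (t x))\<^sup>2 / (H (t x))\<^sup>2) *
            (\<Sum>b\<in>Basis. (partial_derivative b t x)\<^sup>2)"
        by (rule laplacian_chain[OF \<Omega>(1) t2 tS d1 d2 c x])
      also have "laplacian t x = 2 * n" by (simp add: t_def laplacian_norm_square n_def)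
      also have "(\<Sum>b\<in>Basis. (partial_derivative b t x)\<^sup>2) = 4 * t x"
        by (simp add: t_def sum_partial_norm_square)
      finally have lap0: "laplacian (\<lambda>x. \<phi> (t x)) x = - 2 * \<beta> * E (t x) / H (t x) * (2 * n)
          + (2 * \<beta>\<^sup>2 * E (t x) / H (t x) + 2 * \<beta>\<^sup>2 * (E (t x))\<^sup>2 / (H (t x))\<^sup>2) * (4 * t x)" .
      have lap: "laplacian (\<lambda>x. \<phi> (t x)) x =
          (E s / H s) * (8 * \<beta>\<^sup>2 * s - 4 * n * \<beta>) + 8 * s * \<beta>\<^sup>2 * (E s)\<^sup>2 / (H s)\<^sup>2"
      proof -
        have "- 2 * \<beta> * E s / H s * (2 * n)
            + (2 * \<beta>\<^sup>2 * E s / H s + 2 * \<beta>\<^sup>2 * (E s)\<^sup>2 / (H s)\<^sup>2) * (4 * s)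
          = (E s / H s) * (8 * \<beta>\<^sup>2 * s - 4 * n * \<beta>) + 8 * s * \<beta>\<^sup>2 * (E s)\<^sup>2 / (H s)\<^sup>2"
          using Hs by (simp add: field_simps power2_eq_square)
        with lap0 show ?thesis unfolding s_def[symmetric] by simp
      qed
      have "4 * n * \<beta> = 8 * \<beta>\<^sup>2 * \<rho>\<^sup>2"
        using \<rho> by (simp add: \<beta> n_def power2_eq_square field_simps)
      also have "\<dots> \<le> 8 * \<beta>\<^sup>2 * s" using s by (intro mult_left_mono) auto
      finally have "0 \<le> (E s / H s) * (8 * \<beta>\<^sup>2 * s - 4 * n * \<beta>)"
        using E0[of s] Hs by (intro mult_nonneg_nonneg) auto
      moreover have "k / (H s)\<^sup>2 \<le> 8 * s * \<beta>\<^sup>2 * (E s)\<^sup>2 / (H s)\<^sup>2"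
      proof (rule divide_right_mono)
        have "exp (- \<beta> * T) \<le> E s" using s \<beta>0 by (simp add: E_def)
        moreover have "s \<ge> 0" using s(1) zero_le_power2[of \<rho>] by linarith
        ultimately show "k \<le> 8 * s * \<beta>\<^sup>2 * (E s)\<^sup>2"
          unfolding k using s(1) \<beta>0 by (intro mult_mono power_mono) auto
      qed simp
      moreover have "exp (\<phi> s) = k / (H s)\<^sup>2"
        using Hs k0 exp_of_nat_mult[of 2 "ln (H s)"] by (simp add: \<phi>_def exp_diff)
      ultimately show ?thesis by (simp add: lap s_def[symmetric])
    qed
    show "laplacian v x \<le> exp (v x)" if "x \<in> \<Omega>" for x using lapv[OF that] by simp
    fix z e assume z: "z \<in> frontier \<Omega>" and e: "(e::real) > 0"
    have "eventually (\<lambda>x. ln k - 2 * ln \<delta> \<le> v x) (at z within \<Omega>)"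
      using blow[OF z] by (simp add: filterlim_at_top)
    moreover have "eventually (\<lambda>x. x \<in> \<Omega>) (at z within \<Omega>)" by (simp add: eventually_at_filter)
    ultimately show "eventually (\<lambda>x. \<phi> (t x) \<le> v x + e) (at z within \<Omega>)"
    proof eventually_elim
      case (elim x)
      have "ln \<delta> \<le> ln (H (t x))" using H[of "t x"] H0[of "t x"] tS[OF elim(2)] \<delta> by simp
      then show ?case using elim e by (simp add: \<phi>_def)
    qed
  qed
  then show ?thesis by (simp add: \<phi>_def H_def t_def)
qed

text \<open>At distance \<open>d\<close> from the point \<open>z\<close> where the exterior ball touches, the function \<open>h\<close> of the barrier is at most
  \<open>A d\<close>. The barrier with \<open>\<delta> = A d\<close> is evaluated at this very point \<open>x\<close>, so no limit \<open>\<delta> \<rightarrow> 0\<close> is taken.\<close>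

lemma boundary_blowup_solution_lower_bound:
  fixes \<Omega> :: "'a::euclidean_space set"
  assumes \<Omega>: "smooth_bounded_domain \<Omega>" and v: "boundary_blowup_solution \<Omega> v"
  shows "\<exists>C. \<forall>x\<in>\<Omega>. \<forall>z\<in>frontier \<Omega>. - 2 * ln (dist x z) - C \<le> v x"
proof -
  have op: "open \<Omega>" and bd: "bounded \<Omega>" using \<Omega> by (auto simp: smooth_bounded_domain_def)
  obtain \<rho> where \<rho>: "\<rho> > 0" and ext: "\<And>z. z \<in> frontier \<Omega> \<Longrightarrow> \<exists>y. dist y z = \<rho> \<and> ball y \<rho> \<inter> \<Omega> = {}"
    using uniform_exterior_ball[OF \<Omega>] by blast
  define D where "D = diameter (closure \<Omega>)"
  have D: "dist x z \<le> D" if "x \<in> \<Omega>" "z \<in> frontier \<Omega>" for x z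
    unfolding D_def using that closure_subset bd
    by (intro diameter_bounded_bound) (auto simp: frontier_def)
  define \<beta> where "\<beta> = real DIM('a) / (2 * \<rho>\<^sup>2)"
  define T where "T = (D + \<rho>)\<^sup>2"
  define k where "k = 8 * \<rho>\<^sup>2 * \<beta>\<^sup>2 * (exp (- \<beta> * T))\<^sup>2"
  define A where "A = \<beta> * (D + 2 * \<rho>)"
  have \<beta>0: "\<beta> > 0" using \<rho> by (simp add: \<beta>_def)
  have "- 2 * ln (dist x z) - (2 * ln (2 * A) - ln k) \<le> v x"
    if x: "x \<in> \<Omega>" and z: "z \<in> frontier \<Omega>" for x z
  proof -
    obtain y where y: "dist y z = \<rho>" "ball y \<rho> \<inter> \<Omega> = {}" using ext[OF z] by blast
    define d where "d = dist x z"
    have "x \<noteq> z" using x z op by (auto simp: frontier_def interior_open)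
    then have d: "d > 0" "d \<le> D" using D[OF x z] by (auto simp: d_def)
    have D0: "D > 0" using d by simp
    have A0: "A > 0" using \<beta>0 \<rho> D0 by (simp add: A_def)
    have sq: "(w - y) \<bullet> (w - y) = (dist w y)\<^sup>2" for w by (simp add: dist_norm power2_norm_eq_inner)
    have lo: "\<rho>\<^sup>2 \<le> (w - y) \<bullet> (w - y)" if "w \<in> \<Omega>" for w
    proof -
      have "w \<notin> ball y \<rho>" using y that by blast
      then have "\<rho> \<le> dist w y" by (simp add: dist_commute)
      then show ?thesis unfolding sq using \<rho> by (intro power_mono) auto
    qed
    have hi: "(w - y) \<bullet> (w - y) \<le> T" if "w \<in> \<Omega>" for w
    proof -
      have "dist w y \<le> D + \<rho>" using dist_triangle[of w y z] D[OF that z] y by (simp add: dist_commute)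
      then show ?thesis unfolding sq T_def by (intro power_mono) auto
    qed
    define h where "h = exp (- \<beta> * \<rho>\<^sup>2) - exp (- \<beta> * ((x - y) \<bullet> (x - y)))"
    have bar: "ln k - 2 * ln (A * d + exp (- \<beta> * \<rho>\<^sup>2) - exp (- \<beta> * ((x - y) \<bullet> (x - y)))) \<le> v x"
      using A0 d by (intro exterior_ball_barrier[OF op bd v \<rho> lo hi _ \<beta>_def k_def x]) auto
    define s where "s = \<beta> * ((x - y) \<bullet> (x - y) - \<rho>\<^sup>2)"
    have s0: "s \<ge> 0" using lo[OF x] \<beta>0 by (simp add: s_def)
    have "h = exp (- \<beta> * \<rho>\<^sup>2) * (1 - exp (- s))"
      by (simp add: h_def s_def algebra_simps flip: exp_add)
    also have "\<dots> \<le> 1 * s"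
      using exp_ge_add_one_self[of "- s"] \<beta>0 s0 by (intro mult_mono) auto
    also have "\<dots> \<le> \<beta> * (d * (D + 2 * \<rho>))"
    proof -
      have "dist x y \<le> d + \<rho>" using dist_triangle[of x y z] y by (simp add: d_def dist_commute)
      then have "(dist x y)\<^sup>2 \<le> (d + \<rho>)\<^sup>2" by (intro power_mono) auto
      then have "(x - y) \<bullet> (x - y) - \<rho>\<^sup>2 \<le> d * (d + 2 * \<rho>)"
        unfolding sq by (simp add: power2_eq_square algebra_simps)
      also have "\<dots> \<le> d * (D + 2 * \<rho>)" using d by (intro mult_left_mono) auto
      finally show ?thesis using \<beta>0 by (simp add: s_def)
    qed
    finally have hA: "h \<le> A * d" by (simp add: A_def algebra_simps)
    have h0: "h \<ge> 0" using lo[OF x] \<beta>0 by (simp add: h_def)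
    have "ln (A * d + h) \<le> ln (2 * A * d)" using hA h0 A0 d by (subst ln_le_cancel_iff) (auto intro: add_pos_nonneg)
    also have "\<dots> = ln (2 * A) + ln d" using A0 d by (simp add: ln_mult)
    finally show ?thesis using bar by (simp add: h_def d_def algebra_simps)
  qed
  then show ?thesis by blast
qed

section \<open>Uniqueness of the boundary blow-up solution\<close>

text \<open>With \<open>d\<close> the distance to the frontier, \<open>w \<le> -2 ln d + C\<close> by the Keller-Osserman bound on the ball of
  radius \<open>d\<close> inside the domain, and \<open>v \<ge> -2 ln d - C\<close> by the barrier at the nearest frontier point.\<close>

lemma blowup_solutions_bounded_difference:
  fixes \<Omega> :: "'a::euclidean_space set"
  assumes \<Omega>: "smooth_bounded_domain \<Omega>" and v: "boundary_blowup_solution \<Omega> v" and w: "boundary_blowup_solution \<Omega> w"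
  obtains K where "\<And>x. x \<in> \<Omega> \<Longrightarrow> w x \<le> v x + K"
proof -
  have op: "open \<Omega>" and bd: "bounded \<Omega>" and ne: "\<Omega> \<noteq> {}" using \<Omega> by (auto simp: smooth_bounded_domain_def)
  obtain C where C: "\<And>x z. x \<in> \<Omega> \<Longrightarrow> z \<in> frontier \<Omega> \<Longrightarrow> - 2 * ln (dist x z) - C \<le> v x"
    using boundary_blowup_solution_lower_bound[OF \<Omega> v] by blast
  have fne: "frontier \<Omega> \<noteq> {}"
    using ne bd not_bounded_UNIV by (auto simp: frontier_eq_empty)
  define c where "c = ln (4 * real DIM('a) + 8)"
  have "w x \<le> v x + (c + 2 * ln 2 + C)" if x: "x \<in> \<Omega>" for x
  proof -
    obtain z where z: "z \<in> frontier \<Omega>" "\<And>y. y \<in> frontier \<Omega> \<Longrightarrow> dist x z \<le> dist x y"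
      using distance_attains_inf[OF frontier_closed fne, of x] by blast
    define d where "d = dist x z"
    have "x \<noteq> z" using x z(1) op by (auto simp: frontier_def interior_open)
    then have d: "d > 0" by (simp add: d_def)
    have sub: "ball x d \<subseteq> \<Omega>"
    proof (rule ccontr)
      assume "\<not> ball x d \<subseteq> \<Omega>"
      then have "ball x d - \<Omega> \<noteq> {}" by blast
      moreover have "ball x d \<inter> \<Omega> \<noteq> {}" using x d by (metis Int_iff centre_in_ball empty_iff)
      ultimately obtain y where "y \<in> ball x d" "y \<in> frontier \<Omega>"
        using connected_Int_frontier[OF connected_ball] by blast
      then show False using z(2)[of y] by (simp add: d_def)
    qed
    have "w x \<le> c - 2 * ln (d / 2)"
      unfolding c_def using w sub
      by (intro Keller_Osserman_bound[OF d])
         (auto simp: boundary_blowup_solution_def intro: Ck_on_subset)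
    also have "\<dots> = c + 2 * ln 2 - 2 * ln d" using d by (simp add: ln_div)
    finally show ?thesis using C[OF x z(1)] by (simp add: d_def)
  qed
  then show ?thesis by (rule that)
qed

text \<open>As a limit of solutions with finite boundary values, \<open>v\<close> lies below every supersolution that is infinite on the
  frontier. Two such supersolutions give both inequalities: \<open>w\<close> itself and \<open>2v - w\<close>. The latter
  is a supersolution because \<open>e\<^sup>v\<close> is the geometric mean of \<open>e\<^sup>w\<close> and \<open>exp (2v - w)\<close>, and it
  blows up because \<open>w - v\<close> is bounded.\<close>

lemma boundary_blowup_solution_unique:
  fixes \<Omega> :: "'a::euclidean_space set"
  assumes \<Omega>: "smooth_bounded_domain \<Omega>" and v: "boundary_blowup_solution \<Omega> v"
    and minimal: "\<And>c. dirichlet_solution \<Omega> c (f c)" "\<And>x. x \<in> \<Omega> \<Longrightarrow> (\<lambda>n. f (real n) x) \<longlonglongrightarrow> v x"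
    and w: "boundary_blowup_solution \<Omega> w" and x: "x \<in> \<Omega>"
  shows "w x = v x"
proof -
  have op: "open \<Omega>" and bd: "bounded \<Omega>" using \<Omega> by (auto simp: smooth_bounded_domain_def)
  have v2: "Ck_on 2 \<Omega> v" "\<And>x. x \<in> \<Omega> \<Longrightarrow> laplacian v x = exp (v x)"
    "\<And>z. z \<in> frontier \<Omega> \<Longrightarrow> filterlim v at_top (at z within \<Omega>)"
    using v by (auto simp: boundary_blowup_solution_def)
  have w2: "Ck_on 2 \<Omega> w" "\<And>x. x \<in> \<Omega> \<Longrightarrow> laplacian w x = exp (w x)"
    "\<And>z. z \<in> frontier \<Omega> \<Longrightarrow> filterlim w at_top (at z within \<Omega>)"
    using w by (auto simp: boundary_blowup_solution_def)
  have below: "v x \<le> g x"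
    if g: "Ck_on 2 \<Omega> g" "\<And>x. x \<in> \<Omega> \<Longrightarrow> laplacian g x \<le> exp (g x)"
      "\<And>z. z \<in> frontier \<Omega> \<Longrightarrow> filterlim g at_top (at z within \<Omega>)" for g
  proof (rule LIMSEQ_le_const2[OF minimal(2)[OF x]])
    have "f c x \<le> g x" for c
    proof (rule dirichlet_solution_le[OF op bd minimal(1) g(1,2) _ x])
      show "eventually (\<lambda>x. c - e < g x) (at z within \<Omega>)" if "z \<in> frontier \<Omega>" for z e
        using g(3)[OF that] by (simp add: filterlim_at_top_dense)
    qed
    then show "\<exists>N. \<forall>n\<ge>N. f (real n) x \<le> g x" by blast
  qed
  obtain K where K: "\<And>x. x \<in> \<Omega> \<Longrightarrow> w x \<le> v x + K"
    using blowup_solutions_bounded_difference[OF \<Omega> v w] by blast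
  have "v x \<le> 2 * v x - w x"
  proof (rule below)
    note vv = Ck_on_cmult[OF op v2(1), of 2]
    show "Ck_on 2 \<Omega> (\<lambda>x. 2 * v x - w x)" by (rule Ck_on_diff[OF op vv w2(1)])
    show "laplacian (\<lambda>x. 2 * v x - w x) x \<le> exp (2 * v x - w x)" if x: "x \<in> \<Omega>" for x
    proof -
      have "laplacian (\<lambda>x. 2 * v x - w x) x = 2 * exp (v x) - exp (w x)"
        by (simp add: laplacian_diff[OF op vv w2(1) x] laplacian_cmult[OF op v2(1) x] v2(2)[OF x] w2(2)[OF x])
      also have "\<dots> \<le> exp (2 * v x - w x)"
      proof -
        have "0 \<le> (exp (v x - w x / 2) - exp (w x / 2))\<^sup>2" by simp
        also have "\<dots> = exp (2 * v x - w x) + exp (w x) - 2 * exp (v x)"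
          by (simp add: power2_eq_square algebra_simps flip: exp_add)
        finally show ?thesis by simp
      qed
      finally show ?thesis .
    qed
    show "filterlim (\<lambda>x. 2 * v x - w x) at_top (at z within \<Omega>)" if z: "z \<in> frontier \<Omega>" for z
      unfolding filterlim_at_top
    proof
      fix Z
      have "eventually (\<lambda>x. Z + K \<le> v x) (at z within \<Omega>)"
        using v2(3)[OF z] by (simp add: filterlim_at_top)
      moreover have "eventually (\<lambda>x. x \<in> \<Omega>) (at z within \<Omega>)" by (simp add: eventually_at_filter)
      ultimately show "eventually (\<lambda>x. Z \<le> 2 * v x - w x) (at z within \<Omega>)"
      proof eventually_elim
        case (elim x)
        then show ?case using K[OF elim(2)] by simp
      qed
    qed
  qed
  moreover have "v x \<le> w x" by (rule below) (use w2 in auto)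
  ultimately show ?thesis by simp
qed

section \<open>Asymptotic behaviour for large boundary values\<close>

lemma tendsto_Cinf_loc_cong_eventually:
  assumes "tendsto_Cinf_loc S f g F" "eventually (\<lambda>i. f' i = f i) F"
  shows "tendsto_Cinf_loc S f' g F"
  unfolding tendsto_Cinf_loc_def
proof (intro conjI allI impI)
  show "Cinf_on S g" using assms(1) by (simp add: tendsto_Cinf_loc_def)
  have "\<forall>\<^sub>F i in F. Cinf_on S (f i)" using assms(1) by (simp add: tendsto_Cinf_loc_def)
  with assms(2) show "\<forall>\<^sub>F i in F. Cinf_on S (f' i)" by eventually_elim simp
  fix K :: "'a set" and bs :: "'a list" assume "compact K \<and> K \<subseteq> S \<and> set bs \<subseteq> Basis"
  then have lim: "uniform_limit K (\<lambda>i. iterated_partial bs (f i)) (iterated_partial bs g) F"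
    using assms(1) by (simp add: tendsto_Cinf_loc_def)
  show "uniform_limit K (\<lambda>i. iterated_partial bs (f' i)) (iterated_partial bs g) F"
  proof (rule uniform_limitI)
    fix e :: real assume "e > 0"
    from uniform_limitD[OF lim this] assms(2)
    show "\<forall>\<^sub>F i in F. \<forall>x\<in>K. dist (iterated_partial bs (f' i) x) (iterated_partial bs g x) < e"
      by eventually_elim simp
  qed
qed

theorem corollary1p10:
  fixes \<Omega> :: "'a::euclidean_space set"
    and u :: "real \<Rightarrow> 'a \<Rightarrow> real"
  assumes "DIM('a) \<ge> 2"
    and "smooth_bounded_domain \<Omega>"
    and "\<And>l. l < 0 \<Longrightarrow> negative_solution \<Omega> l (u l)"
  shows "\<exists>v. boundary_blowup_solution \<Omega> v \<and>
             (\<forall>w. boundary_blowup_solution \<Omega> w \<longrightarrow> (\<forall>x\<in>\<Omega>. w x = v x)) \<and>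
             tendsto_Cinf_loc \<Omega> (\<lambda>l x. u l x - (- ln (- l) + v x)) (\<lambda>x. 0) at_bot \<and>
             Cinf_on \<Omega> v"
proof -
  have op: "open \<Omega>" and bd: "bounded \<Omega>" using assms(2) by (auto simp: smooth_bounded_domain_def)
  \<comment> \<open>Indexed by the boundary value \<open>c = ln (-\<lambda>)\<close>, which ranges over all reals.\<close>
  define w where "w = (\<lambda>c x. u (- exp c) x + c)"
  have w: "dirichlet_solution \<Omega> c (w c)" for c
    unfolding w_def by (rule dirichlet_solution_if_negative_solution[OF op assms(3)]) simp
  have w2: "Ck_on 2 \<Omega> (w c)" "\<And>x. x \<in> \<Omega> \<Longrightarrow> laplacian (w c) x = exp (w c x)" for c
    using w by (auto simp: dirichlet_solution_def)
  obtain v where v: "boundary_blowup_solution \<Omega> v" and wv: "\<And>c x. x \<in> \<Omega> \<Longrightarrow> w c x \<le> v x"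
    and lim: "\<And>x. x \<in> \<Omega> \<Longrightarrow> \<exists>r>0. uniform_limit (ball x r) (\<lambda>n. w (real n)) v sequentially"
    using large_solution_limit[OF op bd w] by blast
  have v2: "Ck_on 2 \<Omega> v" "\<And>x. x \<in> \<Omega> \<Longrightarrow> laplacian v x = exp (v x)"
    using v by (auto simp: boundary_blowup_solution_def)
  have Cv: "Cinf_on \<Omega> v" by (rule Cinf_on_if_laplacian_eq_exp[OF op v2])
  have Cw: "Cinf_on \<Omega> (w c)" for c by (rule Cinf_on_if_laplacian_eq_exp[OF op w2])
  have limx: "(\<lambda>n. w (real n) x) \<longlonglongrightarrow> v x" if x: "x \<in> \<Omega>" for x
  proof -
    obtain r where "r > 0" "uniform_limit (ball x r) (\<lambda>n. w (real n)) v sequentially" using lim[OF x] by blast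
    then show ?thesis by (intro tendsto_uniform_limitI) auto
  qed
  have C0: "Ck_tendsto 0 \<Omega> (\<lambda>l. w (ln (- l))) v at_bot"
    unfolding Ck_tendsto.simps(1)
  proof (intro allI impI, elim conjE)
    fix K assume K: "compact K" "K \<subseteq> \<Omega>"
    \<comment> \<open>By monotonicity, integer boundary values control all larger ones: \<open>w n \<le> w c \<le> v\<close> for \<open>c \<ge> n\<close>.\<close>
    have ul: "uniform_limit K (\<lambda>n. w (real n)) v sequentially"
      by (rule uniform_limit_compact_if_locally[OF lim K])
    show "uniform_limit K (\<lambda>l. w (ln (- l))) v at_bot"
    proof (rule uniform_limitI)
      fix e :: real assume "e > 0"
      from eventually_happens[OF uniform_limitD[OF ul this]]
      obtain n where n: "\<And>x. x \<in> K \<Longrightarrow> dist (w (real n) x) (v x) < e" by auto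
      have "eventually (\<lambda>l. l \<le> - exp (real n)) at_bot" by (rule eventually_le_at_bot)
      then show "\<forall>\<^sub>F l in at_bot. \<forall>x\<in>K. dist (w (ln (- l)) x) (v x) < e"
      proof eventually_elim
        case (elim l)
        have "ln (exp (real n)) \<le> ln (- l)" using elim exp_gt_zero[of "real n"] by (subst ln_le_cancel_iff) linarith+
        then have nl: "real n \<le> ln (- l)" by simp
        show ?case
        proof
          fix x assume x: "x \<in> K"
          then have "x \<in> \<Omega>" using K by blast
          then have "w (real n) x \<le> w (ln (- l)) x" "w (ln (- l)) x \<le> v x"
            using dirichlet_solution_mono[OF op bd w w nl] wv by auto
          then show "dist (w (ln (- l)) x) (v x) < e" using n[OF x] by (simp add: dist_real_def)
        qed
      qed
    qed
  qed
  have "Ck_tendsto k \<Omega> (\<lambda>l. w (ln (- l))) v at_bot" for k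
    by (rule Ck_tendsto_if_laplacian_eq_exp[OF op Cw Cv w2(2) v2(2) C0])
  then have T: "tendsto_Cinf_loc \<Omega> (\<lambda>l x. w (ln (- l)) x - v x) (\<lambda>x. 0) at_bot"
    by (rule tendsto_Cinf_loc_diff[OF op Cw Cv])
  have "eventually (\<lambda>l. l < (0::real)) at_bot" by (rule eventually_gt_at_bot)
  then have "eventually (\<lambda>l. (\<lambda>x. u l x - (- ln (- l) + v x)) = (\<lambda>x. w (ln (- l)) x - v x)) at_bot"
    by eventually_elim (simp add: w_def fun_eq_iff)
  with T have "tendsto_Cinf_loc \<Omega> (\<lambda>l x. u l x - (- ln (- l) + v x)) (\<lambda>x. 0) at_bot"
    by (rule tendsto_Cinf_loc_cong_eventually)
  moreover have "w' x = v x" if "boundary_blowup_solution \<Omega> w'" "x \<in> \<Omega>" for w' x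
    by (rule boundary_blowup_solution_unique[OF assms(2) v w limx that])
  ultimately show ?thesis using v Cv by blast
qed

end
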